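(* Let $\mathcal{G}$ be a finite group acting by ring automorphisms on a commutative ring $R$ such that $R$ is noetherian as an $R^{\mathcal{G}}$-module. Assume that $R$ and $R^{\mathcal{G}}$ are Cohen-Macaulay. Let $k$ be a non-negative integer. If $H^i(\mathcal{G},R) = 0$ for all $0 < i < k$, then the restriction map $$\operatorname{res}^{\mathcal{G}}_{\mathfrak{X}_{k+1}} \colon H^k(\mathcal{G},R) \to \prod_{\mathcal{H} \in \mathfrak{X}_{k+1}} H^k(\mathcal{H},R)$$ is injective.
   Context: $R^{\mathcal{G}}$ is the subring of $\mathcal{G}$-invariants of $R$, and $H^*(\mathcal{G},R)$ is ordinary group cohomology. For $g \in \mathcal{G}$ let $I_R(g) = \sum_{r \in R} (g(r)-r)R$, an ideal of $R$, and for a subgroup $\mathcal{H} \le \mathcal{G}$ let $I_R(\mathcal{H}) = \sum_{g \in \mathcal{H}} I_R(g)$. For an integer $j \geq 0$ put $\mathfrak{X}_j = \{ \mathcal{H} \le \mathcal{G} \mid \operatorname{height} I_R(\mathcal{H}) \le j \}$, where the height of an ideal is the infimum of the heights of the prime ideals containing it (and the improper ideal has height $\infty$). The map $\operatorname{res}^{\mathcal{G}}_{\mathfrak{X}_{k+1}}$ has as components the usual restriction maps $H^k(\mathcal{G},R) \to H^k(\mathcal{H},R)$. *)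

theory Defs
  imports "HOL-Algebra.Algebra" "HOL-Library.Extended_Nat"
begin

section \<open>Heights, depth and Cohen-Macaulay rings\<close>

definition prime_height :: "('a, 'b) ring_scheme \<Rightarrow> 'a set \<Rightarrow> enat" where
  "prime_height R P =
     Sup {enat n | n. \<exists>p. (\<forall>i\<le>n. primeideal (p i) R) \<and> (\<forall>i<n. p i \<subset> p (Suc i)) \<and> p n = P}"

text \<open>The infimum of the empty set in \<^typ>\<open>enat\<close> is \<open>\<infinity>\<close>, so the improper ideal has height \<open>\<infinity>\<close>.\<close>

definition ideal_height :: "('a, 'b) ring_scheme \<Rightarrow> 'a set \<Rightarrow> enat" where
  "ideal_height R I = (INF P \<in> {P. primeideal P R \<and> I \<subseteq> P}. prime_height R P)"

definition krull_dim :: "('a, 'b) ring_scheme \<Rightarrow> enat" where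
  "krull_dim R = (SUP P \<in> {P. primeideal P R}. prime_height R P)"

text \<open>The second conjunct says that \<open>xs ! i\<close> is a non-zero-divisor modulo the ideal generated by
  its predecessors.\<close>

definition regular_sequence :: "('a, 'b) ring_scheme \<Rightarrow> 'a list \<Rightarrow> bool" where
  "regular_sequence R xs \<longleftrightarrow>
     set xs \<subseteq> carrier R \<and>
     (\<forall>i<length xs. \<forall>a\<in>carrier R.
        xs ! i \<otimes>\<^bsub>R\<^esub> a \<in> Idl\<^bsub>R\<^esub> (set (take i xs)) \<longrightarrow> a \<in> Idl\<^bsub>R\<^esub> (set (take i xs))) \<and>
     Idl\<^bsub>R\<^esub> (set xs) \<noteq> carrier R"

definition ideal_depth :: "('a, 'b) ring_scheme \<Rightarrow> 'a set \<Rightarrow> enat" where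
  "ideal_depth R I = (SUP xs \<in> {xs. regular_sequence R xs \<and> set xs \<subseteq> I}. enat (length xs))"

text \<open>The localization of \<open>R\<close> at a multiplicative set \<open>S\<close>: fractions are classes of pairs
  (numerator, denominator).\<close>

definition frac_rel :: "('a, 'b) ring_scheme \<Rightarrow> 'a set \<Rightarrow> (('a \<times> 'a) \<times> ('a \<times> 'a)) set" where
  "frac_rel R S = {((a, s), (b, t)) | a s b t.
     a \<in> carrier R \<and> b \<in> carrier R \<and> s \<in> S \<and> t \<in> S \<and>
     (\<exists>u\<in>S. u \<otimes>\<^bsub>R\<^esub> (a \<otimes>\<^bsub>R\<^esub> t \<ominus>\<^bsub>R\<^esub> b \<otimes>\<^bsub>R\<^esub> s) = \<zero>\<^bsub>R\<^esub>)}"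

definition frac_class :: "('a, 'b) ring_scheme \<Rightarrow> 'a set \<Rightarrow> 'a \<Rightarrow> 'a \<Rightarrow> ('a \<times> 'a) set" where
  "frac_class R S a s = frac_rel R S `` {(a, s)}"

definition localization :: "('a, 'b) ring_scheme \<Rightarrow> 'a set \<Rightarrow> ('a \<times> 'a) set ring" where
  "localization R S =
     \<lparr>carrier = (carrier R \<times> S) // frac_rel R S,
      monoid.mult = (\<lambda>p q. \<Union>(a, s)\<in>p. \<Union>(b, t)\<in>q. frac_class R S (a \<otimes>\<^bsub>R\<^esub> b) (s \<otimes>\<^bsub>R\<^esub> t)),
      monoid.one = frac_class R S \<one>\<^bsub>R\<^esub> \<one>\<^bsub>R\<^esub>,
      ring.zero = frac_class R S \<zero>\<^bsub>R\<^esub> \<one>\<^bsub>R\<^esub>,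
      ring.add = (\<lambda>p q. \<Union>(a, s)\<in>p. \<Union>(b, t)\<in>q.
               frac_class R S (a \<otimes>\<^bsub>R\<^esub> t \<oplus>\<^bsub>R\<^esub> b \<otimes>\<^bsub>R\<^esub> s) (s \<otimes>\<^bsub>R\<^esub> t))\<rparr>"

definition cohen_macaulay_local :: "('a, 'b) ring_scheme \<Rightarrow> bool" where
  "cohen_macaulay_local A \<longleftrightarrow>
     cring A \<and> noetherian_ring A \<and>
     (\<exists>M. maximalideal M A \<and> (\<forall>M'. maximalideal M' A \<longrightarrow> M' = M) \<and>
          ideal_depth A M = krull_dim A)"

text \<open>All local rings of \<open>R\<close> are required to be Cohen-Macaulay, as in the Stacks project; asking
  this only at maximal ideals gives the same class of rings. The zero ring qualifies.\<close>

definition cohen_macaulay :: "('a, 'b) ring_scheme \<Rightarrow> bool" where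
  "cohen_macaulay R \<longleftrightarrow>
     cring R \<and> noetherian_ring R \<and>
     (\<forall>P. primeideal P R \<longrightarrow> cohen_macaulay_local (localization R (carrier R - P)))"


section \<open>Noetherian modules\<close>

locale noetherian_module = module +
  assumes finitely_generated:
    "submodule N R M \<Longrightarrow> \<exists>A\<subseteq>N. finite A \<and> N = \<Inter>{N'. submodule N' R M \<and> A \<subseteq> N'}"

text \<open>A ring regarded as a module, by multiplication, over any of its subrings.\<close>

definition mult_module :: "('a, 'b) ring_scheme \<Rightarrow> ('a, 'a) module" where
  "mult_module R =
     \<lparr>carrier = carrier R, monoid.mult = (\<otimes>\<^bsub>R\<^esub>), monoid.one = \<one>\<^bsub>R\<^esub>, ring.zero = \<zero>\<^bsub>R\<^esub>, ring.add = (\<oplus>\<^bsub>R\<^esub>),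
      module.smult = (\<otimes>\<^bsub>R\<^esub>)\<rparr>"


section \<open>Invariants and the ideals of a group action on a ring\<close>

definition invariant_ring ::
  "('g, 'm) monoid_scheme \<Rightarrow> ('r, 'n) ring_scheme \<Rightarrow> ('g \<Rightarrow> 'r \<Rightarrow> 'r) \<Rightarrow> ('r, 'n) ring_scheme" where
  "invariant_ring G R \<phi> = R\<lparr>carrier := {r \<in> carrier R. \<forall>g\<in>carrier G. \<phi> g r = r}\<rparr>"

definition displacement_ideal ::
  "('r, 'n) ring_scheme \<Rightarrow> ('g \<Rightarrow> 'r \<Rightarrow> 'r) \<Rightarrow> 'g \<Rightarrow> 'r set" where
  "displacement_ideal R \<phi> g = Idl\<^bsub>R\<^esub> {\<phi> g r \<ominus>\<^bsub>R\<^esub> r | r. r \<in> carrier R}"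

definition displacement_ideal_of ::
  "('r, 'n) ring_scheme \<Rightarrow> ('g \<Rightarrow> 'r \<Rightarrow> 'r) \<Rightarrow> 'g set \<Rightarrow> 'r set" where
  "displacement_ideal_of R \<phi> H = Idl\<^bsub>R\<^esub> (\<Union>g\<in>H. displacement_ideal R \<phi> g)"

definition height_subgroups ::
  "('g, 'm) monoid_scheme \<Rightarrow> ('r, 'n) ring_scheme \<Rightarrow> ('g \<Rightarrow> 'r \<Rightarrow> 'r) \<Rightarrow> nat \<Rightarrow> 'g set set" where
  "height_subgroups G R \<phi> j =
     {H. subgroup H G \<and> ideal_height R (displacement_ideal_of R \<phi> H) \<le> enat j}"


section \<open>Group cohomology\<close>

text \<open>Cohomology is computed by the homogeneous cochain complex, that is from the standard
  resolution: an \<open>n\<close>-cochain is an equivariant function from \<open>(n + 1)\<close>-tuples of group elements to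
  the coefficients, and the differential is the alternating sum over the omission of one entry.
  Only the additive group of \<open>M\<close> is used.\<close>

definition tuples :: "('g, 'm) monoid_scheme \<Rightarrow> nat \<Rightarrow> 'g list set" where
  "tuples G n = {xs. length xs = n \<and> set xs \<subseteq> carrier G}"

definition cochains ::
  "('g, 'm) monoid_scheme \<Rightarrow> ('r, 'n) ring_scheme \<Rightarrow> ('g \<Rightarrow> 'r \<Rightarrow> 'r) \<Rightarrow> nat \<Rightarrow> ('g list \<Rightarrow> 'r) set" where
  "cochains G M \<phi> n =
     {f \<in> tuples G (Suc n) \<rightarrow>\<^sub>E carrier M.
        \<forall>g\<in>carrier G. \<forall>xs\<in>tuples G (Suc n). f (map (\<lambda>x. g \<otimes>\<^bsub>G\<^esub> x) xs) = \<phi> g (f xs)}"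

definition differential ::
  "('g, 'm) monoid_scheme \<Rightarrow> ('r, 'n) ring_scheme \<Rightarrow> nat \<Rightarrow> ('g list \<Rightarrow> 'r) \<Rightarrow> 'g list \<Rightarrow> 'r" where
  "differential G M n f =
     (\<lambda>xs\<in>tuples G (Suc (Suc n)).
        \<Oplus>\<^bsub>M\<^esub>i\<in>{..Suc n}.
          (if even i then f (take i xs @ drop (Suc i) xs)
           else \<ominus>\<^bsub>M\<^esub> f (take i xs @ drop (Suc i) xs)))"

definition zero_cochain ::
  "('g, 'm) monoid_scheme \<Rightarrow> ('r, 'n) ring_scheme \<Rightarrow> nat \<Rightarrow> 'g list \<Rightarrow> 'r" where
  "zero_cochain G M n = (\<lambda>xs\<in>tuples G (Suc n). \<zero>\<^bsub>M\<^esub>)"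

definition cocycle_group ::
  "('g, 'm) monoid_scheme \<Rightarrow> ('r, 'n) ring_scheme \<Rightarrow> ('g \<Rightarrow> 'r \<Rightarrow> 'r) \<Rightarrow> nat \<Rightarrow> ('g list \<Rightarrow> 'r) monoid" where
  "cocycle_group G M \<phi> n =
     \<lparr>carrier = {f \<in> cochains G M \<phi> n. differential G M n f = zero_cochain G M (Suc n)},
      monoid.mult = (\<lambda>f f'. \<lambda>xs\<in>tuples G (Suc n). f xs \<oplus>\<^bsub>M\<^esub> f' xs),
      monoid.one = zero_cochain G M n\<rparr>"

fun coboundaries ::
  "('g, 'm) monoid_scheme \<Rightarrow> ('r, 'n) ring_scheme \<Rightarrow> ('g \<Rightarrow> 'r \<Rightarrow> 'r) \<Rightarrow> nat \<Rightarrow> ('g list \<Rightarrow> 'r) set" where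
  "coboundaries G M \<phi> 0 = {zero_cochain G M 0}"
| "coboundaries G M \<phi> (Suc n) = differential G M n ` cochains G M \<phi> n"

definition cohomology ::
  "('g, 'm) monoid_scheme \<Rightarrow> ('r, 'n) ring_scheme \<Rightarrow> ('g \<Rightarrow> 'r \<Rightarrow> 'r) \<Rightarrow> nat \<Rightarrow> ('g list \<Rightarrow> 'r) set monoid" where
  "cohomology G M \<phi> n = cocycle_group G M \<phi> n Mod coboundaries G M \<phi> n"

text \<open>Restriction sends the class of a cocycle \<open>c\<close> to the class of its restriction to tuples from
  \<open>H\<close>. That class does not depend on the representative, so the union over all representatives is
  a union of equal cosets.\<close>

definition cohomology_res ::
  "('g, 'm) monoid_scheme \<Rightarrow> ('r, 'n) ring_scheme \<Rightarrow> ('g \<Rightarrow> 'r \<Rightarrow> 'r) \<Rightarrow> nat \<Rightarrow> 'g set \<Rightarrow>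
   ('g list \<Rightarrow> 'r) set \<Rightarrow> ('g list \<Rightarrow> 'r) set" where
  "cohomology_res G M \<phi> n H \<xi> =
     (let K = G\<lparr>carrier := H\<rparr> in
      \<Union>c\<in>\<xi>. coboundaries K M \<phi> n #>\<^bsub>cocycle_group K M \<phi> n\<^esub> restrict c (tuples K (Suc n)))"

text \<open>The map with components \<open>cohomology_res\<close>, with values in the carrier of
  \<open>product_group \<XX> (\<lambda>H. cohomology (G\<lparr>carrier := H\<rparr>) M \<phi> n)\<close>.\<close>

definition cohomology_res_family ::
  "('g, 'm) monoid_scheme \<Rightarrow> ('r, 'n) ring_scheme \<Rightarrow> ('g \<Rightarrow> 'r \<Rightarrow> 'r) \<Rightarrow> nat \<Rightarrow> 'g set set \<Rightarrow>
   ('g list \<Rightarrow> 'r) set \<Rightarrow> 'g set \<Rightarrow> ('g list \<Rightarrow> 'r) set" where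
  "cohomology_res_family G M \<phi> n \<XX> \<xi> = (\<lambda>H\<in>\<XX>. cohomology_res G M \<phi> n H \<xi>)"

end

theory Submission
  imports Defs
begin

text \<open>Write \<open>S\<close> for the ring of invariants. The standard complex, augmented by \<open>S\<close>, is exact below
  degree \<open>k\<close> by hypothesis, and its terms are sums of copies of \<open>R\<close> apart from the
  augmentation \<open>S\<close>. Let \<open>c\<close> be a class of degree \<open>k\<close> whose restrictions vanish, with annihilator
  \<open>a\<close> in \<open>S\<close>. If \<open>P\<close> is a prime of \<open>R\<close> of height at most \<open>k + 1\<close>, its inertia group \<open>H\<close> belongs to the family;
  since \<open>c\<close> vanishes on \<open>H\<close>, it is annihilated by the transfer from \<open>H\<close> to \<open>G\<close> of every \<open>H\<close>-invariant, and
  independence of characters modulo \<open>P\<close> gives such a transfer outside \<open>P\<close>. Hence \<open>a\<close> lies in no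
  prime of height at most \<open>k + 1\<close>, so by unmixedness it contains \<open>k + 2\<close> elements forming a regular sequence
  on both \<open>R\<close> and \<open>S\<close>. Dividing these out one after the other moves \<open>c\<close> down the complex
  to an element of \<open>S\<close> modulo \<open>k + 1\<close> of them that is killed by the last one; so \<open>c = 0\<close>.\<close>

section \<open>Ideals, associated primes and regular elements\<close>

text \<open>The sequence has to be regular on every term of the augmented complex at once. In
  positive places an equivariant function is given by arbitrary values on tuples starting with the
  unit, so the term is a power of \<open>R\<close>; in place 0 the term is \<open>S\<close> itself,
  and there the Cohen-Macaulay property of \<open>S\<close> enters. Unmixedness bounds heights in
  \<open>S\<close>, and a prime of \<open>R\<close> over a prime of \<open>S\<close> has at most the
  same height, so the information about primes of \<open>R\<close> is enough for both rings. The
  number k + 2 counts places: the class sits in place k + 1, each of k + 1 divisions lowers the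
  place by one, and place 0 still needs one regular element. The obstacle in the transfer is that an
  element outside the inertia group of \<open>P\<close> may map \<open>P\<close> to itself. It then
  acts on \<open>R/P\<close> differently from the identity, and the orbit polynomial of
  \<open>r\<close> under the inertia group, the product of all \<open>X - h r\<close>, shows that
  this is already visible on the invariants of that group; independence of characters needs exactly
  this. For k = 0 the augmented complex sees only the cohomology modulo invariants, so that case
  rests on the trivial subgroup instead.\<close>

definition colon_ideal :: "('a, 'b) ring_scheme \<Rightarrow> 'a set \<Rightarrow> 'a \<Rightarrow> 'a set" where
  "colon_ideal R K u = {a \<in> carrier R. a \<otimes>\<^bsub>R\<^esub> u \<in> K}"

text \<open>The associated primes of the module \<open>R/K\<close>. Everything is phrased with
  elements and ideals of \<open>R\<close>, so no quotient ring is formed.\<close>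

definition assoc_primes :: "('a, 'b) ring_scheme \<Rightarrow> 'a set \<Rightarrow> 'a set set" where
  "assoc_primes R K = {P. primeideal P R \<and> (\<exists>u\<in>carrier R. P = colon_ideal R K u)}"

definition ideal_adjoin :: "('a, 'b) ring_scheme \<Rightarrow> 'a set \<Rightarrow> 'a \<Rightarrow> 'a set" where
  "ideal_adjoin R K x = {k \<oplus>\<^bsub>R\<^esub> x \<otimes>\<^bsub>R\<^esub> r | k r. k \<in> K \<and> r \<in> carrier R}"

definition regular_mod :: "('a, 'b) ring_scheme \<Rightarrow> 'a set \<Rightarrow> 'a \<Rightarrow> bool" where
  "regular_mod R K x \<longleftrightarrow> (\<forall>a\<in>carrier R. x \<otimes>\<^bsub>R\<^esub> a \<in> K \<longrightarrow> a \<in> K)"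

lemma regular_modD:
  "\<lbrakk>regular_mod R K x; a \<in> carrier R; x \<otimes>\<^bsub>R\<^esub> a \<in> K\<rbrakk> \<Longrightarrow> a \<in> K"
  by (simp add: regular_mod_def)

context cring
begin

lemma ideal_minus_closed: "\<lbrakk>ideal K R; a \<in> K; b \<in> K\<rbrakk> \<Longrightarrow> a \<ominus> b \<in> K"
  by (simp add: ideal.axioms(1) additive_subgroup.a_closed additive_subgroup.a_inv_closed minus_eq)

lemma ideal_add_closed: "\<lbrakk>ideal K R; a \<in> K; b \<in> K\<rbrakk> \<Longrightarrow> a \<oplus> b \<in> K"
  by (simp add: ideal.axioms(1) additive_subgroup.a_closed)

lemma ideal_zero_closed: "ideal K R \<Longrightarrow> \<zero> \<in> K"
  by (simp add: ideal.axioms(1) additive_subgroup.zero_closed)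

lemma ideal_add_cancel:
  assumes "ideal K R" "a \<in> carrier R" "b \<in> K" "a \<oplus> b \<in> K"
  shows "a \<in> K"
proof -
  have b: "b \<in> carrier R" using assms ideal.Icarr by fastforce
  have "a = (a \<oplus> b) \<ominus> b" using assms(2) b by algebra
  then show ?thesis using ideal_minus_closed[OF assms(1,4,3)] by simp
qed

lemma idealI_cring:
  assumes "I \<subseteq> carrier R" "I \<noteq> {}"
    and "\<And>a b. a \<in> I \<Longrightarrow> b \<in> I \<Longrightarrow> a \<oplus> b \<in> I"
    and "\<And>a x. a \<in> I \<Longrightarrow> x \<in> carrier R \<Longrightarrow> x \<otimes> a \<in> I"
  shows "ideal I R"
proof (rule idealI[OF ring_axioms])
  have "\<ominus> a \<in> I" if "a \<in> I" for a
  proof -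
    have "\<ominus> a = \<ominus> \<one> \<otimes> a" using that assms(1) by (simp add: l_minus subsetD)
    then show ?thesis using assms(4)[OF that, of "\<ominus> \<one>"] by simp
  qed
  then show "subgroup I (add_monoid R)"
    using assms by (intro add.subgroupI) (auto simp: a_inv_def)
  show "a \<otimes> x \<in> I" if "a \<in> I" "x \<in> carrier R" for a x
    using assms(1,4) that m_comm by (metis subsetD)
qed (use assms in auto)

lemma colon_ideal_ideal:
  assumes "ideal K R" "u \<in> carrier R"
  shows "ideal (colon_ideal R K u) R"
proof -
  interpret K: ideal K R by fact
  show ?thesis
  proof (rule idealI_cring)
    show "colon_ideal R K u \<noteq> {}"
      using assms K.zero_closed by (auto simp: colon_ideal_def intro!: exI[of _ \<zero>])
  qed (use assms K.I_l_closed K.a_closed in \<open>auto simp: colon_ideal_def l_distr m_assoc\<close>)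
qed

lemma ideal_adjoinI:
  "\<lbrakk>y = k \<oplus> x \<otimes> r; k \<in> K; r \<in> carrier R\<rbrakk> \<Longrightarrow> y \<in> ideal_adjoin R K x"
  by (auto simp: ideal_adjoin_def)

lemma ideal_adjoinE:
  assumes "y \<in> ideal_adjoin R K x"
  obtains k r where "y = k \<oplus> x \<otimes> r" "k \<in> K" "r \<in> carrier R"
  using assms by (auto simp: ideal_adjoin_def)

lemma ideal_adjoin_ideal:
  assumes "ideal K R" "x \<in> carrier R"
  shows "ideal (ideal_adjoin R K x) R"
proof -
  interpret K: ideal K R by fact
  show ?thesis
  proof (rule idealI_cring)
    show "ideal_adjoin R K x \<noteq> {}"
      using ideal_adjoinI[OF refl K.zero_closed zero_closed] by blast
    show "ideal_adjoin R K x \<subseteq> carrier R"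
      using assms by (auto simp: ideal_adjoin_def)
    show "a \<oplus> b \<in> ideal_adjoin R K x"
      if "a \<in> ideal_adjoin R K x" "b \<in> ideal_adjoin R K x" for a b
    proof -
      from that obtain k r l s where *: "a = k \<oplus> x \<otimes> r" "b = l \<oplus> x \<otimes> s"
        "k \<in> K" "l \<in> K" "r \<in> carrier R" "s \<in> carrier R" by (auto simp: ideal_adjoin_def)
      then have "a \<oplus> b = (k \<oplus> l) \<oplus> x \<otimes> (r \<oplus> s)"
        using assms(2) K.Icarr by algebra
      then show ?thesis by (rule ideal_adjoinI) (use * in auto)
    qed
    show "y \<otimes> a \<in> ideal_adjoin R K x" if "a \<in> ideal_adjoin R K x" "y \<in> carrier R" for a y
    proof -
      from that obtain k r where *: "a = k \<oplus> x \<otimes> r" "k \<in> K" "r \<in> carrier R"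
        by (auto simp: ideal_adjoin_def)
      then have "y \<otimes> a = y \<otimes> k \<oplus> x \<otimes> (y \<otimes> r)"
        using assms(2) K.Icarr that(2) by algebra
      then show ?thesis by (rule ideal_adjoinI) (use * K.I_l_closed that(2) in auto)
    qed
  qed
qed

lemma subset_ideal_adjoin:
  assumes "ideal K R" "x \<in> carrier R"
  shows "K \<subseteq> ideal_adjoin R K x"
proof
  fix k assume "k \<in> K"
  then have "k = k \<oplus> x \<otimes> \<zero>" using assms by (simp add: ideal.Icarr)
  then show "k \<in> ideal_adjoin R K x" by (rule ideal_adjoinI) (use \<open>k \<in> K\<close> in auto)
qed

lemma mem_ideal_adjoin:
  assumes "ideal K R" "x \<in> carrier R"
  shows "x \<in> ideal_adjoin R K x"
proof -
  have "x = \<zero> \<oplus> x \<otimes> \<one>" using assms by simp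
  then show ?thesis by (rule ideal_adjoinI) (use ideal_zero_closed[OF assms(1)] in auto)
qed

lemma ideal_adjoin_least:
  assumes "ideal J R" "K \<subseteq> J" "x \<in> J"
  shows "ideal_adjoin R K x \<subseteq> J"
  using assms by (auto simp: ideal_adjoin_def intro!: ideal_add_closed ideal.I_r_closed)

lemma ideal_adjoin_comm:
  assumes "ideal K R" "x \<in> carrier R" "y \<in> carrier R"
  shows "ideal_adjoin R (ideal_adjoin R K x) y = ideal_adjoin R (ideal_adjoin R K y) x"
proof -
  have "ideal_adjoin R (ideal_adjoin R K x) y \<subseteq> ideal_adjoin R (ideal_adjoin R K y) x"
    if "x \<in> carrier R" "y \<in> carrier R" for x y
  proof (intro ideal_adjoin_least)
    show "y \<in> ideal_adjoin R (ideal_adjoin R K y) x"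
      using subset_ideal_adjoin[OF ideal_adjoin_ideal[OF assms(1) that(2)] that(1)]
        mem_ideal_adjoin[OF assms(1) that(2)] by blast
    show "x \<in> ideal_adjoin R (ideal_adjoin R K y) x"
      using mem_ideal_adjoin[OF ideal_adjoin_ideal[OF assms(1) that(2)] that(1)] .
    show "K \<subseteq> ideal_adjoin R (ideal_adjoin R K y) x"
      using subset_ideal_adjoin[OF assms(1) that(2)]
        subset_ideal_adjoin[OF ideal_adjoin_ideal[OF assms(1) that(2)] that(1)] by blast
  qed (use assms that ideal_adjoin_ideal in auto)
  then show ?thesis using assms by blast
qed

lemma genideal_insert:
  assumes "A \<subseteq> carrier R" "x \<in> carrier R"
  shows "Idl (insert x A) = ideal_adjoin R (Idl A) x"
proof
  have I: "ideal (Idl A) R" using assms genideal_ideal by blast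
  have "insert x A \<subseteq> ideal_adjoin R (Idl A) x"
    using mem_ideal_adjoin[OF I assms(2)] subset_ideal_adjoin[OF I assms(2)] genideal_self[OF assms(1)]
    by blast
  then show "Idl (insert x A) \<subseteq> ideal_adjoin R (Idl A) x"
    using genideal_minimal ideal_adjoin_ideal I assms by blast
  have "insert x A \<subseteq> Idl (insert x A)" "ideal (Idl (insert x A)) R"
    using assms genideal_self[of "insert x A"] genideal_ideal[of "insert x A"] by auto
  then show "ideal_adjoin R (Idl A) x \<subseteq> Idl (insert x A)"
    using genideal_minimal[of "Idl (insert x A)" A] by (intro ideal_adjoin_least) auto
qed

lemma mem_colon_ideal: "a \<in> colon_ideal R K u \<longleftrightarrow> a \<in> carrier R \<and> a \<otimes> u \<in> K"
  by (simp add: colon_ideal_def)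

lemma colon_ideal_proper:
  assumes "ideal K R" "u \<in> carrier R"
  shows "colon_ideal R K u \<noteq> carrier R \<longleftrightarrow> u \<notin> K"
proof -
  interpret K: ideal K R by fact
  show ?thesis using assms K.I_l_closed
    by (auto simp: colon_ideal_def) (metis (mono_tags, lifting) l_one mem_Collect_eq one_closed)
qed

lemma assoc_prime_subset:
  assumes "ideal K R" "P \<in> assoc_primes R K"
  shows "K \<subseteq> P"
  using assms by (auto simp: assoc_primes_def mem_colon_ideal ideal.I_r_closed ideal.Icarr)

lemma assoc_primeE:
  assumes "ideal K R" "P \<in> assoc_primes R K"
  obtains u where "primeideal P R" "u \<in> carrier R" "u \<notin> K" "P = colon_ideal R K u"
proof -
  from assms obtain u where u: "primeideal P R" "u \<in> carrier R" "P = colon_ideal R K u"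
    by (auto simp: assoc_primes_def)
  then have "u \<notin> K" using colon_ideal_proper[OF assms(1) u(2)] primeideal.I_notcarr by metis
  then show thesis using u that by blast
qed

end

section \<open>Noetherian induction and associated primes\<close>

context noetherian_ring
begin

text \<open>Zorn's lemma applies because a nonempty chain of ideals in a noetherian ring contains
  its own union.\<close>

lemma maximal_ideal_exists:
  assumes "\<I> \<noteq> {}" "\<And>I. I \<in> \<I> \<Longrightarrow> ideal I R"
  shows "\<exists>M\<in>\<I>. \<forall>I\<in>\<I>. M \<subseteq> I \<longrightarrow> I = M"
proof (rule subset_Zorn_nonempty)
  show "\<Union> \<C> \<in> \<I>" if "\<C> \<noteq> {}" "subset.chain \<I> \<C>" for \<C>
  proof -
    have "subset.chain {I. ideal I R} \<C>"
      using that(2) assms(2) unfolding subset.chain_def by blast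
    then have "\<Union> \<C> \<in> \<C>" using ideal_chain_is_trivial that(1) by blast
    then show ?thesis using that(2) unfolding subset.chain_def by blast
  qed
qed (use assms in auto)

lemma noetherian_induct:
  assumes "ideal K R"
    and "\<And>K. ideal K R \<Longrightarrow> (\<And>L. ideal L R \<Longrightarrow> K \<subset> L \<Longrightarrow> Q L) \<Longrightarrow> Q K"
  shows "Q K"
proof (rule ccontr)
  assume "\<not> Q K"
  then obtain M where M: "ideal M R" "\<not> Q M" "\<And>I. ideal I R \<Longrightarrow> \<not> Q I \<Longrightarrow> M \<subseteq> I \<Longrightarrow> I = M"
    using maximal_ideal_exists[of "{I. ideal I R \<and> \<not> Q I}"] assms(1)
    by (metis (no_types, lifting) empty_iff mem_Collect_eq)
  then show False using assms(2)[OF M(1)] by blast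
qed

end

locale noetherian_cring = cring + noetherian_ring
begin

text \<open>A maximal one among the colon ideals of elements \<open>b\<close> outside
  \<open>K\<close> is prime: if \<open>y b\<close> is not in \<open>K\<close>, its colon ideal
  contains that of \<open>b\<close>, hence equals it, and \<open>x y b\<close> in \<open>K\<close>
  puts \<open>x\<close> into it.\<close>

lemma colon_ideal_in_assoc_prime:
  assumes K: "ideal K R" and a: "a \<in> carrier R" "a \<notin> K"
  shows "\<exists>P\<in>assoc_primes R K. colon_ideal R K a \<subseteq> P"
proof -
  interpret K: ideal K R by fact
  define \<I> where "\<I> = {colon_ideal R K b | b. b \<in> carrier R \<and> b \<notin> K \<and> colon_ideal R K a \<subseteq> colon_ideal R K b}"
  have "\<exists>M\<in>\<I>. \<forall>I\<in>\<I>. M \<subseteq> I \<longrightarrow> I = M"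
    using assms colon_ideal_ideal by (intro maximal_ideal_exists) (auto simp: \<I>_def)
  then obtain M where M: "M \<in> \<I>" "\<And>I. I \<in> \<I> \<Longrightarrow> M \<subseteq> I \<Longrightarrow> I = M" by blast
  then obtain b where bM: "M = colon_ideal R K b" and b: "b \<in> carrier R" "b \<notin> K" "colon_ideal R K a \<subseteq> colon_ideal R K b"
    unfolding \<I>_def by blast
  have max: "colon_ideal R K c = colon_ideal R K b"
    if "c \<in> carrier R" "c \<notin> K" "colon_ideal R K b \<subseteq> colon_ideal R K c" for c
  proof -
    have "colon_ideal R K c \<in> \<I>" using that b(3) unfolding \<I>_def by blast
    then show ?thesis using M(2) that(3) bM by simp
  qed
  have "primeideal (colon_ideal R K b) R"
  proof (rule primeidealI[OF colon_ideal_ideal[OF K b(1)] is_cring])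
    show "carrier R \<noteq> colon_ideal R K b" using colon_ideal_proper[OF K b(1)] b by blast
    fix x y assume xy: "x \<in> carrier R" "y \<in> carrier R" "x \<otimes> y \<in> colon_ideal R K b"
    show "x \<in> colon_ideal R K b \<or> y \<in> colon_ideal R K b"
    proof (cases "y \<otimes> b \<in> K")
      case False
      have "colon_ideal R K b \<subseteq> colon_ideal R K (y \<otimes> b)"
      proof
        fix c assume "c \<in> colon_ideal R K b"
        then have c: "c \<in> carrier R" "c \<otimes> b \<in> K" by (auto simp: mem_colon_ideal)
        then have "c \<otimes> (y \<otimes> b) = y \<otimes> (c \<otimes> b)" using b xy m_lcomm by simp
        then show "c \<in> colon_ideal R K (y \<otimes> b)"
          using c xy K.I_l_closed by (simp add: mem_colon_ideal)
      qed
      then have "colon_ideal R K (y \<otimes> b) = colon_ideal R K b"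
        using max[OF _ False] b xy by auto
      moreover have "x \<in> colon_ideal R K (y \<otimes> b)"
        using xy b by (simp add: mem_colon_ideal m_assoc)
      ultimately show ?thesis by simp
    qed (use xy in \<open>simp add: mem_colon_ideal\<close>)
  qed
  then show ?thesis using b unfolding assoc_primes_def by blast
qed

lemma assoc_primes_nonempty:
  assumes "ideal K R" "K \<noteq> carrier R"
  shows "assoc_primes R K \<noteq> {}"
proof -
  have "\<one> \<notin> K" using assms ideal.one_imp_carrier by blast
  then show ?thesis using colon_ideal_in_assoc_prime[OF assms(1), of \<one>] by blast
qed

text \<open>With \<open>P = colon_ideal R K u\<close> associated and \<open>L = K + u R\<close>, the
  module \<open>L/K\<close> is a copy of \<open>R/P\<close>, whose only associated prime is
  \<open>P\<close>. So an associated prime of \<open>K\<close> is \<open>P\<close> or is associated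
  to the larger ideal \<open>L\<close>.\<close>

lemma assoc_primes_finite:
  assumes "ideal K R"
  shows "finite (assoc_primes R K)"
  using assms
proof (induction K rule: noetherian_induct)
  case (2 K)
  interpret K: ideal K R by fact
  show ?case
  proof (cases "K = carrier R")
    case True
    have "assoc_primes R K = {}"
    proof (rule ccontr)
      assume "assoc_primes R K \<noteq> {}"
      then obtain P where "P \<in> assoc_primes R K" by blast
      from assoc_primeE[OF 2(1) this] True show False by metis
    qed
    then show ?thesis by simp
  next
    case False
    then obtain P u where P: "P \<in> assoc_primes R K" and u: "primeideal P R" "u \<in> carrier R" "u \<notin> K"
      "P = colon_ideal R K u"
      using assoc_primes_nonempty[OF 2(1)] assoc_primeE[OF 2(1)] by (metis ex_in_conv)
    interpret P: primeideal P R by fact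
    define L where "L = ideal_adjoin R K u"
    have L: "ideal L R" using ideal_adjoin_ideal 2(1) u by (simp add: L_def)
    have KL: "K \<subset> L"
      using subset_ideal_adjoin[OF 2(1) u(2)] mem_ideal_adjoin[OF 2(1) u(2)] u L_def by blast
    have "assoc_primes R K \<subseteq> insert P (assoc_primes R L)"
    proof
      fix P' assume P': "P' \<in> assoc_primes R K"
      then obtain v where v: "primeideal P' R" "v \<in> carrier R" "v \<notin> K" "P' = colon_ideal R K v"
        using assoc_primeE[OF 2(1)] by metis
      interpret P': primeideal P' R by fact
      \<comment> \<open>The cases tell whether the multiples of \<open>v\<close> meet
        \<open>L\<close> only in \<open>K\<close>. If so, the colon ideals of \<open>v\<close>
        modulo \<open>K\<close> and modulo \<open>L\<close> agree. If not, some \<open>r v\<close>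
        outside \<open>K\<close> agrees modulo \<open>K\<close> with a multiple \<open>u t\<close>,
        and the annihilator of this element is both \<open>P'\<close> and \<open>P\<close>.\<close>
      show "P' \<in> insert P (assoc_primes R L)"
      proof (cases "\<forall>r\<in>carrier R. r \<otimes> v \<in> L \<longrightarrow> r \<otimes> v \<in> K")
        case True
        then have "a \<otimes> v \<in> K \<longleftrightarrow> a \<otimes> v \<in> L" if "a \<in> carrier R" for a
          using that KL by blast
        then have "P' = colon_ideal R L v" unfolding v(4) colon_ideal_def by blast
        then show ?thesis using v(1,2) unfolding assoc_primes_def by blast
      next
        case False
        then obtain r where r: "r \<in> carrier R" "r \<otimes> v \<in> L" "r \<otimes> v \<notin> K" by blast
        then obtain k t where kt: "k \<in> K" "t \<in> carrier R" "r \<otimes> v = k \<oplus> u \<otimes> t"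
          by (auto simp: L_def ideal_adjoin_def)
        have ut: "u \<otimes> t \<notin> K" using kt r K.a_closed by auto
        have rP': "r \<notin> P'" using r v by (simp add: mem_colon_ideal)
        have tP: "t \<notin> P" using ut u kt by (simp add: mem_colon_ideal m_comm)
        have "a \<in> P \<longleftrightarrow> a \<in> P'" if a: "a \<in> carrier R" for a
        proof -
          have "a \<in> P' \<longleftrightarrow> a \<otimes> r \<in> P'"
            using rP' a r P'.I_prime P'.I_r_closed by blast
          also have "\<dots> \<longleftrightarrow> a \<otimes> (r \<otimes> v) \<in> K" using v a r by (simp add: mem_colon_ideal m_assoc)
          also have "a \<otimes> (r \<otimes> v) = a \<otimes> (u \<otimes> t) \<oplus> a \<otimes> k"
            using kt u a K.Icarr by algebra
          also have "\<dots> \<in> K \<longleftrightarrow> a \<otimes> (u \<otimes> t) \<in> K"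
            using ideal_add_cancel[OF 2(1), of "a \<otimes> (u \<otimes> t)" "a \<otimes> k"] kt u a
              K.I_l_closed[OF kt(1) a] K.a_closed by auto
          also have "\<dots> \<longleftrightarrow> a \<otimes> t \<in> P"
          proof -
            have "a \<otimes> (u \<otimes> t) = a \<otimes> t \<otimes> u" using u kt a by algebra
            then show ?thesis using u kt a by (simp add: mem_colon_ideal)
          qed
          also have "\<dots> \<longleftrightarrow> a \<in> P" using tP a kt P.I_prime P.I_r_closed by blast
          finally show ?thesis by simp
        qed
        then have "P' = P" using P.Icarr P'.Icarr by blast
        then show ?thesis by simp
      qed
    qed
    then show ?thesis using finite_subset[OF _ finite.insertI[OF 2(2)[OF L KL L]]] by simp
  qed
qed (use assms in auto)

end

section \<open>Regular sequences\<close>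

context cring
begin

text \<open>One factor from each ideal, all chosen outside \<open>P\<close>: the product lies in
  every ideal, and primality keeps it outside \<open>P\<close>.\<close>

lemma mem_inter_not_mem_prime:
  assumes "finite \<Q>" "primeideal P R" "ideal I R" "\<not> I \<subseteq> P"
    and "\<And>Q. Q \<in> \<Q> \<Longrightarrow> ideal Q R \<and> \<not> Q \<subseteq> P"
  shows "\<exists>y\<in>I. y \<notin> P \<and> (\<forall>Q\<in>\<Q>. y \<in> Q)"
  using assms(1,5)
proof (induction \<Q>)
  case empty
  then show ?case using assms by blast
next
  case (insert Q \<Q>)
  interpret P: primeideal P R by fact
  interpret I: ideal I R by fact
  obtain y where y: "y \<in> I" "y \<notin> P" "\<forall>Q\<in>\<Q>. y \<in> Q" using insert by auto
  have Q: "ideal Q R" using insert.prems by simp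
  interpret Q: ideal Q R by fact
  obtain z where z: "z \<in> Q" "z \<notin> P" using insert.prems by blast
  have "y \<otimes> z \<in> I" "y \<otimes> z \<notin> P" "y \<otimes> z \<in> Q"
    using P.I_prime[OF I.Icarr[OF y(1)] Q.Icarr[OF z(1)]] y z
      I.I_r_closed[OF y(1) Q.Icarr[OF z(1)]] Q.I_l_closed[OF z(1) I.Icarr[OF y(1)]] by auto
  moreover have "y \<otimes> z \<in> Q'" if "Q' \<in> \<Q>" for Q'
    using ideal.I_r_closed[of Q' R y z] y(3) Q.Icarr[OF z(1)] that insert.prems by simp
  ultimately show ?case by blast
qed

lemma prime_avoidance:
  assumes "finite \<Q>" "ideal I R" "\<And>P. P \<in> \<Q> \<Longrightarrow> primeideal P R \<and> \<not> I \<subseteq> P"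
  shows "\<exists>x\<in>I. \<forall>P\<in>\<Q>. x \<notin> P"
  using assms(1,3)
proof (induction "card \<Q>" arbitrary: \<Q> rule: less_induct)
  case less
  interpret I: ideal I R by fact
  show ?case
  proof (cases "\<exists>P\<in>\<Q>. \<exists>Q\<in>\<Q>. Q \<noteq> P \<and> Q \<subseteq> P")
    case True
    then obtain P Q where PQ: "P \<in> \<Q>" "Q \<in> \<Q>" "Q \<noteq> P" "Q \<subseteq> P" by blast
    have "card (\<Q> - {Q}) < card \<Q>" using PQ less.prems by (meson card_Diff1_less)
    then obtain x where "x \<in> I" "\<forall>P\<in>\<Q> - {Q}. x \<notin> P"
      using less.hyps[of "\<Q> - {Q}"] less.prems by auto
    then show ?thesis using PQ by blast
  next
    case False
    show ?thesis
    proof (cases "\<Q> = {}")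
      case True
      then show ?thesis using I.zero_closed by blast
    next
      case nonempty: False
      then obtain P where P: "P \<in> \<Q>" by blast
      have "card (\<Q> - {P}) < card \<Q>" using P less.prems by (meson card_Diff1_less)
      then obtain x where x: "x \<in> I" "\<forall>Q\<in>\<Q> - {P}. x \<notin> Q"
        using less.hyps[of "\<Q> - {P}"] less.prems by auto
      show ?thesis
      proof (cases "x \<in> P")
        case True
        have "\<exists>y\<in>I. y \<notin> P \<and> (\<forall>Q\<in>\<Q> - {P}. y \<in> Q)"
          using False P less.prems assms(2)
          by (intro mem_inter_not_mem_prime) (auto simp: primeideal.axioms(1))
        then obtain y where y: "y \<in> I" "y \<notin> P" "\<forall>Q\<in>\<Q> - {P}. y \<in> Q" by blast
        have c: "x \<in> carrier R" "y \<in> carrier R" using x y I.Icarr by auto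
        have "x \<oplus> y \<notin> P"
          using ideal_add_cancel[of P y x] P less.prems c True y
          by (auto simp: primeideal.axioms(1) a_comm)
        moreover have "x \<oplus> y \<notin> Q" if "Q \<in> \<Q> - {P}" for Q
          using ideal_add_cancel[of Q x y] that less.prems c x y
          by (auto simp: primeideal.axioms(1))
        ultimately show ?thesis using x y I.a_closed by (intro bexI[of _ "x \<oplus> y"]) blast+
      qed (use x in blast)
    qed
  qed
qed

text \<open>Regularity over a base ideal that grows along the recursion. In contrast to
  \<open>regular_sequence\<close>, the ideal reached at the end may be everything: sequences of a
  prescribed length are wanted even if the dimension is too small for proper ones.\<close>

fun regular_seq_mod :: "'a set \<Rightarrow> 'a list \<Rightarrow> bool" where
  "regular_seq_mod K [] \<longleftrightarrow> True"
| "regular_seq_mod K (x # xs) \<longleftrightarrow>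
     x \<in> carrier R \<and> regular_mod R K x \<and> regular_seq_mod (ideal_adjoin R K x) xs"

definition ideal_adjoin_list :: "'a set \<Rightarrow> 'a list \<Rightarrow> 'a set" where
  "ideal_adjoin_list = foldl (ideal_adjoin R)"

lemma ideal_adjoin_list_simps [simp]:
  "ideal_adjoin_list K [] = K"
  "ideal_adjoin_list K (x # xs) = ideal_adjoin_list (ideal_adjoin R K x) xs"
  "ideal_adjoin_list K (xs @ ys) = ideal_adjoin_list (ideal_adjoin_list K xs) ys"
  by (auto simp: ideal_adjoin_list_def)

lemma ideal_adjoin_list_ideal:
  "\<lbrakk>ideal K R; set xs \<subseteq> carrier R\<rbrakk> \<Longrightarrow> ideal (ideal_adjoin_list K xs) R"
  by (induction xs arbitrary: K) (auto simp: ideal_adjoin_ideal)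

lemma ideal_adjoin_list_swap:
  "\<lbrakk>ideal K R; x \<in> carrier R; set xs \<subseteq> carrier R\<rbrakk> \<Longrightarrow>
     ideal_adjoin_list (ideal_adjoin R K x) xs = ideal_adjoin R (ideal_adjoin_list K xs) x"
proof (induction xs arbitrary: K)
  case (Cons y ys)
  then show ?case using ideal_adjoin_comm[of K x y] ideal_adjoin_ideal[of K y] by simp
qed simp

lemma genideal_set_eq_ideal_adjoin_list:
  "set xs \<subseteq> carrier R \<Longrightarrow> Idl (set xs) = ideal_adjoin_list {\<zero>} xs"
proof (induction xs rule: rev_induct)
  case Nil
  have "Idl {} = {\<zero>}"
  proof
    show "Idl {} \<subseteq> {\<zero>}" using genideal_minimal[OF zeroideal] by simp
    show "{\<zero>} \<subseteq> Idl {}" using ideal_zero_closed[OF genideal_ideal[of "{}"]] by simp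
  qed
  then show ?case by simp
next
  case (snoc x xs)
  then show ?case using genideal_insert[of "set xs" x] by simp
qed

lemma regular_seq_mod_append:
  "regular_seq_mod K (xs @ ys) \<longleftrightarrow>
     regular_seq_mod K xs \<and> regular_seq_mod (ideal_adjoin_list K xs) ys"
  by (induction xs arbitrary: K) auto

lemma regular_seq_mod_carrier: "regular_seq_mod K xs \<Longrightarrow> set xs \<subseteq> carrier R"
  by (induction xs arbitrary: K) auto

lemma regular_seq_mod_of_regular_sequence:
  assumes "regular_sequence R xs"
  shows "regular_seq_mod {\<zero>} xs"
proof -
  have xs: "set xs \<subseteq> carrier R" using assms by (simp add: regular_sequence_def)
  have "regular_seq_mod {\<zero>} (take i xs)" if "i \<le> length xs" for i
    using that
  proof (induction i)
    case (Suc i)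
    have "regular_mod R (Idl (set (take i xs))) (xs ! i)"
      using assms Suc.prems by (auto simp: regular_sequence_def regular_mod_def)
    moreover have "set (take i xs) \<subseteq> carrier R" using xs set_take_subset by fastforce
    ultimately show ?case using Suc xs
      by (auto simp: take_Suc_conv_app_nth regular_seq_mod_append genideal_set_eq_ideal_adjoin_list)
  qed simp
  from this[of "length xs"] show ?thesis by simp
qed

text \<open>From \<open>x a = k + z b\<close>, regularity of \<open>z\<close> modulo
  \<open>K + x R\<close> gives \<open>b = l + x c\<close>; then \<open>x (a - z c)\<close> lies in
  \<open>K\<close>, and \<open>x\<close> cancels.\<close>

lemma regular_mod_swap:
  assumes K: "ideal K R" and x: "x \<in> carrier R" "regular_mod R K x"
    and z: "z \<in> carrier R" "regular_mod R (ideal_adjoin R K x) z" "regular_mod R K z"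
  shows "regular_mod R (ideal_adjoin R K z) x"
  unfolding regular_mod_def
proof (intro ballI impI)
  interpret K: ideal K R by fact
  fix a assume a: "a \<in> carrier R" "x \<otimes> a \<in> ideal_adjoin R K z"
  then obtain k b where kb: "k \<in> K" "b \<in> carrier R" "x \<otimes> a = k \<oplus> z \<otimes> b"
    by (auto simp: ideal_adjoin_def)
  have k: "k \<in> carrier R" using kb K.Icarr by blast
  have "z \<otimes> b = \<ominus> k \<oplus> (k \<oplus> z \<otimes> b)" using k z kb by algebra
  also have "\<dots> = \<ominus> k \<oplus> x \<otimes> a" using kb by simp
  finally have "z \<otimes> b \<in> ideal_adjoin R K x"
    using a(1) K.a_inv_closed[OF kb(1)] by (intro ideal_adjoinI)
  then have "b \<in> ideal_adjoin R K x" by (rule regular_modD[OF z(2) kb(2)])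
  then obtain l c where lc: "l \<in> K" "c \<in> carrier R" "b = l \<oplus> x \<otimes> c"
    by (auto simp: ideal_adjoin_def)
  have l: "l \<in> carrier R" using lc K.Icarr by blast
  have "x \<otimes> (a \<ominus> z \<otimes> c) = x \<otimes> a \<ominus> x \<otimes> (z \<otimes> c)" using x z lc a by algebra
  also have "\<dots> = k \<oplus> z \<otimes> (l \<oplus> x \<otimes> c) \<ominus> x \<otimes> (z \<otimes> c)" using kb lc by simp
  also have "\<dots> = k \<oplus> z \<otimes> l" using x z lc k l by algebra
  finally have "x \<otimes> (a \<ominus> z \<otimes> c) \<in> K" using kb lc z by (simp add: K.I_l_closed K.a_closed)
  then have "a \<ominus> z \<otimes> c \<in> K" using regular_modD[OF x(2)] z(1) lc(2) a(1) by simp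
  moreover have "a = (a \<ominus> z \<otimes> c) \<oplus> z \<otimes> c" using a z lc by algebra
  ultimately show "a \<in> ideal_adjoin R K z" using lc(2) by (intro ideal_adjoinI)
qed

text \<open>\<open>z\<close> is moved to the front by swapping it with one entry after the other,
  which is why its regularity is asked modulo every initial segment.\<close>

lemma regular_seq_mod_adjoin:
  assumes "ideal K R" "z \<in> carrier R" "regular_seq_mod K xs"
    and "\<And>i. i \<le> length xs \<Longrightarrow> regular_mod R (ideal_adjoin_list K (take i xs)) z"
  shows "regular_seq_mod (ideal_adjoin R K z) xs"
  using assms
proof (induction xs arbitrary: K)
  case (Cons x xs)
  have x: "x \<in> carrier R" "regular_mod R K x" using Cons.prems by auto
  have "regular_mod R K z" "regular_mod R (ideal_adjoin R K x) z"
    using Cons.prems(4)[of 0] Cons.prems(4)[of 1] by auto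
  then have "regular_mod R (ideal_adjoin R K z) x"
    using regular_mod_swap Cons.prems x by blast
  moreover have "regular_seq_mod (ideal_adjoin R (ideal_adjoin R K x) z) xs"
    using Cons.IH[of "ideal_adjoin R K x"] Cons.prems ideal_adjoin_ideal[of K x]
      Cons.prems(4)[of "Suc i" for i] by auto
  ultimately show ?case using x ideal_adjoin_comm Cons.prems by simp
qed simp

text \<open>A nonzero element of \<open>R/K\<close> annihilated by \<open>I\<close>, that is, a
  nonzero homomorphism from \<open>R/I\<close> to \<open>R/K\<close>. If \<open>K\<close> is
  generated by a regular sequence in \<open>I\<close> and the ring is noetherian, it says that the
  sequence cannot be prolonged inside \<open>I\<close>.\<close>

definition kills_mod :: "'a set \<Rightarrow> 'a set \<Rightarrow> bool" where
  "kills_mod I K \<longleftrightarrow> (\<exists>u\<in>carrier R. u \<notin> K \<and> (\<forall>a\<in>I. a \<otimes> u \<in> K))"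

text \<open>A witness \<open>u\<close> modulo \<open>K + x R\<close> yields the witness
  \<open>v\<close> modulo \<open>K + y R\<close> by \<open>y u = k + x v\<close>. This relation is
  symmetric, so \<open>v\<close> determines \<open>u\<close> modulo \<open>K + x R\<close>;
  therefore \<open>v\<close> cannot vanish modulo \<open>K + y R\<close>.\<close>

lemma kills_mod_exchange:
  assumes K: "ideal K R" and x: "x \<in> I" "x \<in> carrier R" "regular_mod R K x"
    and y: "y \<in> I" "y \<in> carrier R" "regular_mod R K y" and I: "I \<subseteq> carrier R"
    and kills: "kills_mod I (ideal_adjoin R K x)"
  shows "kills_mod I (ideal_adjoin R K y)"
proof -
  interpret K: ideal K R by fact
  obtain u where u: "u \<in> carrier R" "u \<notin> ideal_adjoin R K x" "\<And>a. a \<in> I \<Longrightarrow> a \<otimes> u \<in> ideal_adjoin R K x"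
    using kills by (auto simp: kills_mod_def)
  obtain k v where kv: "k \<in> K" "v \<in> carrier R" "y \<otimes> u = k \<oplus> x \<otimes> v"
    using u(3)[OF y(1)] by (auto simp: ideal_adjoin_def)
  have k: "k \<in> carrier R" using kv K.Icarr by blast
  have "v \<notin> ideal_adjoin R K y"
  proof
    assume "v \<in> ideal_adjoin R K y"
    then obtain l w where lw: "l \<in> K" "w \<in> carrier R" "v = l \<oplus> y \<otimes> w"
      by (auto simp: ideal_adjoin_def)
    have l: "l \<in> carrier R" using lw K.Icarr by blast
    have "y \<otimes> (u \<ominus> x \<otimes> w) = y \<otimes> u \<ominus> x \<otimes> (y \<otimes> w)" using u x y lw by algebra
    also have "\<dots> = k \<oplus> x \<otimes> (l \<oplus> y \<otimes> w) \<ominus> x \<otimes> (y \<otimes> w)" using kv lw by simp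
    also have "\<dots> = k \<oplus> x \<otimes> l" using k l x y lw by algebra
    finally have "y \<otimes> (u \<ominus> x \<otimes> w) \<in> K" using kv lw x by (simp add: K.I_l_closed K.a_closed)
    then have "u \<ominus> x \<otimes> w \<in> K" using regular_modD[OF y(3)] u(1) x(2) lw(2) by simp
    moreover have "u = (u \<ominus> x \<otimes> w) \<oplus> x \<otimes> w" using u x lw by algebra
    ultimately have "u \<in> ideal_adjoin R K x" using lw(2) by (intro ideal_adjoinI)
    then show False using u(2) by simp
  qed
  moreover have "a \<otimes> v \<in> ideal_adjoin R K y" if a: "a \<in> I" for a
  proof -
    have ac: "a \<in> carrier R" using a I by blast
    obtain l w where lw: "l \<in> K" "w \<in> carrier R" "a \<otimes> u = l \<oplus> x \<otimes> w"
      using u(3)[OF a] by (auto simp: ideal_adjoin_def)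
    have l: "l \<in> carrier R" using lw K.Icarr by blast
    have "x \<otimes> (a \<otimes> v \<ominus> y \<otimes> w) = a \<otimes> (k \<oplus> x \<otimes> v) \<ominus> a \<otimes> k \<ominus> y \<otimes> (x \<otimes> w)"
      using x y ac kv lw k by algebra
    also have "\<dots> = y \<otimes> (a \<otimes> u) \<ominus> a \<otimes> k \<ominus> y \<otimes> (x \<otimes> w)"
      using kv u ac y m_lcomm by simp
    also have "\<dots> = y \<otimes> (l \<oplus> x \<otimes> w) \<ominus> a \<otimes> k \<ominus> y \<otimes> (x \<otimes> w)" using lw by simp
    also have "\<dots> = y \<otimes> l \<ominus> a \<otimes> k" using x y ac lw k l by algebra
    finally have "x \<otimes> (a \<otimes> v \<ominus> y \<otimes> w) \<in> K"
      using kv lw ac y by (simp add: K.I_l_closed ideal_minus_closed[OF K])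
    then have "a \<otimes> v \<ominus> y \<otimes> w \<in> K" using regular_modD[OF x(3)] kv(2) y(2) lw(2) ac by simp
    moreover have "a \<otimes> v = (a \<otimes> v \<ominus> y \<otimes> w) \<oplus> y \<otimes> w" using kv y lw ac by algebra
    ultimately show ?thesis using lw(2) by (intro ideal_adjoinI)
  qed
  ultimately show ?thesis using kv unfolding kills_mod_def by blast
qed

end

section \<open>The length of maximal regular sequences\<close>

context noetherian_cring
begin

lemma regular_modI:
  assumes "ideal K R" "x \<in> carrier R" "\<And>P. P \<in> assoc_primes R K \<Longrightarrow> x \<notin> P"
  shows "regular_mod R K x"
  unfolding regular_mod_def
proof (intro ballI impI, rule ccontr)
  fix a assume a: "a \<in> carrier R" "x \<otimes> a \<in> K" "a \<notin> K"
  then show False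
    using colon_ideal_in_assoc_prime[OF assms(1), of a] assms(2,3) by (auto simp: mem_colon_ideal)
qed

text \<open>An ideal that contains a regular element modulo \<open>K\<close> lies in no associated
  prime of \<open>K\<close>. Prime avoidance over the associated primes of all members of
  \<open>\<K>\<close> together finds one element for all of them.\<close>

lemma common_regular_element:
  assumes "finite \<K>" "ideal I R" "\<And>K. K \<in> \<K> \<Longrightarrow> ideal K R \<and> (\<exists>x\<in>I. regular_mod R K x)"
  shows "\<exists>z\<in>I. \<forall>K\<in>\<K>. regular_mod R K z"
proof -
  interpret I: ideal I R by fact
  have "\<exists>z\<in>I. \<forall>P\<in>(\<Union>K\<in>\<K>. assoc_primes R K). z \<notin> P"
  proof (rule prime_avoidance)
    fix P assume "P \<in> (\<Union>K\<in>\<K>. assoc_primes R K)"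
    then obtain K where K: "K \<in> \<K>" "P \<in> assoc_primes R K" by blast
    obtain x where x: "x \<in> I" "regular_mod R K x" using assms(3) K by blast
    have "ideal K R" using assms(3) K by blast
    then obtain u where "primeideal P R" "u \<in> carrier R" "u \<notin> K" "P = colon_ideal R K u"
      using assoc_primeE K by metis
    moreover have "x \<notin> P"
      using regular_modD[OF x(2)] \<open>u \<in> carrier R\<close> \<open>u \<notin> K\<close> \<open>P = _\<close> by (auto simp: mem_colon_ideal)
    ultimately show "primeideal P R \<and> \<not> I \<subseteq> P" using x by blast
  qed (use assms assoc_primes_finite in auto)
  then obtain z where z: "z \<in> I" "\<And>K P. K \<in> \<K> \<Longrightarrow> P \<in> assoc_primes R K \<Longrightarrow> z \<notin> P" by blast
  then show ?thesis using regular_modI[OF _ I.Icarr[OF z(1)]] assms(3) by blast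
qed

text \<open>Kaplansky's proof that all maximal regular sequences in an ideal have the same length:
  exchange the last entries of both sequences for a common regular element \<open>z\<close>, and move \<open>z\<close> to
  the front.\<close>

lemma kills_mod_regular_seq:
  assumes "ideal K R" "ideal I R" "regular_seq_mod K xs" "regular_seq_mod K ys"
    and "set xs \<subseteq> I" "set ys \<subseteq> I" "length xs = length ys"
    and "kills_mod I (ideal_adjoin_list K xs)"
  shows "kills_mod I (ideal_adjoin_list K ys)"
  using assms
proof (induction "length xs" arbitrary: K xs ys)
  case (Suc n)
  interpret I: ideal I R by fact
  have I: "I \<subseteq> carrier R" using I.Icarr by blast
  obtain xs' x ys' y where xy: "xs = xs' @ [x]" "ys = ys' @ [y]" "length xs' = n" "length ys' = n"
    using Suc by (metis append_butlast_last_id length_0_conv length_butlast diff_Suc_1 nat.distinct(1))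
  note prems = Suc.prems[unfolded xy, simplified regular_seq_mod_append, simplified]
  have carr: "set xs' \<subseteq> carrier R" "set ys' \<subseteq> carrier R" using prems I by auto
  define L where "L zs i = ideal_adjoin_list K (take i zs)" for zs i
  have L: "ideal (L zs i) R" if "set zs \<subseteq> carrier R" for zs i
    using that Suc.prems(1) set_take_subset unfolding L_def
    by (intro ideal_adjoin_list_ideal) fastforce+
  have reg: "\<exists>w\<in>I. regular_mod R (L zs i) w"
    if "regular_seq_mod K (zs @ [w])" "set (zs @ [w]) \<subseteq> I" "i \<le> length zs" for zs w i
  proof -
    have "zs @ [w] = take i zs @ drop i (zs @ [w])" using that(3) 
      by (metis append_assoc append_take_drop_id drop_append diff_is_0_eq drop_0)
    moreover obtain w' ws where w: "drop i (zs @ [w]) = w' # ws"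
      using \<open>i \<le> length zs\<close> by (cases "drop i (zs @ [w])") auto
    ultimately have "regular_mod R (L zs i) w'" 
      using that(1) unfolding L_def by (metis regular_seq_mod.simps(2) regular_seq_mod_append)
    moreover have "w' \<in> I" using w that(2) by (metis in_set_dropD list.set_intros(1) subsetD)
    ultimately show ?thesis by blast
  qed
  \<comment> \<open>Modulo each of these initial ideals the next entry of the sequence in question
    is a regular element of \<open>I\<close>. The index \<open>n\<close> is included; there the next
    entry is the last one, \<open>x\<close> or \<open>y\<close>.\<close>
  have "\<exists>z\<in>I. \<forall>J\<in>L xs' ` {..n} \<union> L ys' ` {..n}. regular_mod R J z"
    using Suc.prems(2) L carr reg[of xs' x] reg[of ys' y] Suc.prems(3-6) xy
    by (intro common_regular_element) auto
  then obtain z where z: "z \<in> I" "\<And>i. i \<le> n \<Longrightarrow> regular_mod R (L xs' i) z"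
    "\<And>i. i \<le> n \<Longrightarrow> regular_mod R (L ys' i) z"
    by auto
  have zc: "z \<in> carrier R" using z I by blast
  have "kills_mod I (ideal_adjoin R (L xs' n) z)"
    using prems xy L[OF carr(1), of n] z zc z(2)[of n] I kills_mod_exchange[of "L xs' n" x I z]
    by (auto simp: L_def)
  then have "kills_mod I (ideal_adjoin_list (ideal_adjoin R K z) xs')"
    using ideal_adjoin_list_swap[OF Suc.prems(1) zc carr(1)] xy by (simp add: L_def)
  moreover have "regular_seq_mod (ideal_adjoin R K z) xs'"
    by (rule regular_seq_mod_adjoin[OF Suc.prems(1) zc]) (use prems z(2) xy L_def in auto)
  moreover have "regular_seq_mod (ideal_adjoin R K z) ys'"
    by (rule regular_seq_mod_adjoin[OF Suc.prems(1) zc]) (use prems z(3) xy L_def in auto)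
  ultimately have "kills_mod I (ideal_adjoin_list (ideal_adjoin R K z) ys')"
    using Suc.hyps(1)[of xs' "ideal_adjoin R K z" ys'] xy Suc.prems(1,2,7) prems zc ideal_adjoin_ideal by auto
  then have "kills_mod I (ideal_adjoin R (L ys' n) z)"
    using ideal_adjoin_list_swap[OF Suc.prems(1) zc carr(2)] xy by (simp add: L_def)
  then have "kills_mod I (ideal_adjoin R (L ys' n) y)"
    using prems xy L[OF carr(2), of n] z zc z(3)[of n] I kills_mod_exchange[of "L ys' n" z I y]
    by (auto simp: L_def)
  then show ?case using xy by (simp add: L_def)
next
  case 0
  then have "xs = []" "ys = []" by simp_all
  then show ?case using 0 by (simp only:)
qed

text \<open>Otherwise the initial part of \<open>ys\<close> of length \<open>length xs\<close> would
  also leave a nonzero element killed by \<open>I\<close>. The next entry of \<open>ys\<close> lies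
  in \<open>I\<close> and kills it too, against regularity.\<close>

lemma regular_seq_mod_length_le:
  assumes "ideal K R" "ideal I R" "regular_seq_mod K xs" "regular_seq_mod K ys"
    and "set xs \<subseteq> I" "set ys \<subseteq> I" "kills_mod I (ideal_adjoin_list K xs)"
  shows "length ys \<le> length xs"
proof (rule ccontr)
  assume len: "\<not> ?thesis"
  define n where "n = length xs"
  have ys: "ys = take n ys @ ys ! n # drop (Suc n) ys"
    using len by (simp add: n_def id_take_nth_drop)
  have "regular_seq_mod K (take n ys @ ys ! n # drop (Suc n) ys)"
    using assms(4) ys by simp
  then have "regular_seq_mod K (take n ys)"
    and y: "regular_mod R (ideal_adjoin_list K (take n ys)) (ys ! n)"
    unfolding regular_seq_mod_append by simp_all
  moreover have "set (take n ys) \<subseteq> I" using assms(6) set_take_subset by fastforce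
  ultimately have "kills_mod I (ideal_adjoin_list K (take n ys))"
    by (intro kills_mod_regular_seq[OF assms(1-3) _ assms(5) _ _ assms(7)])
      (use len in \<open>simp_all add: n_def\<close>)
  then obtain u where u: "u \<in> carrier R" "u \<notin> ideal_adjoin_list K (take n ys)"
    "\<And>a. a \<in> I \<Longrightarrow> a \<otimes> u \<in> ideal_adjoin_list K (take n ys)"
    unfolding kills_mod_def by blast
  moreover have "ys ! n \<in> I" using len assms(6) by (auto simp: n_def)
  ultimately show False using regular_modD[OF y u(1)] by blast
qed

end

section \<open>Localization and unmixedness\<close>

context primeideal
begin

abbreviation "loc_set \<equiv> carrier R - I"
abbreviation "loc_ring \<equiv> localization R loc_set"
abbreviation "fraction \<equiv> frac_class R loc_set"

lemma loc_set_mult: "\<lbrakk>s \<in> loc_set; t \<in> loc_set\<rbrakk> \<Longrightarrow> s \<otimes> t \<in> loc_set"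
  using I_prime by blast

lemma loc_set_one: "\<one> \<in> loc_set"
  using one_imp_carrier I_notcarr by auto

lemma frac_rel_iff:
  "((a, s), (b, t)) \<in> frac_rel R loc_set \<longleftrightarrow>
     a \<in> carrier R \<and> b \<in> carrier R \<and> s \<in> loc_set \<and> t \<in> loc_set \<and>
     (\<exists>u\<in>loc_set. u \<otimes> (a \<otimes> t \<ominus> b \<otimes> s) = \<zero>)"
  unfolding frac_rel_def by blast

lemma frac_rel_equiv: "equiv (carrier R \<times> loc_set) (frac_rel R loc_set)"
proof (rule equivI)
  show "refl_on (carrier R \<times> loc_set) (frac_rel R loc_set)"
  proof (rule refl_onI)
    fix p assume "p \<in> carrier R \<times> loc_set"
    then obtain a s where p: "p = (a, s)" "a \<in> carrier R" "s \<in> loc_set" by blast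
    have "\<one> \<otimes> (a \<otimes> s \<ominus> a \<otimes> s) = \<zero>" using p by (simp add: r_neg minus_eq)
    then show "(p, p) \<in> frac_rel R loc_set"
      unfolding p(1) frac_rel_iff using p loc_set_one by blast
  qed
  show "frac_rel R loc_set \<subseteq> (carrier R \<times> loc_set) \<times> (carrier R \<times> loc_set)"
    unfolding frac_rel_def by blast
  show "sym (frac_rel R loc_set)"
  proof (rule symI)
    fix p q assume pq: "(p, q) \<in> frac_rel R loc_set"
    obtain a s b t where [simp]: "p = (a, s)" "q = (b, t)" by (cases p, cases q)
    obtain u where u: "a \<in> carrier R" "b \<in> carrier R" "s \<in> loc_set" "t \<in> loc_set" "u \<in> loc_set"
      "u \<otimes> (a \<otimes> t \<ominus> b \<otimes> s) = \<zero>" using pq by (auto simp: frac_rel_iff)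
    have c: "s \<in> carrier R" "t \<in> carrier R" "u \<in> carrier R" using u by auto
    have "u \<otimes> (b \<otimes> s \<ominus> a \<otimes> t) = \<ominus> (u \<otimes> (a \<otimes> t \<ominus> b \<otimes> s))"
      using u(1,2) c by algebra
    also have "\<dots> = \<zero>" using u by simp
    finally show "(q, p) \<in> frac_rel R loc_set"
      unfolding \<open>p = _\<close> \<open>q = _\<close> frac_rel_iff using u by blast
  qed
  show "trans (frac_rel R loc_set)"
  proof (rule transI)
    fix p q r assume pq: "(p, q) \<in> frac_rel R loc_set" "(q, r) \<in> frac_rel R loc_set"
    obtain a s b t c v where [simp]: "p = (a, s)" "q = (b, t)" "r = (c, v)"
      by (cases p, cases q, cases r)
    obtain u where u: "a \<in> carrier R" "b \<in> carrier R" "s \<in> loc_set" "t \<in> loc_set" "u \<in> loc_set"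
      "u \<otimes> (a \<otimes> t \<ominus> b \<otimes> s) = \<zero>" using pq by (auto simp: frac_rel_iff)
    obtain w where w: "c \<in> carrier R" "v \<in> loc_set" "w \<in> loc_set"
      "w \<otimes> (b \<otimes> v \<ominus> c \<otimes> t) = \<zero>" using pq by (auto simp: frac_rel_iff)
    have C: "s \<in> carrier R" "t \<in> carrier R" "u \<in> carrier R" "v \<in> carrier R" "w \<in> carrier R"
      using u w by auto
    have "(u \<otimes> w \<otimes> t) \<otimes> (a \<otimes> v \<ominus> c \<otimes> s) =
        w \<otimes> v \<otimes> (u \<otimes> (a \<otimes> t \<ominus> b \<otimes> s)) \<oplus> u \<otimes> s \<otimes> (w \<otimes> (b \<otimes> v \<ominus> c \<otimes> t))"
      using u(1,2) w(1) C by algebra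
    also have "\<dots> = \<zero>" using C unfolding u(6) w(4) by simp
    finally show "(p, r) \<in> frac_rel R loc_set"
      unfolding \<open>p = _\<close> \<open>r = _\<close> frac_rel_iff using u w loc_set_mult by blast
  qed
qed

lemma frac_eq_iff:
  assumes "a \<in> carrier R" "b \<in> carrier R" "s \<in> loc_set" "t \<in> loc_set"
  shows "fraction a s = fraction b t \<longleftrightarrow> (\<exists>u\<in>loc_set. u \<otimes> (a \<otimes> t \<ominus> b \<otimes> s) = \<zero>)"
  using eq_equiv_class_iff[OF frac_rel_equiv, of "(a, s)" "(b, t)"] assms
  by (simp add: frac_class_def frac_rel_iff)

lemma frac_eqI:
  assumes "a \<in> carrier R" "b \<in> carrier R" "s \<in> loc_set" "t \<in> loc_set" "a \<otimes> t = b \<otimes> s"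
  shows "fraction a s = fraction b t"
proof -
  have "\<one> \<otimes> (a \<otimes> t \<ominus> b \<otimes> s) = \<zero>" using assms by (simp add: r_neg minus_eq)
  then show ?thesis using frac_eq_iff[OF assms(1-4)] loc_set_one by blast
qed

lemma mem_frac_iff:
  assumes "a \<in> carrier R" "s \<in> loc_set"
  shows "(b, t) \<in> fraction a s \<longleftrightarrow>
     b \<in> carrier R \<and> t \<in> loc_set \<and> (\<exists>u\<in>loc_set. u \<otimes> (a \<otimes> t \<ominus> b \<otimes> s) = \<zero>)"
  using assms by (simp add: frac_class_def frac_rel_iff)

text \<open>The operations of \<open>localization\<close> are unions over all pairs of
  representatives; well-definedness collapses such a union to its common value.\<close>

lemma UN_fraction2:
  fixes F :: "'a \<Rightarrow> 'a \<Rightarrow> 'a \<Rightarrow> 'a \<Rightarrow> 'c set"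
  assumes "a \<in> carrier R" "s \<in> loc_set" "b \<in> carrier R" "t \<in> loc_set"
    and "\<And>a' s' b' t'. (a', s') \<in> fraction a s \<Longrightarrow> (b', t') \<in> fraction b t \<Longrightarrow> F a' s' b' t' = Y"
  shows "(\<Union>(a', s')\<in>fraction a s. \<Union>(b', t')\<in>fraction b t. F a' s' b' t') = Y"
proof -
  have "(a, s) \<in> fraction a s" "(b, t) \<in> fraction b t"
    using equiv_class_self[OF frac_rel_equiv] assms(1-4) by (auto simp: frac_class_def)
  moreover have "(\<Union>q\<in>fraction b t. F a' s' (fst q) (snd q)) = Y" if "(a', s') \<in> fraction a s" for a' s'
    by (rule SUP_eq_const) (use assms(5)[OF that] \<open>(b, t) \<in> fraction b t\<close> in auto)
  ultimately show ?thesis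
    unfolding case_prod_beta' by (intro SUP_eq_const[of "fraction a s"]) auto
qed

lemma frac_mult:
  assumes "a \<in> carrier R" "s \<in> loc_set" "b \<in> carrier R" "t \<in> loc_set"
  shows "fraction a s \<otimes>\<^bsub>loc_ring\<^esub> fraction b t = fraction (a \<otimes> b) (s \<otimes> t)"
  unfolding localization_def monoid.simps
proof (rule UN_fraction2[OF assms])
  fix a' s' b' t' assume *: "(a', s') \<in> fraction a s" "(b', t') \<in> fraction b t"
  obtain u where u: "a' \<in> carrier R" "s' \<in> loc_set" "u \<in> loc_set" "u \<otimes> (a \<otimes> s' \<ominus> a' \<otimes> s) = \<zero>"
    using * mem_frac_iff assms by metis
  obtain w where w: "b' \<in> carrier R" "t' \<in> loc_set" "w \<in> loc_set" "w \<otimes> (b \<otimes> t' \<ominus> b' \<otimes> t) = \<zero>"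
    using * mem_frac_iff assms by metis
  have C: "s \<in> carrier R" "t \<in> carrier R" "s' \<in> carrier R" "t' \<in> carrier R" "u \<in> carrier R" "w \<in> carrier R"
    using u w assms by auto
  have "(u \<otimes> w) \<otimes> ((a \<otimes> b) \<otimes> (s' \<otimes> t') \<ominus> (a' \<otimes> b') \<otimes> (s \<otimes> t)) =
      w \<otimes> b \<otimes> t' \<otimes> (u \<otimes> (a \<otimes> s' \<ominus> a' \<otimes> s)) \<oplus> u \<otimes> a' \<otimes> s \<otimes> (w \<otimes> (b \<otimes> t' \<ominus> b' \<otimes> t))"
    using u(1) w(1) C assms(1,3) by algebra
  also have "\<dots> = \<zero>" using C assms u(1) unfolding u(4) w(4) by simp
  finally have "fraction (a \<otimes> b) (s \<otimes> t) = fraction (a' \<otimes> b') (s' \<otimes> t')"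
    using frac_eq_iff[of "a \<otimes> b" "a' \<otimes> b'" "s \<otimes> t" "s' \<otimes> t'"] u w assms loc_set_mult m_closed
    by blast
  then show "fraction (a' \<otimes> b') (s' \<otimes> t') = fraction (a \<otimes> b) (s \<otimes> t)" by simp
qed

lemma frac_add:
  assumes "a \<in> carrier R" "s \<in> loc_set" "b \<in> carrier R" "t \<in> loc_set"
  shows "fraction a s \<oplus>\<^bsub>loc_ring\<^esub> fraction b t = fraction (a \<otimes> t \<oplus> b \<otimes> s) (s \<otimes> t)"
  unfolding localization_def ring.simps
proof (rule UN_fraction2[OF assms])
  fix a' s' b' t' assume *: "(a', s') \<in> fraction a s" "(b', t') \<in> fraction b t"
  obtain u where u: "a' \<in> carrier R" "s' \<in> loc_set" "u \<in> loc_set" "u \<otimes> (a \<otimes> s' \<ominus> a' \<otimes> s) = \<zero>"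
    using * mem_frac_iff assms by metis
  obtain w where w: "b' \<in> carrier R" "t' \<in> loc_set" "w \<in> loc_set" "w \<otimes> (b \<otimes> t' \<ominus> b' \<otimes> t) = \<zero>"
    using * mem_frac_iff assms by metis
  have C: "s \<in> carrier R" "t \<in> carrier R" "s' \<in> carrier R" "t' \<in> carrier R" "u \<in> carrier R" "w \<in> carrier R"
    using u w assms by auto
  have "(u \<otimes> w) \<otimes> ((a \<otimes> t \<oplus> b \<otimes> s) \<otimes> (s' \<otimes> t') \<ominus> (a' \<otimes> t' \<oplus> b' \<otimes> s') \<otimes> (s \<otimes> t)) =
      w \<otimes> t \<otimes> t' \<otimes> (u \<otimes> (a \<otimes> s' \<ominus> a' \<otimes> s)) \<oplus> u \<otimes> s \<otimes> s' \<otimes> (w \<otimes> (b \<otimes> t' \<ominus> b' \<otimes> t))"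
    using u(1) w(1) C assms(1,3) by algebra
  also have "\<dots> = \<zero>" using C assms u(1) unfolding u(4) w(4) by simp
  finally have "fraction (a \<otimes> t \<oplus> b \<otimes> s) (s \<otimes> t) = fraction (a' \<otimes> t' \<oplus> b' \<otimes> s') (s' \<otimes> t')"
    using frac_eq_iff[of "a \<otimes> t \<oplus> b \<otimes> s" "a' \<otimes> t' \<oplus> b' \<otimes> s'" "s \<otimes> t" "s' \<otimes> t'"]
      u(1,2,3) w(1,2,3) assms C loc_set_mult m_closed a_closed by blast
  then show "fraction (a' \<otimes> t' \<oplus> b' \<otimes> s') (s' \<otimes> t') = fraction (a \<otimes> t \<oplus> b \<otimes> s) (s \<otimes> t)" by simp
qed

lemma loc_ring_carrier: "x \<in> carrier loc_ring \<longleftrightarrow> (\<exists>a\<in>carrier R. \<exists>s\<in>loc_set. x = fraction a s)"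
  by (auto simp: localization_def quotient_def frac_class_def)

lemma frac_closed: "\<lbrakk>a \<in> carrier R; s \<in> loc_set\<rbrakk> \<Longrightarrow> fraction a s \<in> carrier loc_ring"
  using loc_ring_carrier by blast

lemma loc_ring_one: "\<one>\<^bsub>loc_ring\<^esub> = fraction \<one> \<one>"
  and loc_ring_zero: "\<zero>\<^bsub>loc_ring\<^esub> = fraction \<zero> \<one>"
  by (simp_all add: localization_def)

definition extended :: "'a set \<Rightarrow> ('a \<times> 'a) set set" where
  "extended J = {fraction a s | a s. a \<in> J \<and> s \<in> loc_set}"

lemma frac_mem_extended_iff:
  assumes J: "ideal J R" and a: "a \<in> carrier R" "s \<in> loc_set"
  shows "fraction a s \<in> extended J \<longleftrightarrow> (\<exists>u\<in>loc_set. u \<otimes> a \<in> J)"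
proof
  interpret J: ideal J R by fact
  assume "fraction a s \<in> extended J"
  then obtain b t where bt: "fraction a s = fraction b t" "b \<in> J" "t \<in> loc_set"
    unfolding extended_def by blast
  have b: "b \<in> carrier R" using bt J.Icarr by blast
  obtain u where u: "u \<in> loc_set" "u \<otimes> (a \<otimes> t \<ominus> b \<otimes> s) = \<zero>"
    using frac_eq_iff[OF a(1) b a(2) bt(3)] bt(1) by blast
  have C: "s \<in> carrier R" "t \<in> carrier R" "u \<in> carrier R" using a u bt by auto
  have "u \<otimes> t \<otimes> a = u \<otimes> (a \<otimes> t \<ominus> b \<otimes> s) \<oplus> u \<otimes> s \<otimes> b"
    using C a(1) b by algebra
  also have "\<dots> = u \<otimes> s \<otimes> b" using C b unfolding u(2) by simp
  also have "\<dots> \<in> J" using bt(2) C by (simp add: J.I_l_closed)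
  finally show "\<exists>u\<in>loc_set. u \<otimes> a \<in> J" using loc_set_mult[OF u(1) bt(3)] by blast
next
  assume "\<exists>u\<in>loc_set. u \<otimes> a \<in> J"
  then obtain u where u: "u \<in> loc_set" "u \<otimes> a \<in> J" by blast
  have "fraction a s = fraction (u \<otimes> a) (u \<otimes> s)"
    by (rule frac_eqI) (use a u loc_set_mult in \<open>auto simp: m_ac\<close>)
  then show "fraction a s \<in> extended J"
    using u(2) loc_set_mult[OF u(1) a(2)] unfolding extended_def by blast
qed

lemma frac_mem_extended: "\<lbrakk>a \<in> J; s \<in> loc_set\<rbrakk> \<Longrightarrow> fraction a s \<in> extended J"
  unfolding extended_def by blast

lemma frac_mem_extended_prime_iff:
  assumes "primeideal J R" "J \<subseteq> I" "a \<in> carrier R" "s \<in> loc_set"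
  shows "fraction a s \<in> extended J \<longleftrightarrow> a \<in> J"
proof -
  interpret J: primeideal J R by fact
  show ?thesis
    using frac_mem_extended_iff[OF J.is_ideal assms(3,4)] J.I_prime[OF _ assms(3)] assms(2)
      frac_mem_extended[OF _ assms(4), of a J] by blast
qed

text \<open>That the localization is a commutative ring is part of the Cohen-Macaulay property. It
  is therefore an assumption here, discharged from there.\<close>

context
  assumes loc_cring: "cring loc_ring"
begin

interpretation L: cring loc_ring by (rule loc_cring)

lemma extended_ideal:
  assumes "ideal J R"
  shows "ideal (extended J) loc_ring"
proof (rule L.idealI_cring)
  interpret J: ideal J R by fact
  show "extended J \<subseteq> carrier loc_ring"
    unfolding extended_def using frac_closed J.Icarr by blast
  show "extended J \<noteq> {}" using frac_mem_extended[OF J.zero_closed loc_set_one] by blast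
  fix p assume "p \<in> extended J"
  then obtain a s where p: "p = fraction a s" "a \<in> J" "s \<in> loc_set" unfolding extended_def by blast
  have s: "s \<in> carrier R" using p by simp
  show "p \<oplus>\<^bsub>loc_ring\<^esub> q \<in> extended J" if "q \<in> extended J" for q
  proof -
    obtain b t where q: "q = fraction b t" "b \<in> J" "t \<in> loc_set"
      using \<open>q \<in> extended J\<close> unfolding extended_def by blast
    have t: "t \<in> carrier R" using q by simp
    have "p \<oplus>\<^bsub>loc_ring\<^esub> q = fraction (a \<otimes> t \<oplus> b \<otimes> s) (s \<otimes> t)"
      unfolding p(1) q(1) by (rule frac_add) (use p q J.Icarr in auto)
    moreover have "a \<otimes> t \<oplus> b \<otimes> s \<in> J"
      using J.a_closed[OF J.I_r_closed[OF p(2) t] J.I_r_closed[OF q(2) s]] .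
    ultimately show ?thesis using frac_mem_extended loc_set_mult[OF p(3) q(3)] by simp
  qed
  show "x \<otimes>\<^bsub>loc_ring\<^esub> p \<in> extended J" if x: "x \<in> carrier loc_ring" for x
  proof -
    obtain b t where b: "x = fraction b t" "b \<in> carrier R" "t \<in> loc_set"
      using x loc_ring_carrier by blast
    have "x \<otimes>\<^bsub>loc_ring\<^esub> p = fraction (b \<otimes> a) (t \<otimes> s)"
      unfolding p(1) b(1) by (rule frac_mult) (use p b J.Icarr in auto)
    then show ?thesis
      using frac_mem_extended[OF J.I_l_closed[OF p(2) b(2)] loc_set_mult[OF b(3) p(3)]] by simp
  qed
qed

lemma extended_prime:
  assumes "primeideal J R" "J \<subseteq> I"
  shows "primeideal (extended J) loc_ring"
proof -
  interpret J: primeideal J R by fact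
  show ?thesis
  proof (rule primeidealI[OF extended_ideal[OF J.is_ideal] loc_cring])
    have "\<one> \<notin> J" using J.one_imp_carrier J.I_notcarr by auto
    then have "fraction \<one> \<one> \<notin> extended J"
      using frac_mem_extended_prime_iff[OF assms one_closed loc_set_one] by simp
    then show "carrier loc_ring \<noteq> extended J"
      using frac_closed[OF one_closed loc_set_one] by blast
    fix x y assume xy: "x \<in> carrier loc_ring" "y \<in> carrier loc_ring" "x \<otimes>\<^bsub>loc_ring\<^esub> y \<in> extended J"
    obtain a s where x: "x = fraction a s" "a \<in> carrier R" "s \<in> loc_set"
      using xy loc_ring_carrier by blast
    obtain b t where y: "y = fraction b t" "b \<in> carrier R" "t \<in> loc_set"
      using xy loc_ring_carrier by blast
    have "fraction (a \<otimes> b) (s \<otimes> t) \<in> extended J"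
      using xy(3) frac_mult[OF x(2,3) y(2,3)] x y by simp
    then have "a \<otimes> b \<in> J"
      using frac_mem_extended_prime_iff[OF assms m_closed[OF x(2) y(2)] loc_set_mult[OF x(3) y(3)]] by simp
    then have "a \<in> J \<or> b \<in> J" by (rule J.I_prime[OF x(2) y(2)])
    then show "x \<in> extended J \<or> y \<in> extended J"
      using frac_mem_extended x y by blast
  qed
qed

text \<open>A prime inside \<open>I\<close> can be recovered from its extension by
  \<open>frac_mem_extended_prime_iff\<close>, so strict chains ending in \<open>I\<close> extend to
  strict chains.\<close>

lemma prime_height_le_krull_dim: "prime_height R I \<le> krull_dim loc_ring"
  unfolding prime_height_def
proof (rule Sup_least)
  fix h assume "h \<in> {enat n | n. \<exists>p. (\<forall>i\<le>n. primeideal (p i) R) \<and> (\<forall>i<n. p i \<subset> p (Suc i)) \<and> p n = I}"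
  then obtain n p where p: "h = enat n" "\<And>i. i \<le> n \<Longrightarrow> primeideal (p i) R"
    "\<And>i. i < n \<Longrightarrow> p i \<subset> p (Suc i)" "p n = I" by blast
  have sub: "p i \<subseteq> I" if "i \<le> n" for i
    using that by (induction rule: inc_induct) (use p in blast)+
  have prime: "primeideal (extended (p i)) loc_ring" if "i \<le> n" for i
    using extended_prime p(2) sub that by blast
  have strict: "extended (p i) \<subset> extended (p (Suc i))" if "i < n" for i
  proof
    show "extended (p i) \<subseteq> extended (p (Suc i))"
      using p(3)[OF that] unfolding extended_def by blast
    obtain a where a: "a \<in> p (Suc i)" "a \<notin> p i" using p(3)[OF \<open>i < n\<close>] by blast
    have ac: "a \<in> carrier R" using a(1) sub[of "Suc i"] that Icarr by auto
    have "fraction a \<one> \<in> extended (p (Suc i))" using frac_mem_extended a(1) loc_set_one by blast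
    moreover have "fraction a \<one> \<notin> extended (p i)"
      using frac_mem_extended_prime_iff[OF p(2) sub ac loc_set_one] a(2) that by simp
    ultimately show "extended (p i) \<noteq> extended (p (Suc i))" by blast
  qed
  have "h \<le> prime_height loc_ring (extended (p n))"
    unfolding prime_height_def p(1)
    by (rule Sup_upper) (use prime strict in \<open>auto intro!: exI[of _ "\<lambda>i. extended (p i)"]\<close>)
  also have "\<dots> \<le> krull_dim loc_ring"
    unfolding krull_dim_def by (rule SUP_upper) (use prime in auto)
  finally show "h \<le> krull_dim loc_ring" .
qed

text \<open>A fraction whose numerator lies outside \<open>I\<close> is a unit.\<close>

lemma maximalideal_subset_extended:
  assumes "maximalideal M loc_ring"
  shows "M \<subseteq> extended I"
proof
  interpret M: maximalideal M loc_ring by fact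
  fix x assume x: "x \<in> M"
  then obtain a s where a: "x = fraction a s" "a \<in> carrier R" "s \<in> loc_set"
    using M.Icarr loc_ring_carrier by metis
  show "x \<in> extended I"
  proof (cases "a \<in> I")
    case False
    then have as: "a \<in> loc_set" "s \<in> carrier R" using a by auto
    have "x \<otimes>\<^bsub>loc_ring\<^esub> fraction s a = fraction (a \<otimes> s) (s \<otimes> a)"
      unfolding a(1) by (rule frac_mult) (use a as in auto)
    also have "\<dots> = \<one>\<^bsub>loc_ring\<^esub>"
      unfolding loc_ring_one by (rule frac_eqI) (use a as loc_set_one loc_set_mult in \<open>auto simp: m_comm\<close>)
    finally have "\<one>\<^bsub>loc_ring\<^esub> \<in> M"
      using M.I_r_closed[OF x frac_closed[OF as(2,1)]] by simp
    then show ?thesis using M.one_imp_carrier M.I_notcarr by simp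
  qed (use a frac_mem_extended in simp)
qed

lemma regular_mod_extended:
  assumes J: "ideal J R" and x: "x \<in> carrier R" "regular_mod R J x"
  shows "regular_mod loc_ring (extended J) (fraction x \<one>)"
  unfolding regular_mod_def
proof (intro ballI impI)
  fix y assume y: "y \<in> carrier loc_ring" "fraction x \<one> \<otimes>\<^bsub>loc_ring\<^esub> y \<in> extended J"
  obtain a s where a: "y = fraction a s" "a \<in> carrier R" "s \<in> loc_set" using y loc_ring_carrier by blast
  have s: "s \<in> carrier R" using a by simp
  have "fraction (x \<otimes> a) s \<in> extended J"
    using y(2) frac_mult[OF x(1) loc_set_one a(2,3)] a(1) s by simp
  then obtain u where u: "u \<in> loc_set" "u \<otimes> (x \<otimes> a) \<in> J"
    using frac_mem_extended_iff[OF J m_closed[OF x(1) a(2)] a(3)] by blast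
  have uc: "u \<in> carrier R" using u by simp
  have "x \<otimes> (u \<otimes> a) \<in> J" using u(2) m_lcomm[OF x(1) uc a(2)] by simp
  then have "u \<otimes> a \<in> J" by (rule regular_modD[OF x(2) m_closed[OF uc a(2)]])
  then show "y \<in> extended J" using frac_mem_extended_iff[OF J a(2,3)] u(1) a(1) by blast
qed

lemma ideal_adjoin_extended:
  assumes J: "ideal J R" and x: "x \<in> carrier R"
  shows "ideal_adjoin loc_ring (extended J) (fraction x \<one>) = extended (ideal_adjoin R J x)"
proof
  interpret J: ideal J R by fact
  show "extended (ideal_adjoin R J x) \<subseteq> ideal_adjoin loc_ring (extended J) (fraction x \<one>)"
  proof
    fix y assume "y \<in> extended (ideal_adjoin R J x)"
    then obtain a s where a: "y = fraction a s" "a \<in> ideal_adjoin R J x" "s \<in> loc_set"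
      unfolding extended_def by blast
    obtain k r where k: "a = k \<oplus> x \<otimes> r" "k \<in> J" "r \<in> carrier R" using a(2) by (rule ideal_adjoinE)
    have kc: "k \<in> carrier R" "s \<in> carrier R" using k a J.Icarr by auto
    have "fraction k s \<oplus>\<^bsub>loc_ring\<^esub> fraction x \<one> \<otimes>\<^bsub>loc_ring\<^esub> fraction r s = fraction (k \<otimes> s \<oplus> x \<otimes> r \<otimes> s) (s \<otimes> s)"
      using frac_mult[OF x loc_set_one k(3) a(3)] frac_add[OF kc(1) a(3) m_closed[OF x k(3)] a(3)] kc by simp
    also have "\<dots> = y" unfolding a(1) k(1)
    proof (rule frac_eqI)
      show "(k \<otimes> s \<oplus> x \<otimes> r \<otimes> s) \<otimes> s = (k \<oplus> x \<otimes> r) \<otimes> (s \<otimes> s)" using kc x k(3) by algebra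
    qed (use kc x k a loc_set_mult in auto)
    finally show "y \<in> ideal_adjoin loc_ring (extended J) (fraction x \<one>)"
      using L.ideal_adjoinI[OF sym frac_mem_extended[OF k(2) a(3)] frac_closed[OF k(3) a(3)]] by blast
  qed
  show "ideal_adjoin loc_ring (extended J) (fraction x \<one>) \<subseteq> extended (ideal_adjoin R J x)"
  proof (rule L.ideal_adjoin_least[OF extended_ideal[OF ideal_adjoin_ideal[OF J x]]])
    show "extended J \<subseteq> extended (ideal_adjoin R J x)"
      using subset_ideal_adjoin[OF J x] unfolding extended_def by blast
    show "fraction x \<one> \<in> extended (ideal_adjoin R J x)"
      by (rule frac_mem_extended[OF mem_ideal_adjoin[OF J x] loc_set_one])
  qed
qed

lemma regular_seq_mod_extended:
  assumes "ideal J R" "regular_seq_mod J xs"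
  shows "L.regular_seq_mod (extended J) (map (\<lambda>x. fraction x \<one>) xs)"
  using assms
proof (induction xs arbitrary: J)
  case (Cons x xs)
  then show ?case
    using regular_mod_extended[of J x] ideal_adjoin_extended[of J x] ideal_adjoin_ideal[of J x]
      frac_closed[OF _ loc_set_one, of x] by simp
qed simp

lemma ideal_adjoin_list_extended:
  assumes "ideal J R" "set xs \<subseteq> carrier R"
  shows "L.ideal_adjoin_list (extended J) (map (\<lambda>x. fraction x \<one>) xs) = extended (ideal_adjoin_list J xs)"
  using assms
proof (induction xs arbitrary: J)
  case (Cons x xs)
  then show ?case using ideal_adjoin_extended[of J x] ideal_adjoin_ideal[of J x] by simp
qed simp

lemma extended_zero: "extended {\<zero>} = {\<zero>\<^bsub>loc_ring\<^esub>}"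
proof -
  have "fraction \<zero> s = fraction \<zero> \<one>" if "s \<in> loc_set" for s
    by (rule frac_eqI) (use that loc_set_one in auto)
  then show ?thesis using loc_set_one unfolding extended_def loc_ring_zero by blast
qed

text \<open>As \<open>I\<close> is exactly the annihilator of \<open>u\<close> modulo
  \<open>K\<close>, no denominator kills \<open>u\<close>; its image stays nonzero and is killed by
  the extension of \<open>I\<close>.\<close>

lemma kills_mod_extended:
  assumes K: "ideal K R" and u: "u \<in> carrier R" "I = colon_ideal R K u"
  shows "L.kills_mod (extended I) (extended K)"
  unfolding L.kills_mod_def
proof (intro bexI conjI ballI)
  show "fraction u \<one> \<notin> extended K"
    using frac_mem_extended_iff[OF K u(1) loc_set_one] u by (auto simp: mem_colon_ideal)
  show "y \<otimes>\<^bsub>loc_ring\<^esub> fraction u \<one> \<in> extended K" if "y \<in> extended I" for y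
  proof -
    obtain a s where a: "y = fraction a s" "a \<in> I" "s \<in> loc_set"
      using \<open>y \<in> extended I\<close> unfolding extended_def by blast
    have "y \<otimes>\<^bsub>loc_ring\<^esub> fraction u \<one> = fraction (a \<otimes> u) s"
      using frac_mult[OF Icarr[OF a(2)] a(3) u(1) loc_set_one] a by simp
    moreover have "a \<otimes> u \<in> K" using a(2) u(2) by (simp add: mem_colon_ideal)
    ultimately show ?thesis using frac_mem_extended a(3) by simp
  qed
qed (rule frac_closed[OF u(1) loc_set_one])

end
end

text \<open>Unmixedness: the localization at \<open>P\<close> has a maximal regular sequence of length
  \<open>length xs\<close>, hence this depth and dimension.\<close>

lemma assoc_prime_height_le:
  assumes CM: "cohen_macaulay R" and xs: "cring.regular_seq_mod R {\<zero>\<^bsub>R\<^esub>} xs"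
    and P: "P \<in> assoc_primes R (cring.ideal_adjoin_list R {\<zero>\<^bsub>R\<^esub>} xs)"
  shows "prime_height R P \<le> enat (length xs)"
proof -
  interpret R: cring R using CM by (simp add: cohen_macaulay_def)
  define K where "K = R.ideal_adjoin_list {\<zero>\<^bsub>R\<^esub>} xs"
  have carr: "set xs \<subseteq> carrier R" by (rule R.regular_seq_mod_carrier[OF xs])
  have K: "ideal K R" unfolding K_def by (rule R.ideal_adjoin_list_ideal[OF R.zeroideal carr])
  obtain u where u: "primeideal P R" "u \<in> carrier R" "u \<notin> K" "P = colon_ideal R K u"
    using R.assoc_primeE[OF K] P unfolding K_def by metis
  interpret P: primeideal P R by (rule u(1))
  define A where "A = P.loc_ring"
  have "cohen_macaulay_local A" using CM u(1) by (simp add: cohen_macaulay_def A_def)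
  then obtain M where A: "cring A" "noetherian_ring A" and M: "maximalideal M A"
    and depth: "ideal_depth A M = krull_dim A"
    unfolding cohen_macaulay_local_def by blast
  interpret A: noetherian_cring A using A by (simp add: noetherian_cring_def)
  note A' = A(1)[unfolded A_def]
  define zs where "zs = map (\<lambda>x. P.fraction x \<one>\<^bsub>R\<^esub>) xs"
  have zs: "A.regular_seq_mod {\<zero>\<^bsub>A\<^esub>} zs" "A.ideal_adjoin_list {\<zero>\<^bsub>A\<^esub>} zs = P.extended K"
    using P.regular_seq_mod_extended[OF A' R.zeroideal xs]
      P.ideal_adjoin_list_extended[OF A' R.zeroideal carr]
    unfolding P.extended_zero[OF A'] zs_def A_def K_def by simp_all
  have kills: "A.kills_mod (P.extended P) (A.ideal_adjoin_list {\<zero>\<^bsub>A\<^esub>} zs)"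
    using P.kills_mod_extended[OF A' K u(2,4)] unfolding zs(2) by (simp add: A_def)
  have I: "ideal (P.extended P) A" using P.extended_ideal[OF A' P.is_ideal] unfolding A_def .
  have "set xs \<subseteq> K"
    using R.genideal_self[OF carr] R.genideal_set_eq_ideal_adjoin_list[OF carr] by (simp add: K_def)
  then have "set xs \<subseteq> P" using R.assoc_prime_subset[OF K P[folded K_def]] by blast
  then have zsI: "set zs \<subseteq> P.extended P"
    unfolding zs_def using P.frac_mem_extended[OF _ P.loc_set_one] by auto
  have "ideal_depth A M \<le> enat (length xs)"
    unfolding ideal_depth_def
  proof (rule SUP_least)
    fix ys assume "ys \<in> {xs. regular_sequence A xs \<and> set xs \<subseteq> M}"
    then have ys: "A.regular_seq_mod {\<zero>\<^bsub>A\<^esub>} ys" "set ys \<subseteq> M"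
      using A.regular_seq_mod_of_regular_sequence by blast+
    \<comment> \<open>\<open>M\<close> is the maximal ideal that the Cohen-Macaulay property
      supplies; its inclusion in the extension of \<open>P\<close> suffices to compare
      lengths.\<close>
    then have "set ys \<subseteq> P.extended P"
      using P.maximalideal_subset_extended[OF A' M[unfolded A_def]] by blast
    then have "length ys \<le> length zs"
      by (rule A.regular_seq_mod_length_le[OF A.zeroideal I zs(1) ys(1) zsI _ kills])
    then show "enat (length ys) \<le> enat (length xs)" by (simp add: zs_def)
  qed
  then show ?thesis using P.prime_height_le_krull_dim[OF A'] depth unfolding A_def by simp
qed

section \<open>Regular sequences acting on a complex\<close>

text \<open>Axioms for dividing operators out of a complex, where \<open>F j n\<close> is the part
  of \<open>C n\<close> generated by the images of the first \<open>j\<close> of them. Place 0 is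
  the augmentation, so exactness concerns places 0 to \<open>k\<close> and the class under study
  lives in place \<open>Suc k\<close>. The operators \<open>x 0\<close> to \<open>x (Suc k)\<close>,
  which are \<open>k + 2\<close> in number, are regular in every place.\<close>

locale regular_complex = abelian_group A for A (structure) +
  fixes C :: "nat \<Rightarrow> 'a set" and d :: "'a \<Rightarrow> 'a" and x :: "nat \<Rightarrow> 'a \<Rightarrow> 'a"
    and F :: "nat \<Rightarrow> nat \<Rightarrow> 'a set" and k :: nat
  assumes C_sub: "additive_subgroup (C n) A"
    and d_closed: "f \<in> C n \<Longrightarrow> d f \<in> C (Suc n)"
    and d_add: "\<lbrakk>f \<in> C n; g \<in> C n\<rbrakk> \<Longrightarrow> d (f \<oplus> g) = d f \<oplus> d g"
    and d_d: "f \<in> C n \<Longrightarrow> d (d f) = \<zero>"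
    and x_closed: "f \<in> C n \<Longrightarrow> x i f \<in> C n"
    and x_add: "\<lbrakk>f \<in> C n; g \<in> C n\<rbrakk> \<Longrightarrow> x i (f \<oplus> g) = x i f \<oplus> x i g"
    and x_d: "f \<in> C n \<Longrightarrow> x i (d f) = d (x i f)"
    and x_x: "f \<in> C n \<Longrightarrow> x i (x j f) = x j (x i f)"
    and F_0: "F 0 n = {\<zero>}"
    and F_Suc: "F (Suc j) n = {f \<oplus> x j g | f g. f \<in> F j n \<and> g \<in> C n}"
    and regular: "\<lbrakk>j \<le> Suc k; f \<in> C n; x j f \<in> F j n\<rbrakk> \<Longrightarrow> f \<in> F j n"
    and exact_0: "\<lbrakk>f \<in> C 0; d f = \<zero>\<rbrakk> \<Longrightarrow> f = \<zero>"
    and exact_Suc: "\<lbrakk>Suc n \<le> k; f \<in> C (Suc n); d f = \<zero>\<rbrakk> \<Longrightarrow> f \<in> d ` C n"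
begin

lemma C_carrier: "f \<in> C n \<Longrightarrow> f \<in> carrier A"
  using additive_subgroup.a_Hcarr[OF C_sub] .

lemma a_inv_zero: "\<ominus> \<zero> = \<zero>"
  by (rule minus_equality) auto

lemma C_closed:
  "\<zero> \<in> C n" "\<lbrakk>f \<in> C n; g \<in> C n\<rbrakk> \<Longrightarrow> f \<oplus> g \<in> C n" "f \<in> C n \<Longrightarrow> \<ominus> f \<in> C n"
  "\<lbrakk>f \<in> C n; g \<in> C n\<rbrakk> \<Longrightarrow> f \<ominus> g \<in> C n"
  using additive_subgroup.zero_closed[OF C_sub] additive_subgroup.a_closed[OF C_sub]
    additive_subgroup.a_inv_closed[OF C_sub] by (auto simp: minus_eq)

lemma additive_zero_minus:
  assumes T: "\<And>f. f \<in> C n \<Longrightarrow> T f \<in> carrier A"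
    and add: "\<And>f g. f \<in> C n \<Longrightarrow> g \<in> C n \<Longrightarrow> T (f \<oplus> g) = T f \<oplus> T g"
  shows "T \<zero> = \<zero>" "\<lbrakk>f \<in> C n; g \<in> C n\<rbrakk> \<Longrightarrow> T (f \<ominus> g) = T f \<ominus> T g"
proof -
  have "T \<zero> \<oplus> T \<zero> = T \<zero>" using add[OF C_closed(1) C_closed(1)] by simp
  then show 0: "T \<zero> = \<zero>" using T[OF C_closed(1)] add.r_cancel_one by blast
  assume fg: "f \<in> C n" "g \<in> C n"
  have "T (f \<ominus> g) \<oplus> T g = T (f \<ominus> g \<oplus> g)" using add[OF C_closed(4)[OF fg] fg(2)] by simp
  also have "f \<ominus> g \<oplus> g = f" using fg C_carrier by (simp add: minus_eq a_assoc l_neg)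
  finally have "T (f \<ominus> g) \<oplus> T g \<ominus> T g = T f \<ominus> T g" by simp
  then show "T (f \<ominus> g) = T f \<ominus> T g"
    using T[OF C_closed(4)[OF fg]] T[OF fg(2)] by (simp add: minus_eq a_assoc r_neg)
qed

lemma d_zero: "d \<zero> = \<zero>"
  and d_minus: "\<lbrakk>f \<in> C n; g \<in> C n\<rbrakk> \<Longrightarrow> d (f \<ominus> g) = d f \<ominus> d g"
  using additive_zero_minus[of _ d] d_add C_carrier[OF d_closed] by blast+

lemma x_zero: "x i \<zero> = \<zero>"
  and x_minus: "\<lbrakk>f \<in> C n; g \<in> C n\<rbrakk> \<Longrightarrow> x i (f \<ominus> g) = x i f \<ominus> x i g"
  using additive_zero_minus[of _ "x i"] x_add C_carrier[OF x_closed] by blast+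

lemma F_SucI: "\<lbrakk>h = f \<oplus> x j g; f \<in> F j n; g \<in> C n\<rbrakk> \<Longrightarrow> h \<in> F (Suc j) n"
  unfolding F_Suc by blast

lemma F_SucE:
  assumes "h \<in> F (Suc j) n"
  obtains f g where "h = f \<oplus> x j g" "f \<in> F j n" "g \<in> C n"
  using assms unfolding F_Suc by blast

lemma F_C: "f \<in> F j n \<Longrightarrow> f \<in> C n"
proof (induction j arbitrary: f)
  case 0
  then show ?case using F_0 C_closed(1) by simp
next
  case (Suc j)
  then show ?case by (metis F_SucE C_closed(2) x_closed)
qed

lemma F_zero: "\<zero> \<in> F j n"
proof (induction j)
  case 0
  then show ?case using F_0 by simp
next
  case (Suc j)
  show ?case by (rule F_SucI[OF _ Suc C_closed(1)]) (simp add: x_zero)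
qed

lemma F_add: "\<lbrakk>f \<in> F j n; g \<in> F j n\<rbrakk> \<Longrightarrow> f \<oplus> g \<in> F j n"
proof (induction j arbitrary: f g)
  case 0
  then show ?case using F_0 by simp
next
  case (Suc j)
  obtain f1 f2 where f: "f = f1 \<oplus> x j f2" "f1 \<in> F j n" "f2 \<in> C n" using Suc.prems(1) by (rule F_SucE)
  obtain g1 g2 where g: "g = g1 \<oplus> x j g2" "g1 \<in> F j n" "g2 \<in> C n" using Suc.prems(2) by (rule F_SucE)
  note C = C_carrier[OF F_C[OF f(2)]] C_carrier[OF F_C[OF g(2)]]
    C_carrier[OF x_closed[OF f(3)]] C_carrier[OF x_closed[OF g(3)]]
  have "f \<oplus> g = (f1 \<oplus> g1) \<oplus> x j (f2 \<oplus> g2)"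
    unfolding f(1) g(1) x_add[OF f(3) g(3)] using C by (simp add: a_ac)
  then show ?case by (rule F_SucI[OF _ Suc.IH[OF f(2) g(2)] C_closed(2)[OF f(3) g(3)]])
qed

lemma F_minus: "\<lbrakk>f \<in> F j n; g \<in> F j n\<rbrakk> \<Longrightarrow> f \<ominus> g \<in> F j n"
proof (induction j arbitrary: f g)
  case 0
  then show ?case using F_0 by (simp add: minus_eq)
next
  case (Suc j)
  obtain f1 f2 where f: "f = f1 \<oplus> x j f2" "f1 \<in> F j n" "f2 \<in> C n" using Suc.prems(1) by (rule F_SucE)
  obtain g1 g2 where g: "g = g1 \<oplus> x j g2" "g1 \<in> F j n" "g2 \<in> C n" using Suc.prems(2) by (rule F_SucE)
  note C = C_carrier[OF F_C[OF f(2)]] C_carrier[OF F_C[OF g(2)]]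
    C_carrier[OF x_closed[OF f(3)]] C_carrier[OF x_closed[OF g(3)]]
  have "f \<ominus> g = (f1 \<ominus> g1) \<oplus> x j (f2 \<ominus> g2)"
    unfolding f(1) g(1) x_minus[OF f(3) g(3)] using C by (simp add: a_ac minus_eq minus_add)
  then show ?case by (rule F_SucI[OF _ Suc.IH[OF f(2) g(2)] C_closed(4)[OF f(3) g(3)]])
qed

lemma F_x: "f \<in> F j n \<Longrightarrow> x i f \<in> F j n"
proof (induction j arbitrary: f)
  case 0
  then show ?case using F_0 x_zero by simp
next
  case (Suc j)
  obtain f1 f2 where f: "f = f1 \<oplus> x j f2" "f1 \<in> F j n" "f2 \<in> C n" using Suc.prems(1) by (rule F_SucE)
  have "x i f = x i f1 \<oplus> x j (x i f2)"
    unfolding f(1) x_add[OF F_C[OF f(2)] x_closed[OF f(3)]] x_x[OF f(3), of i j] ..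
  then show ?case by (rule F_SucI[OF _ Suc.IH[OF f(2)] x_closed[OF f(3)]])
qed

lemma F_d: "f \<in> F j n \<Longrightarrow> d f \<in> F j (Suc n)"
proof (induction j arbitrary: f)
  case 0
  then show ?case using F_0 d_zero by simp
next
  case (Suc j)
  obtain f1 f2 where f: "f = f1 \<oplus> x j f2" "f1 \<in> F j n" "f2 \<in> C n" using Suc.prems(1) by (rule F_SucE)
  have "d f = d f1 \<oplus> x j (d f2)"
    unfolding f(1) d_add[OF F_C[OF f(2)] x_closed[OF f(3)]] x_d[OF f(3)] ..
  then show ?case by (rule F_SucI[OF _ Suc.IH[OF f(2)] d_closed[OF f(3)]])
qed

text \<open>The zero group in place 0 lets the injectivity of \<open>d\<close> there count as
  exactness.\<close>

definition B :: "nat \<Rightarrow> 'a set" where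
  "B n = (case n of 0 \<Rightarrow> {\<zero>} | Suc m \<Rightarrow> d ` C m)"

lemma B_0: "B 0 = {\<zero>}" and B_Suc: "B (Suc n) = d ` C n"
  by (simp_all add: B_def)

lemma B_C: "e \<in> B n \<Longrightarrow> e \<in> C n"
  using C_closed(1) d_closed by (cases n) (auto simp: B_0 B_Suc)

lemma B_d: "e \<in> B n \<Longrightarrow> d e = \<zero>"
  using d_zero d_d by (cases n) (auto simp: B_0 B_Suc)

lemma minus_cancel: "\<lbrakk>f \<in> carrier A; g \<in> carrier A\<rbrakk> \<Longrightarrow> f \<ominus> g \<oplus> g = f"
  by (simp add: minus_eq a_assoc l_neg)

lemma minus_diff_minus:
  assumes "u \<in> carrier A" "v \<in> carrier A" "w \<in> carrier A"
  shows "w \<ominus> v = (u \<ominus> v) \<ominus> (u \<ominus> w)"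
proof -
  have "(u \<ominus> v) \<ominus> (u \<ominus> w) = (u \<oplus> \<ominus> u) \<oplus> (w \<oplus> \<ominus> v)"
    using assms by (simp add: minus_eq minus_add a_ac)
  then show ?thesis using assms by (simp add: minus_eq r_neg)
qed

lemma minus_diff_add:
  assumes "f \<in> carrier A" "e \<in> carrier A" "g \<in> carrier A"
  shows "f \<ominus> e = (f \<ominus> g \<ominus> e) \<oplus> g"
proof -
  have "(f \<ominus> g \<ominus> e) \<oplus> g = (f \<oplus> \<ominus> e) \<oplus> (g \<oplus> \<ominus> g)"
    using assms by (simp add: minus_eq a_ac)
  then show ?thesis using assms by (simp add: minus_eq r_neg)
qed

lemma minus_diff_add2:
  assumes "f \<in> carrier A" "e \<in> carrier A" "g \<in> carrier A"
  shows "f \<ominus> e = (f \<ominus> (g \<oplus> e)) \<oplus> g"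
proof -
  have "(f \<ominus> (g \<oplus> e)) \<oplus> g = (f \<oplus> \<ominus> e) \<oplus> (g \<oplus> \<ominus> g)"
    using assms by (simp add: minus_eq minus_add a_ac)
  then show ?thesis using assms by (simp add: minus_eq r_neg)
qed

text \<open>Dividing out each \<open>x j\<close> costs one degree of exactness.\<close>

lemma exact_mod:
  "\<lbrakk>n + j \<le> k; f \<in> C n; d f \<in> F j (Suc n)\<rbrakk> \<Longrightarrow> \<exists>e\<in>B n. f \<ominus> e \<in> F j n"
proof (induction j arbitrary: n f)
  case 0
  then have df: "d f = \<zero>" using F_0 by simp
  have "f \<in> B n"
  proof (cases n)
    case 0
    then show ?thesis using exact_0[of f] df \<open>f \<in> C n\<close> by (simp add: B_0)
  next
    case (Suc m)
    then show ?thesis using exact_Suc[of m f] df \<open>f \<in> C n\<close> \<open>n + 0 \<le> k\<close> by (simp add: B_Suc)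
  qed
  then show ?case using C_carrier[OF \<open>f \<in> C n\<close>] F_0
    by (intro bexI[of _ f]) (simp_all add: minus_eq r_neg)
next
  case (Suc j)
  obtain a b where ab: "d f = a \<oplus> x j b" "a \<in> F j (Suc n)" "b \<in> C (Suc n)"
    using Suc.prems(3) by (rule F_SucE)
  note c = C_carrier[OF F_C[OF ab(2)]] C_carrier[OF x_closed[OF ab(3), of j]]
  \<comment> \<open>Applying \<open>d\<close> again puts \<open>x j (d b)\<close> into
    \<open>F j\<close>, and regularity cancels \<open>x j\<close>. So \<open>b\<close> is a cycle
    modulo \<open>F j\<close> in place \<open>Suc n\<close>, where the induction hypothesis makes it
    a boundary \<open>d b'\<close>; then \<open>f - x j b'\<close> is a cycle modulo
    \<open>F j\<close>, and the hypothesis applies once more.\<close>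
  have "d a \<oplus> x j (d b) = \<zero>"
    using d_d[OF Suc.prems(2)] unfolding ab(1) d_add[OF F_C[OF ab(2)] x_closed[OF ab(3)]] x_d[OF ab(3)] .
  then have "x j (d b) = \<zero> \<ominus> d a"
    using C_carrier[OF d_closed[OF F_C[OF ab(2)]]] C_carrier[OF x_closed[OF d_closed[OF ab(3)]], of j]
    by (metis a_comm l_zero minus_eq minus_equality a_inv_closed)
  also have "\<dots> \<in> F j (Suc (Suc n))" by (rule F_minus[OF F_zero F_d[OF ab(2)]])
  finally have "d b \<in> F j (Suc (Suc n))" using regular[OF _ d_closed[OF ab(3)]] Suc.prems(1) by simp
  then obtain e' where e': "e' \<in> B (Suc n)" "b \<ominus> e' \<in> F j (Suc n)"
    using Suc.IH[OF _ ab(3)] Suc.prems(1) by auto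
  then obtain b' where b': "e' = d b'" "b' \<in> C n" by (auto simp: B_Suc)
  have "d (f \<ominus> x j b') = a \<oplus> x j b \<ominus> x j (d b')"
    unfolding d_minus[OF Suc.prems(2) x_closed[OF b'(2)]] ab(1) x_d[OF b'(2)] ..
  also have "\<dots> = a \<oplus> x j (b \<ominus> d b')"
    unfolding x_minus[OF ab(3) d_closed[OF b'(2)]]
    using c C_carrier[OF x_closed[OF d_closed[OF b'(2)]], of j] by (simp add: minus_eq a_assoc)
  also have "\<dots> \<in> F j (Suc n)" using F_add[OF ab(2) F_x[OF e'(2)]] unfolding b'(1) .
  finally obtain e where e: "e \<in> B n" "f \<ominus> x j b' \<ominus> e \<in> F j n"
    using Suc.IH[OF _ C_closed(4)[OF Suc.prems(2) x_closed[OF b'(2)]]] Suc.prems(1) by auto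
  have "f \<ominus> e = (f \<ominus> x j b' \<ominus> e) \<oplus> x j b'"
    by (rule minus_diff_add[OF C_carrier[OF Suc.prems(2)] C_carrier[OF B_C[OF e(1)]]
          C_carrier[OF x_closed[OF b'(2)]]])
  then have "f \<ominus> e \<in> F (Suc j) n" by (rule F_SucI[OF _ e(2) b'(2)])
  then show ?case using e(1) by blast
qed

text \<open>If all \<open>x i\<close> kill the class of \<open>f\<close> modulo \<open>F j\<close>, write \<open>x j f = d b\<close> there: then \<open>b\<close> is a class
  modulo \<open>F (Suc j)\<close>, one degree lower, that is again killed by all \<open>x i\<close>. In degree 0 this
  contradicts regularity.\<close>

lemma torsion_mod:
  "\<lbrakk>n + j = Suc k; f \<in> C n; \<And>i. i \<le> Suc k \<Longrightarrow> \<exists>e\<in>B n. x i f \<ominus> e \<in> F j n\<rbrakk> \<Longrightarrow>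
     \<exists>e\<in>B n. f \<ominus> e \<in> F j n"
proof (induction n arbitrary: j f)
  case 0
  \<comment> \<open>In place 0 the first \<open>Suc k\<close> operators have been divided out, and
    the last one, \<open>x (Suc k)\<close>, is still regular.\<close>
  have j: "j = Suc k" using "0.prems"(1) by simp
  have "x j f \<ominus> \<zero> \<in> F j 0" using "0.prems"(3)[of j] j by (simp add: B_0)
  then have "x j f \<in> F j 0" using C_carrier[OF x_closed[OF "0.prems"(2)], of j] by (simp add: minus_eq a_inv_zero)
  then have "f \<in> F j 0" using regular[OF _ "0.prems"(2)] j by simp
  then show ?case using C_carrier[OF "0.prems"(2)] by (simp add: B_0 minus_eq a_inv_zero)
next
  case (Suc n)
  note f = Suc.prems(2)
  obtain e0 where "e0 \<in> B (Suc n)" "x j f \<ominus> e0 \<in> F j (Suc n)" using Suc.prems(1) Suc.prems(3)[of j] by auto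
  then obtain b where b: "b \<in> C n" "x j f \<ominus> d b \<in> F j (Suc n)" by (auto simp: B_Suc)
  have "\<exists>e\<in>B n. x i b \<ominus> e \<in> F (Suc j) n" if i: "i \<le> Suc k" for i
  proof -
    obtain e1 where "e1 \<in> B (Suc n)" "x i f \<ominus> e1 \<in> F j (Suc n)" using Suc.prems(3)[OF i] by blast
    then obtain b1 where b1: "b1 \<in> C n" "x i f \<ominus> d b1 \<in> F j (Suc n)" by (auto simp: B_Suc)
    note C = C_carrier[OF x_closed[OF x_closed[OF f]], of j i]
      C_carrier[OF x_closed[OF d_closed[OF b(1)]], of i] C_carrier[OF x_closed[OF d_closed[OF b1(1)]], of j]
    \<comment> \<open>Both \<open>x i (d b)\<close> and \<open>x j (d b1)\<close> represent
      \<open>x i (x j f)\<close> modulo \<open>F j\<close>, so \<open>x i b - x j b1\<close> is a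
      cycle modulo \<open>F j\<close>. Its place \<open>n\<close> satisfies
      \<open>n + j = k\<close>, the last case that \<open>exact_mod\<close> covers.\<close>
    have "d (x i b \<ominus> x j b1) = x i (d b) \<ominus> x j (d b1)"
      unfolding d_minus[OF x_closed[OF b(1)] x_closed[OF b1(1)]] x_d[OF b(1)] x_d[OF b1(1)] ..
    also have "\<dots> = x j (x i f \<ominus> d b1) \<ominus> x i (x j f \<ominus> d b)"
      unfolding x_minus[OF x_closed[OF f] d_closed[OF b(1)]] x_minus[OF x_closed[OF f] d_closed[OF b1(1)]]
        x_x[OF f, of i j]
      by (rule minus_diff_minus[OF C(1,3,2)])
    also have "\<dots> \<in> F j (Suc n)" by (rule F_minus[OF F_x[OF b1(2)] F_x[OF b(2)]])
    finally obtain e where e: "e \<in> B n" "x i b \<ominus> x j b1 \<ominus> e \<in> F j n"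
      using exact_mod[of n j, OF _ C_closed(4)[OF x_closed[OF b(1)] x_closed[OF b1(1)]]] Suc.prems(1)
      by auto
    have "x i b \<ominus> e = (x i b \<ominus> x j b1 \<ominus> e) \<oplus> x j b1"
      by (rule minus_diff_add[OF C_carrier[OF x_closed[OF b(1)]] C_carrier[OF B_C[OF e(1)]]
            C_carrier[OF x_closed[OF b1(1)]]])
    then have "x i b \<ominus> e \<in> F (Suc j) n" by (rule F_SucI[OF _ e(2) b1(1)])
    then show ?thesis using e(1) by blast
  qed
  then obtain e where e: "e \<in> B n" "b \<ominus> e \<in> F (Suc j) n"
    using Suc.IH[of "Suc j" b] b(1) Suc.prems(1) by auto
  obtain a' b' where ab: "b \<ominus> e = a' \<oplus> x j b'" "a' \<in> F j n" "b' \<in> C n" using e(2) by (rule F_SucE)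
  \<comment> \<open>Back to \<open>f\<close>: decomposing \<open>b - e\<close> gives
    \<open>d b = d a' + x j (d b')\<close>. Hence \<open>x j (f - d b')\<close> lies in
    \<open>F j\<close>, and \<open>x j\<close> cancels.\<close>
  have "d b \<ominus> \<zero> = d (b \<ominus> e)" unfolding d_minus[OF b(1) B_C[OF e(1)]] B_d[OF e(1)] ..
  also have "\<dots> = d a' \<oplus> x j (d b')"
    unfolding ab(1) d_add[OF F_C[OF ab(2)] x_closed[OF ab(3)]] x_d[OF ab(3)] ..
  finally have db: "d b = d a' \<oplus> x j (d b')" using C_carrier[OF d_closed[OF b(1)]] by (simp add: minus_eq a_inv_zero)
  note C = C_carrier[OF x_closed[OF f], of j] C_carrier[OF d_closed[OF F_C[OF ab(2)]]]
    C_carrier[OF x_closed[OF d_closed[OF ab(3)]], of j]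
  have "x j (f \<ominus> d b') = (x j f \<ominus> d b) \<oplus> d a'"
    unfolding x_minus[OF f d_closed[OF ab(3)]] db
    using minus_diff_add2[OF C(1,3,2)] .
  also have "\<dots> \<in> F j (Suc n)" by (rule F_add[OF b(2) F_d[OF ab(2)]])
  finally have "f \<ominus> d b' \<in> F j (Suc n)"
    using regular[OF _ C_closed(4)[OF f d_closed[OF ab(3)]]] Suc.prems(1) by simp
  moreover have "d b' \<in> B (Suc n)" using ab(3) by (simp add: B_Suc)
  ultimately show ?case by blast
qed

lemma torsion_free:
  assumes "f \<in> C (Suc k)" "\<And>i. i \<le> Suc k \<Longrightarrow> x i f \<in> d ` C k"
  shows "f \<in> d ` C k"
proof -
  have "\<exists>e\<in>B (Suc k). f \<ominus> e \<in> F 0 (Suc k)"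
  proof (rule torsion_mod)
    fix i assume "i \<le> Suc k"
    then have "x i f \<in> B (Suc k)" using assms(2) by (simp add: B_Suc)
    then show "\<exists>e\<in>B (Suc k). x i f \<ominus> e \<in> F 0 (Suc k)"
      using C_carrier[OF x_closed[OF assms(1)], of i] F_0
      by (intro bexI[of _ "x i f"]) (simp_all add: minus_eq r_neg)
  qed (use assms in simp_all)
  then obtain e where e: "e \<in> B (Suc k)" "f \<ominus> e = \<zero>" using F_0 by blast
  then have "f = e" using C_carrier[OF assms(1)] C_carrier[OF B_C[OF e(1)]] minus_cancel[of f e] by simp
  then show ?thesis using e(1) by (simp add: B_Suc)
qed

end

section \<open>Primes of the ring of invariants\<close>

lemma (in primeideal) finprod_mem_prime:
  assumes "finite A" "f \<in> A \<rightarrow> carrier R" "finprod R f A \<in> I"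
  shows "\<exists>a\<in>A. f a \<in> I"
  using assms
proof (induction A)
  case empty
  then show ?case using one_imp_carrier I_notcarr by auto
next
  case (insert a A)
  have "f a \<in> carrier R" "f \<in> A \<rightarrow> carrier R" using insert.prems by auto
  moreover have "f a \<otimes> finprod R f A \<in> I"
    using insert.prems(2) finprod_insert[OF insert.hyps calculation(2,1)] by simp
  ultimately have "f a \<in> I \<or> finprod R f A \<in> I" using I_prime finprod_closed by blast
  then show ?case using insert.IH[OF \<open>f \<in> A \<rightarrow> carrier R\<close>] by blast
qed

lemma (in cring) finprod_mem_ideal:
  assumes "ideal J R" "finite A" "f \<in> A \<rightarrow> carrier R" "a \<in> A" "f a \<in> J"
  shows "finprod R f A \<in> J"
proof -
  have A: "A = insert a (A - {a})" "finite (A - {a})" using assms by auto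
  have "finprod R f (insert a (A - {a})) = f a \<otimes> finprod R f (A - {a})"
    by (rule finprod_insert) (use A assms in auto)
  moreover have "finprod R f (A - {a}) \<in> carrier R"
    by (rule finprod_closed) (use assms in auto)
  ultimately show ?thesis using A(1) ideal.I_r_closed[OF assms(1,5)] by simp
qed

text \<open>Modulo \<open>s\<close> every factor is \<open>t\<close>. If \<open>s\<close> and
  \<open>t\<close> are invariant and \<open>y\<close> runs over the conjugates of \<open>r\<close>,
  the product is the norm of \<open>t - s r\<close>.\<close>

lemma (in cring) finprod_minus_mult:
  assumes "finite A" "t \<in> carrier R" "s \<in> carrier R" "y \<in> A \<rightarrow> carrier R"
  shows "\<exists>w\<in>carrier R. finprod R (\<lambda>a. t \<ominus> s \<otimes> y a) A = t [^] card A \<oplus> s \<otimes> w"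
  using assms(1,4)
proof (induction A)
  case empty
  then show ?case using assms by (intro bexI[of _ \<zero>]) auto
next
  case (insert a A)
  have y: "y a \<in> carrier R" "y \<in> A \<rightarrow> carrier R" using insert.prems by auto
  obtain w where w: "w \<in> carrier R" "finprod R (\<lambda>a. t \<ominus> s \<otimes> y a) A = t [^] card A \<oplus> s \<otimes> w"
    using insert.IH[OF y(2)] by blast
  have "finprod R (\<lambda>a. t \<ominus> s \<otimes> y a) (insert a A) = (t \<ominus> s \<otimes> y a) \<otimes> (t [^] card A \<oplus> s \<otimes> w)"
    unfolding w(2)[symmetric] by (rule finprod_insert) (use insert.hyps y assms in auto)
  also have "\<dots> = t [^] card A \<otimes> t \<oplus> s \<otimes> (t \<otimes> w \<ominus> y a \<otimes> t [^] card A \<ominus> y a \<otimes> s \<otimes> w)"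
    using nat_pow_closed[OF assms(2), of "card A"] w(1) y(1) assms(2,3) by algebra
  finally show ?case using insert.hyps w(1) y(1) assms(2,3)
    by (intro bexI[of _ "t \<otimes> w \<ominus> y a \<otimes> t [^] card A \<ominus> y a \<otimes> s \<otimes> w"]) simp_all
qed

section \<open>Norms, incomparability and lying over for a finite group action\<close>

locale ring_action = cring R + G: group G for R (structure) and G (structure) +
  fixes \<phi> :: "'c \<Rightarrow> 'a \<Rightarrow> 'a"
  assumes fin: "finite (carrier G)"
    and act_hom: "g \<in> carrier G \<Longrightarrow> \<phi> g \<in> ring_hom R R"
    and act_comp: "\<lbrakk>g \<in> carrier G; h \<in> carrier G; r \<in> carrier R\<rbrakk> \<Longrightarrow> \<phi> (g \<otimes>\<^bsub>G\<^esub> h) r = \<phi> g (\<phi> h r)"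
    and act_id: "r \<in> carrier R \<Longrightarrow> \<phi> \<one>\<^bsub>G\<^esub> r = r"
begin

abbreviation "inv_ring \<equiv> invariant_ring G R \<phi>"
abbreviation "Inv \<equiv> carrier inv_ring"

lemma act_ring_hom_cring: "g \<in> carrier G \<Longrightarrow> ring_hom_cring R R (\<phi> g)"
  by (intro ring_hom_cring.intro ring_hom_cring_axioms.intro is_cring act_hom)

lemma act_closed [simp]: "\<lbrakk>g \<in> carrier G; r \<in> carrier R\<rbrakk> \<Longrightarrow> \<phi> g r \<in> carrier R"
  using ring_hom_closed[OF act_hom] by blast

lemma act_add: "\<lbrakk>g \<in> carrier G; r \<in> carrier R; s \<in> carrier R\<rbrakk> \<Longrightarrow> \<phi> g (r \<oplus> s) = \<phi> g r \<oplus> \<phi> g s"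
  using ring_hom_add[OF act_hom] by blast

lemma act_mult: "\<lbrakk>g \<in> carrier G; r \<in> carrier R; s \<in> carrier R\<rbrakk> \<Longrightarrow> \<phi> g (r \<otimes> s) = \<phi> g r \<otimes> \<phi> g s"
  using ring_hom_mult[OF act_hom] by blast

lemma act_one: "g \<in> carrier G \<Longrightarrow> \<phi> g \<one> = \<one>"
  using ring_hom_one[OF act_hom] by blast

lemma act_zero: "g \<in> carrier G \<Longrightarrow> \<phi> g \<zero> = \<zero>"
  using ring_hom_cring.hom_zero[OF act_ring_hom_cring] by blast

lemma act_uminus: "\<lbrakk>g \<in> carrier G; r \<in> carrier R\<rbrakk> \<Longrightarrow> \<phi> g (\<ominus> r) = \<ominus> \<phi> g r"
  using ring_hom_cring.hom_a_inv[OF act_ring_hom_cring] by blast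

lemma act_minus:
  "\<lbrakk>g \<in> carrier G; r \<in> carrier R; s \<in> carrier R\<rbrakk> \<Longrightarrow> \<phi> g (r \<ominus> s) = \<phi> g r \<ominus> \<phi> g s"
  by (simp add: minus_eq act_add act_uminus)

lemma act_act_inv: "\<lbrakk>g \<in> carrier G; r \<in> carrier R\<rbrakk> \<Longrightarrow> \<phi> g (\<phi> (inv\<^bsub>G\<^esub> g) r) = r"
  using act_comp[of g "inv\<^bsub>G\<^esub> g" r] by (simp add: act_id)

lemma inv_ring_simps [simp]:
  "a \<otimes>\<^bsub>inv_ring\<^esub> b = a \<otimes> b" "a \<oplus>\<^bsub>inv_ring\<^esub> b = a \<oplus> b" "\<zero>\<^bsub>inv_ring\<^esub> = \<zero>" "\<one>\<^bsub>inv_ring\<^esub> = \<one>"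
  by (simp_all add: invariant_ring_def)

lemma mem_Inv_iff: "r \<in> Inv \<longleftrightarrow> r \<in> carrier R \<and> (\<forall>g\<in>carrier G. \<phi> g r = r)"
  by (simp add: invariant_ring_def)

lemma Inv_carrier: "r \<in> Inv \<Longrightarrow> r \<in> carrier R"
  by (simp add: mem_Inv_iff)

lemma Inv_closed:
  "\<zero> \<in> Inv" "\<one> \<in> Inv" "\<lbrakk>r \<in> Inv; s \<in> Inv\<rbrakk> \<Longrightarrow> r \<oplus> s \<in> Inv" "\<lbrakk>r \<in> Inv; s \<in> Inv\<rbrakk> \<Longrightarrow> r \<otimes> s \<in> Inv"
  "\<lbrakk>r \<in> Inv; s \<in> Inv\<rbrakk> \<Longrightarrow> r \<ominus> s \<in> Inv"
  by (auto simp: mem_Inv_iff act_zero act_one act_add act_mult act_minus)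

definition norm :: "'a \<Rightarrow> 'a" where
  "norm r = finprod R (\<lambda>g. \<phi> g r) (carrier G)"

lemma norm_Inv:
  assumes "r \<in> carrier R"
  shows "norm r \<in> Inv"
proof -
  have "\<phi> h (norm r) = norm r" if h: "h \<in> carrier G" for h
  proof -
    have "\<phi> h (norm r) = finprod R (\<lambda>g. \<phi> (h \<otimes>\<^bsub>G\<^esub> g) r) (carrier G)"
      unfolding norm_def using assms h act_comp
      by (subst ring_hom_cring.hom_finprod[OF act_ring_hom_cring[OF h]])
        (auto intro!: finprod_cong')
    also have "\<dots> = finprod R (\<lambda>g. \<phi> g r) ((\<lambda>g. h \<otimes>\<^bsub>G\<^esub> g) ` carrier G)"
      using assms h G.inj_on_multc by (subst finprod_reindex) (auto intro: inj_onI)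
    also have "(\<lambda>g. h \<otimes>\<^bsub>G\<^esub> g) ` carrier G = carrier G" using G.surj_const_mult h by blast
    finally show ?thesis by (simp add: norm_def)
  qed
  moreover have "norm r \<in> carrier R" unfolding norm_def using assms by (intro finprod_closed) auto
  ultimately show ?thesis by (simp add: mem_Inv_iff)
qed

lemma norm_mult: "\<lbrakk>r \<in> carrier R; s \<in> carrier R\<rbrakk> \<Longrightarrow> norm (r \<otimes> s) = norm r \<otimes> norm s"
  unfolding norm_def using finprod_multf[of "\<lambda>g. \<phi> g r" "carrier G" "\<lambda>g. \<phi> g s"]
  by (simp add: act_mult Pi_def cong: finprod_cong)

lemma norm_of_Inv: "r \<in> Inv \<Longrightarrow> norm r = r [^] card (carrier G)"
  unfolding norm_def by (subst finprod_const[symmetric]) (auto simp: mem_Inv_iff intro!: finprod_cong')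

lemma norm_mem_ideal:
  assumes "ideal J R" "r \<in> J"
  shows "norm r \<in> J"
proof -
  have "r \<in> carrier R" using assms ideal.Icarr by metis
  then show ?thesis unfolding norm_def
    using finprod_mem_ideal[OF assms(1) fin, of "\<lambda>g. \<phi> g r" "\<one>\<^bsub>G\<^esub>"] assms(2) by (auto simp: act_id)
qed

lemma act_preimage_prime:
  assumes "primeideal P R" "g \<in> carrier G"
  shows "primeideal {r \<in> carrier R. \<phi> g r \<in> P} R"
proof -
  interpret P: primeideal P R by fact
  show ?thesis
  proof (rule primeidealI[OF idealI_cring is_cring])
    show "{r \<in> carrier R. \<phi> g r \<in> P} \<noteq> {}" using act_zero[OF assms(2)] by (auto intro!: exI[of _ \<zero>])
    have "\<one> \<notin> P" using P.one_imp_carrier P.I_notcarr by auto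
    then show "carrier R \<noteq> {r \<in> carrier R. \<phi> g r \<in> P}"
      using act_one[OF assms(2)] by (metis (no_types, lifting) mem_Collect_eq one_closed)
  next
    fix a b assume "a \<in> carrier R" "b \<in> carrier R" "a \<otimes> b \<in> {r \<in> carrier R. \<phi> g r \<in> P}"
    then show "a \<in> {r \<in> carrier R. \<phi> g r \<in> P} \<or> b \<in> {r \<in> carrier R. \<phi> g r \<in> P}"
      using P.I_prime[of "\<phi> g a" "\<phi> g b"] assms(2) by (auto simp: act_mult)
  qed (use assms(2) P.a_closed P.I_l_closed in \<open>auto simp: act_add act_mult\<close>)
qed

lemma act_pow_mem:
  assumes "g \<in> carrier G" "P \<subseteq> carrier R" "\<And>r. r \<in> P \<Longrightarrow> \<phi> g r \<in> P" "r \<in> P"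
  shows "\<phi> (g [^]\<^bsub>G\<^esub> (n::nat)) r \<in> P"
  using assms(4)
proof (induction n arbitrary: r)
  case 0
  then show ?case using assms(2) act_id by auto
next
  case (Suc n)
  have "\<phi> (g [^]\<^bsub>G\<^esub> Suc n) r = \<phi> (g [^]\<^bsub>G\<^esub> n) (\<phi> g r)"
    using act_comp[of "g [^]\<^bsub>G\<^esub> n" g r] Suc.prems assms(1,2) by auto
  then show ?case using Suc.IH[OF assms(3)[OF Suc.prems]] by simp
qed

text \<open>If \<open>Q\<close> were contained in no preimage of \<open>P\<close> under the group,
  prime avoidance would give an \<open>x\<close> in \<open>Q\<close> without conjugates in
  \<open>P\<close>; but its norm lies in \<open>Q\<close> and is invariant, hence lies in
  \<open>P\<close>. So some \<open>g\<close> maps \<open>Q\<close> into \<open>P\<close>, and since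
  \<open>P\<close> is inside \<open>Q\<close>, the powers of \<open>g\<close> do the same; one of
  them is the identity.\<close>

lemma incomparable:
  assumes P: "primeideal P R" and Q: "primeideal Q R" and "P \<subseteq> Q" "Q \<inter> Inv \<subseteq> P"
  shows "P = Q"
proof -
  interpret P: primeideal P R by fact
  interpret Q: primeideal Q R by fact
  have "\<exists>g\<in>carrier G. Q \<subseteq> {r \<in> carrier R. \<phi> g r \<in> P}"
  proof (rule ccontr)
    assume "\<not> ?thesis"
    then have "\<exists>x\<in>Q. \<forall>P'\<in>(\<lambda>g. {r \<in> carrier R. \<phi> g r \<in> P}) ` carrier G. x \<notin> P'"
      using fin act_preimage_prime[OF P] by (intro prime_avoidance) (auto simp: Q.is_ideal)
    then obtain x where x': "x \<in> Q" "\<forall>P'\<in>(\<lambda>g. {r \<in> carrier R. \<phi> g r \<in> P}) ` carrier G. x \<notin> P'"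
      by (rule bexE)
    have x: "x \<in> Q" "\<And>g. g \<in> carrier G \<Longrightarrow> \<phi> g x \<notin> P"
      using x'(1) x'(2) Q.Icarr[OF x'(1)] by simp_all
    have "norm x \<in> P"
      using norm_mem_ideal[OF Q.is_ideal x(1)] norm_Inv[OF Q.Icarr[OF x(1)]] assms(4) by blast
    then show False
      using P.finprod_mem_prime[OF fin, of "\<lambda>g. \<phi> g x"] x Q.Icarr[OF x(1)] by (auto simp: norm_def)
  qed
  then obtain g where g: "g \<in> carrier G" "\<And>r. r \<in> Q \<Longrightarrow> \<phi> g r \<in> P" by blast
  have "r \<in> P" if r: "r \<in> Q" for r
  proof -
    have "order G > 0" using fin G.order_gt_0_iff_finite by blast
    then obtain n where n: "order G = Suc n" using gr0_implies_Suc by blast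
    have "\<phi> (g [^]\<^bsub>G\<^esub> n) (\<phi> g r) \<in> P"
    proof (rule act_pow_mem[OF g(1)])
      show "P \<subseteq> carrier R" using P.Icarr by blast
      show "\<phi> g r \<in> P" if "r \<in> P" for r using g(2) assms(3) that by blast
    qed (rule g(2)[OF r])
    moreover have "\<phi> (g [^]\<^bsub>G\<^esub> n) (\<phi> g r) = \<phi> (g [^]\<^bsub>G\<^esub> Suc n) r"
      using act_comp[of "g [^]\<^bsub>G\<^esub> n" g r] g(1) Q.Icarr[OF r] by simp
    moreover have "g [^]\<^bsub>G\<^esub> Suc n = \<one>\<^bsub>G\<^esub>" using G.pow_order_eq_1[OF g(1)] n by simp
    ultimately show ?thesis using act_id Q.Icarr[OF r] by simp
  qed
  then show ?thesis using assms(3) by blast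
qed

lemma contract_ideal:
  assumes S: "cring inv_ring" and J: "ideal J R"
  shows "ideal (J \<inter> Inv) inv_ring"
proof -
  interpret S: cring inv_ring by (rule S)
  interpret J: ideal J R by (rule J)
  show ?thesis
  proof (rule S.idealI_cring)
    show "J \<inter> Inv \<noteq> {}" using J.zero_closed Inv_closed(1) by blast
  qed (use J.a_closed J.I_l_closed Inv_closed Inv_carrier in auto)
qed

lemma contract_prime:
  assumes S: "cring inv_ring" and P: "primeideal P R"
  shows "primeideal (P \<inter> Inv) inv_ring"
proof -
  interpret P: primeideal P R by (rule P)
  show ?thesis
  proof (rule primeidealI[OF contract_ideal[OF S P.is_ideal] S])
    show "Inv \<noteq> P \<inter> Inv" using P.one_imp_carrier P.I_notcarr Inv_closed(2) by blast
  qed (use P.I_prime Inv_carrier in auto)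
qed

text \<open>Incomparability keeps a strict chain of primes strict after contraction.\<close>

lemma prime_height_le_contract:
  assumes S: "cring inv_ring" and P: "primeideal P R"
  shows "prime_height R P \<le> prime_height inv_ring (P \<inter> Inv)"
  unfolding prime_height_def[of R]
proof (rule Sup_least)
  fix h assume "h \<in> {enat n | n. \<exists>p. (\<forall>i\<le>n. primeideal (p i) R) \<and> (\<forall>i<n. p i \<subset> p (Suc i)) \<and> p n = P}"
  then obtain n p where p: "h = enat n" "\<And>i. i \<le> n \<Longrightarrow> primeideal (p i) R"
    "\<And>i. i < n \<Longrightarrow> p i \<subset> p (Suc i)" "p n = P" by blast
  define q where "q i = p i \<inter> Inv" for i
  have "primeideal (q i) inv_ring" if "i \<le> n" for i
    unfolding q_def by (rule contract_prime[OF S p(2)[OF that]])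
  moreover have "q i \<subset> q (Suc i)" if i: "i < n" for i
  proof -
    have "\<not> p (Suc i) \<inter> Inv \<subseteq> p i"
      using incomparable[OF p(2)[of i] p(2)[of "Suc i"]] p(3)[OF i] i by auto
    then show ?thesis using p(3)[OF i] unfolding q_def by blast
  qed
  moreover have "q n = P \<inter> Inv" by (simp add: q_def p(4))
  ultimately show "h \<le> prime_height inv_ring (P \<inter> Inv)"
    unfolding prime_height_def p(1) by (intro Sup_upper) blast
qed

text \<open>Take \<open>J\<close> maximal among the ideals with \<open>J \<inter> Inv \<subseteq> p\<close>. If some \<open>s \<in> p\<close> were outside \<open>J\<close>, there would
  be an invariant \<open>t \<notin> p\<close> with \<open>t - s r \<in> J\<close>; but the norm of \<open>t - s r\<close> is a power of \<open>t\<close> modulo \<open>s\<close>.\<close>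

lemma lying_over:
  assumes N: "noetherian_ring R" and S: "cring inv_ring" and p: "primeideal p inv_ring"
  shows "\<exists>P. primeideal P R \<and> P \<inter> Inv = p"
proof -
  interpret noetherian_ring R by (rule N)
  interpret p: primeideal p inv_ring by (rule p)
  have pI: "p \<subseteq> Inv" using p.Icarr by blast
  have p1: "\<one> \<notin> p" using p.one_imp_carrier p.I_notcarr by auto
  have "\<exists>M\<in>{J. ideal J R \<and> J \<inter> Inv \<subseteq> p}. \<forall>J\<in>{J. ideal J R \<and> J \<inter> Inv \<subseteq> p}. M \<subseteq> J \<longrightarrow> J = M"
  proof (rule maximal_ideal_exists)
    have "{\<zero>} \<inter> Inv \<subseteq> p" using cring.ideal_zero_closed[OF S p.is_ideal] by simp
    then show "{J. ideal J R \<and> J \<inter> Inv \<subseteq> p} \<noteq> {}" using zeroideal by blast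
  qed simp
  then obtain J where J': "J \<in> {J. ideal J R \<and> J \<inter> Inv \<subseteq> p}"
    "\<forall>I\<in>{J. ideal J R \<and> J \<inter> Inv \<subseteq> p}. J \<subseteq> I \<longrightarrow> I = J" by (rule bexE)
  then have J: "ideal J R" "J \<inter> Inv \<subseteq> p" by simp_all
  have max: "I = J" if "ideal I R" "I \<inter> Inv \<subseteq> p" "J \<subseteq> I" for I
    using J'(2) that by simp
  interpret J: ideal J R by (rule J(1))
  \<comment> \<open>By maximality of \<open>J\<close>, adjoining any element outside it must bring
    in an invariant outside \<open>p\<close>.\<close>
  have grow: "\<exists>t\<in>Inv. t \<notin> p \<and> (\<exists>j\<in>J. \<exists>r\<in>carrier R. t = j \<oplus> a \<otimes> r)"
    if a: "a \<in> carrier R" "a \<notin> J" for a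
  proof -
    have "\<not> ideal_adjoin R J a \<inter> Inv \<subseteq> p"
      using max[OF ideal_adjoin_ideal[OF J(1) a(1)] _ subset_ideal_adjoin[OF J(1) a(1)]]
        mem_ideal_adjoin[OF J(1) a(1)] a(2) by blast
    then obtain t where t: "t \<in> ideal_adjoin R J a" "t \<in> Inv" "t \<notin> p" by blast
    then show ?thesis using ideal_adjoinE[OF t(1)] by metis
  qed
  have prime: "primeideal J R"
  proof (rule primeidealI[OF J(1) is_cring])
    show "carrier R \<noteq> J" using J(2) p1 Inv_closed(2) by blast
    fix a b assume ab: "a \<in> carrier R" "b \<in> carrier R" "a \<otimes> b \<in> J"
    show "a \<in> J \<or> b \<in> J"
    proof (rule ccontr)
      assume "\<not> ?thesis"
      then obtain t j r t' j' r' where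
        t: "t \<in> Inv" "t \<notin> p" "j \<in> J" "r \<in> carrier R" "t = j \<oplus> a \<otimes> r" and
        t': "t' \<in> Inv" "t' \<notin> p" "j' \<in> J" "r' \<in> carrier R" "t' = j' \<oplus> b \<otimes> r'"
        using grow[OF ab(1)] grow[OF ab(2)] by blast
      note jc = J.Icarr[OF t(3)] J.Icarr[OF t'(3)]
      have "t \<otimes> t' = j \<otimes> (j' \<oplus> b \<otimes> r') \<oplus> (j' \<otimes> (a \<otimes> r) \<oplus> (a \<otimes> b) \<otimes> (r \<otimes> r'))"
        unfolding t(5) t'(5) using ab(1,2) t(4) t'(4) jc by algebra
      also have "\<dots> \<in> J"
        by (intro J.a_closed J.I_r_closed t t' ab) (use ab t t' jc in simp_all)
      finally have "t \<otimes> t' \<in> p" using J(2) Inv_closed(4)[OF t(1) t'(1)] by blast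
      then show False using p.I_prime[OF t(1) t'(1)] t(2) t'(2) by simp
    qed
  qed
  have pow_mem: "a \<in> p" if "a \<in> Inv" "a [^] (n::nat) \<in> p" for a n
    using that(2)
  proof (induction n)
    case 0
    then show ?case using p1 by simp
  next
    case (Suc n)
    have "a [^] n \<in> Inv" by (induction n) (use Inv_closed that(1) in auto)
    then show ?case using p.I_prime[of "a [^] n" a] that(1) Suc by auto
  qed
  have "s \<in> J" if s: "s \<in> p" for s
  proof (rule ccontr)
    assume sJ: "s \<notin> J"
    have sI: "s \<in> Inv" using s pI by blast
    have sc: "s \<in> carrier R" by (rule Inv_carrier[OF sI])
    obtain t j r where t: "t \<in> Inv" "t \<notin> p" "j \<in> J" "r \<in> carrier R" "t = j \<oplus> s \<otimes> r"
      using grow[OF sc sJ] by blast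
    note jc = J.Icarr[OF t(3)]
    have tc: "t \<in> carrier R" by (rule Inv_carrier[OF t(1)])
    define n where "n = card (carrier G)"
    have j: "j = t \<ominus> s \<otimes> r" unfolding t(5) using jc sc t(4) by algebra
    have "norm j = finprod R (\<lambda>g. t \<ominus> s \<otimes> \<phi> g r) (carrier G)"
      unfolding norm_def j using sI t(1,4) sc tc
      by (intro finprod_cong') (auto simp: act_minus act_mult mem_Inv_iff)
    then obtain w where w: "w \<in> carrier R" "norm j = t [^] n \<oplus> s \<otimes> w"
      using finprod_minus_mult[OF fin tc sc, of "\<lambda>g. \<phi> g r"] t(4) unfolding n_def by auto
    have nj: "norm j \<in> p" using norm_mem_ideal[OF J(1) t(3)] norm_Inv[OF jc] J(2) by blast
    have tn: "t [^] n \<in> Inv" by (induction n) (use Inv_closed t(1) in auto)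
    have tnc: "t [^] n \<in> carrier R" by (rule Inv_carrier[OF tn])
    have "s \<otimes> w = norm j \<ominus> t [^] n" unfolding w(2) using tnc w(1) sc by algebra
    then have sw: "s \<otimes> w \<in> Inv" using Inv_closed(5) nj pI tn by auto
    \<comment> \<open>Only the product \<open>s w\<close> is known to be invariant, so its
      membership in \<open>p\<close> is read off from its norm: this is its \<open>n\<close>-th
      power and also a multiple of \<open>norm s\<close>, which is the \<open>n\<close>-th power of
      \<open>s\<close>.\<close>
    have "(s \<otimes> w) [^] n = norm s \<otimes> norm w"
      using norm_of_Inv[OF sw] norm_mult[OF sc w(1)] by (simp add: n_def)
    also have "norm s \<in> p"
    proof -
      have "n > 0" using fin unfolding n_def by (auto simp: card_gt_0_iff)
      then obtain m where "n = Suc m" using gr0_implies_Suc by blast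
      then have "norm s = s [^] m \<otimes> s" using norm_of_Inv[OF sI] by (simp add: n_def)
      moreover have "s [^] m \<in> Inv" by (induction m) (use Inv_closed sI in auto)
      ultimately show ?thesis using p.I_l_closed[OF s, of "s [^] m"] by simp
    qed
    then have "norm s \<otimes> norm w \<in> p" using p.I_r_closed norm_Inv[OF w(1)] by fastforce
    finally have "s \<otimes> w \<in> p" by (rule pow_mem[OF sw])
    then have "t [^] n \<in> p"
      using cring.ideal_add_cancel[OF S p.is_ideal, of "t [^] n" "s \<otimes> w"] tn nj w(2) by simp
    then show False using pow_mem[OF t(1)] t(2) by blast
  qed
  then have "J \<inter> Inv = p" using J(2) pI by blast
  then show ?thesis using prime by blast
qed

end

section \<open>The transfer outside a prime ideal\<close>

context cring
begin

fun poly_value :: "'a list \<Rightarrow> 'a \<Rightarrow> 'a" where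
  "poly_value [] a = \<zero>"
| "poly_value (c # cs) a = c \<oplus> a \<otimes> poly_value cs a"

text \<open>\<open>mult_linear z c cs\<close> is the coefficient list of \<open>c + (X + z) p\<close>, where \<open>cs\<close> is that of
  \<open>p\<close>.\<close>

fun mult_linear :: "'a \<Rightarrow> 'a \<Rightarrow> 'a list \<Rightarrow> 'a list" where
  "mult_linear z c [] = [c]"
| "mult_linear z c (d # cs) = (c \<oplus> z \<otimes> d) # mult_linear z d cs"

text \<open>The coefficients, constant term first, of the product of all \<open>X + z\<close>. On
  lists an automorphism of the ring acts by \<open>map\<close>.\<close>

definition linear_prod :: "'a list \<Rightarrow> 'a list" where
  "linear_prod zs = foldr (\<lambda>z. mult_linear z \<zero>) zs [\<one>]"

lemma poly_value_closed: "\<lbrakk>set cs \<subseteq> carrier R; a \<in> carrier R\<rbrakk> \<Longrightarrow> poly_value cs a \<in> carrier R"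
  by (induction cs) auto

lemma mult_linear_closed:
  "\<lbrakk>z \<in> carrier R; c \<in> carrier R; set cs \<subseteq> carrier R\<rbrakk> \<Longrightarrow> set (mult_linear z c cs) \<subseteq> carrier R"
  by (induction cs arbitrary: c) auto

lemma linear_prod_simps:
  "linear_prod [] = [\<one>]" "linear_prod (z # zs) = mult_linear z \<zero> (linear_prod zs)"
  by (simp_all add: linear_prod_def)

lemma linear_prod_closed: "set zs \<subseteq> carrier R \<Longrightarrow> set (linear_prod zs) \<subseteq> carrier R"
  by (induction zs) (simp_all add: linear_prod_simps mult_linear_closed)

lemma poly_value_mult_linear:
  "\<lbrakk>z \<in> carrier R; c \<in> carrier R; set cs \<subseteq> carrier R; a \<in> carrier R\<rbrakk> \<Longrightarrow>
     poly_value (mult_linear z c cs) a = c \<oplus> (a \<oplus> z) \<otimes> poly_value cs a"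
proof (induction cs arbitrary: c)
  case (Cons d cs)
  have "d \<in> carrier R" "set cs \<subseteq> carrier R" using Cons.prems by auto
  then have "poly_value (mult_linear z c (d # cs)) a =
      (c \<oplus> z \<otimes> d) \<oplus> a \<otimes> (d \<oplus> (a \<oplus> z) \<otimes> poly_value cs a)"
    using Cons.IH[of d] Cons.prems by simp
  also have "\<dots> = c \<oplus> (a \<oplus> z) \<otimes> (d \<oplus> a \<otimes> poly_value cs a)"
    using Cons.prems(1,2,4) \<open>d \<in> carrier R\<close> poly_value_closed[OF \<open>set cs \<subseteq> carrier R\<close> Cons.prems(4)]
    by algebra
  finally show ?case by simp
qed simp

text \<open>The polynomials \<open>c + (X + z) (d + (X + w) p)\<close> and
  \<open>c' + (X + w) (d + (X + z) p)\<close> agree exactly if \<open>c + z d = c' + w d\<close>.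
  The carried coefficients have to be general because the recursion of \<open>mult_linear\<close>
  replaces them.\<close>

lemma mult_linear_commute:
  "\<lbrakk>z \<in> carrier R; w \<in> carrier R; c \<in> carrier R; c' \<in> carrier R; d \<in> carrier R;
    set cs \<subseteq> carrier R; c \<oplus> z \<otimes> d = c' \<oplus> w \<otimes> d\<rbrakk> \<Longrightarrow>
     mult_linear z c (mult_linear w d cs) = mult_linear w c' (mult_linear z d cs)"
proof (induction cs arbitrary: c c' d)
  case (Cons e cs)
  have e: "e \<in> carrier R" "set cs \<subseteq> carrier R" using Cons.prems by auto
  have "c \<oplus> z \<otimes> (d \<oplus> w \<otimes> e) = (c \<oplus> z \<otimes> d) \<oplus> z \<otimes> w \<otimes> e"
    using Cons.prems(1-5) e(1) by algebra
  also have "\<dots> = c' \<oplus> w \<otimes> (d \<oplus> z \<otimes> e)"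
    unfolding Cons.prems(7) using Cons.prems(1-5) e(1) by algebra
  finally have "c \<oplus> z \<otimes> (d \<oplus> w \<otimes> e) = c' \<oplus> w \<otimes> (d \<oplus> z \<otimes> e)" .
  moreover have "(d \<oplus> w \<otimes> e) \<oplus> z \<otimes> e = (d \<oplus> z \<otimes> e) \<oplus> w \<otimes> e"
    using Cons.prems(1-5) e(1) by algebra
  ultimately show ?case using Cons.IH[of "d \<oplus> w \<otimes> e" "d \<oplus> z \<otimes> e" e] Cons.prems e by simp
qed simp

lemma linear_prod_append_Cons:
  "\<lbrakk>set as \<subseteq> carrier R; z \<in> carrier R; set bs \<subseteq> carrier R\<rbrakk> \<Longrightarrow>
     linear_prod (as @ z # bs) = linear_prod (z # as @ bs)"
proof (induction as)
  case (Cons a as)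
  then show ?case
    using mult_linear_commute[of a z \<zero> \<zero> \<zero> "linear_prod (as @ bs)"] linear_prod_closed[of "as @ bs"]
    by (simp add: linear_prod_simps)
qed simp

text \<open>Symmetry in the roots: it shows that a group element permuting the entries of
  \<open>zs\<close> fixes every coefficient.\<close>

lemma linear_prod_mset:
  "\<lbrakk>mset zs = mset ws; set zs \<subseteq> carrier R\<rbrakk> \<Longrightarrow> linear_prod zs = linear_prod ws"
proof (induction zs arbitrary: ws)
  case (Cons z zs)
  have "z \<in> set ws" using Cons.prems(1) by (metis list.set_intros(1) mset_eq_setD)
  then obtain as bs where ws: "ws = as @ z # bs" by (meson split_list)
  have "set ws \<subseteq> carrier R" using Cons.prems mset_eq_setD by metis
  then show ?case
    using Cons.IH[of "as @ bs"] Cons.prems linear_prod_append_Cons[of as z bs]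
    by (simp add: ws linear_prod_simps)
qed simp

lemma poly_value_linear_prod_root:
  "\<lbrakk>set zs \<subseteq> carrier R; a \<in> carrier R; \<ominus> a \<in> set zs\<rbrakk> \<Longrightarrow> poly_value (linear_prod zs) a = \<zero>"
proof (induction zs)
  case (Cons z zs)
  have z: "z \<in> carrier R" "set zs \<subseteq> carrier R" using Cons.prems by auto
  have v: "poly_value (linear_prod (z # zs)) a = (a \<oplus> z) \<otimes> poly_value (linear_prod zs) a"
    using poly_value_mult_linear[OF z(1) zero_closed linear_prod_closed[OF z(2)] Cons.prems(2)]
      poly_value_closed[OF linear_prod_closed[OF z(2)] Cons.prems(2)] z(1) Cons.prems(2)
    by (simp add: linear_prod_simps)
  show ?case
  proof (cases "z = \<ominus> a")
    case True
    then show ?thesis using v poly_value_closed[OF linear_prod_closed[OF z(2)] Cons.prems(2)] Cons.prems(2)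
      by (simp add: r_neg)
  next
    case False
    then show ?thesis using v Cons.IH[OF z(2) Cons.prems(2)] Cons.prems(2,3) z(1) by simp
  qed
qed simp

end

lemma (in primeideal) poly_value_linear_prod_mem:
  "\<lbrakk>set zs \<subseteq> carrier R; a \<in> carrier R; poly_value (linear_prod zs) a \<in> I\<rbrakk> \<Longrightarrow> \<exists>z\<in>set zs. a \<oplus> z \<in> I"
proof (induction zs)
  case Nil
  then show ?case using one_imp_carrier I_notcarr by (auto simp: linear_prod_simps)
next
  case (Cons z zs)
  have z: "z \<in> carrier R" "set zs \<subseteq> carrier R" using Cons.prems by auto
  have v: "poly_value (linear_prod (z # zs)) a = (a \<oplus> z) \<otimes> poly_value (linear_prod zs) a"
    using poly_value_mult_linear[OF z(1) zero_closed linear_prod_closed[OF z(2)] Cons.prems(2)]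
      poly_value_closed[OF linear_prod_closed[OF z(2)] Cons.prems(2)] z(1) Cons.prems(2)
    by (simp add: linear_prod_simps)
  have "a \<oplus> z \<in> I \<or> poly_value (linear_prod zs) a \<in> I"
    by (rule I_prime) (use v Cons.prems z poly_value_closed linear_prod_closed in auto)
  then show ?case using Cons.IH[OF z(2) Cons.prems(2)] by auto
qed

section \<open>Independence of characters modulo a prime\<close>

context primeideal
begin

text \<open>The argument of Dedekind's independence of characters; the \<open>\<chi> t\<close> may coincide, only the identity
  has to differ from them modulo \<open>I\<close>.\<close>

lemma characters_independent:
  assumes "finite T" and M: "M \<subseteq> carrier R" "\<one> \<in> M" "\<And>x y. x \<in> M \<Longrightarrow> y \<in> M \<Longrightarrow> x \<otimes> y \<in> M"
    and "\<And>t x. t \<in> T \<Longrightarrow> x \<in> M \<Longrightarrow> \<chi> t x \<in> carrier R"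
    and "\<And>t x y. t \<in> T \<Longrightarrow> x \<in> M \<Longrightarrow> y \<in> M \<Longrightarrow> \<chi> t (x \<otimes> y) = \<chi> t x \<otimes> \<chi> t y"
    and "\<And>t. t \<in> T \<Longrightarrow> \<exists>y\<in>M. \<chi> t y \<ominus> y \<notin> I"
    and "b \<in> carrier R" "b \<notin> I" "\<And>t. t \<in> T \<Longrightarrow> c t \<in> carrier R"
  shows "\<exists>x\<in>M. b \<otimes> x \<oplus> (\<Oplus>t\<in>T. c t \<otimes> \<chi> t x) \<notin> I"
  using assms(1,5-)
proof (induction T arbitrary: b c)
  case empty
  then show ?case using M(2) by (intro bexI[of _ \<one>]) auto
next
  case (insert s T)
  obtain y where y: "y \<in> M" "\<chi> s y \<ominus> y \<notin> I" using insert.prems(3)[of s] by blast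
  define e where "e = \<chi> s y"
  have yc: "y \<in> carrier R" "e \<in> carrier R" using y(1) M(1) insert.prems(1)[of s] by (auto simp: e_def)
  have cl: "\<chi> t x \<in> carrier R" "c t \<in> carrier R" if "t \<in> T" "x \<in> M" for t x
    using insert.prems(1)[of t] insert.prems(6)[of t] that by auto
  have cs: "c s \<in> carrier R" using insert.prems(6) by simp
  \<comment> \<open>Elimination of \<open>\<chi> s\<close>: for the \<open>f\<close> defined below,
    \<open>f (x y) - e f x\<close> has no term at \<open>s\<close>, and its other terms have the
    coefficients \<open>c' t\<close>. The coefficient of the identity becomes
    \<open>b (y - e)\<close>, still outside \<open>I\<close> by the choice of
    \<open>y\<close>.\<close>
  define b' c' where "b' = b \<otimes> (y \<ominus> e)" and "c' t = c t \<otimes> (\<chi> t y \<ominus> e)" for t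
  have b': "b' \<in> carrier R" "b' \<notin> I"
  proof -
    have "y \<ominus> e \<notin> I"
    proof
      assume "y \<ominus> e \<in> I"
      then have "\<ominus> (y \<ominus> e) \<in> I" by simp
      moreover have "\<ominus> (y \<ominus> e) = e \<ominus> y" using yc by (simp add: minus_eq minus_add a_comm)
      ultimately show False using y(2) by (simp add: e_def)
    qed
    then show "b' \<notin> I" using I_prime[OF insert.prems(4), of "y \<ominus> e"] insert.prems(5) yc by (auto simp: b'_def)
    show "b' \<in> carrier R" using yc insert.prems(4) by (simp add: b'_def)
  qed
  have c': "c' t \<in> carrier R" if "t \<in> T" for t
    using cl[OF that y(1)] yc by (simp add: c'_def)
  have "\<exists>x\<in>M. b' \<otimes> x \<oplus> (\<Oplus>t\<in>T. c' t \<otimes> \<chi> t x) \<notin> I"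
    by (rule insert.IH) (use insert.prems b' c' in auto)
  then obtain x where x: "x \<in> M" "b' \<otimes> x \<oplus> (\<Oplus>t\<in>T. c' t \<otimes> \<chi> t x) \<notin> I" by blast
  have xc: "x \<in> carrier R" using x(1) M(1) by blast
  define f where "f z = b \<otimes> z \<oplus> (\<Oplus>t\<in>insert s T. c t \<otimes> \<chi> t z)" for z
  have f: "f z = b \<otimes> z \<oplus> (c s \<otimes> \<chi> s z \<oplus> (\<Oplus>t\<in>T. c t \<otimes> \<chi> t z))" if "z \<in> M" for z
    unfolding f_def using cl[OF _ that] cs insert.prems(1)[of s z] that insert.hyps
    by (subst finsum_insert) auto
  have xy: "x \<otimes> y \<in> M" by (rule M(3)[OF x(1) y(1)])
  define A B D where "A = (\<Oplus>t\<in>T. c t \<otimes> \<chi> t (x \<otimes> y))" and "B = (\<Oplus>t\<in>T. c t \<otimes> \<chi> t x)"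
    and "D = (\<Oplus>t\<in>T. c' t \<otimes> \<chi> t x)"
  have AB: "A \<in> carrier R" "B \<in> carrier R" "D \<in> carrier R"
    unfolding A_def B_def D_def using cl x(1) xy c' by (auto intro!: finsum_closed)
  have "D \<oplus> e \<otimes> B = (\<Oplus>t\<in>T. c' t \<otimes> \<chi> t x \<oplus> e \<otimes> (c t \<otimes> \<chi> t x))"
    unfolding D_def B_def using cl x(1) c' yc insert.hyps(1)
    by (subst finsum_rdistr) (auto simp: finsum_addf)
  also have "\<dots> = A"
    unfolding A_def
  proof (rule finsum_cong')
    fix t assume t: "t \<in> T"
    have "\<chi> t (x \<otimes> y) = \<chi> t x \<otimes> \<chi> t y" using insert.prems(2)[of t] t x(1) y(1) by blast
    moreover note * = cl[OF t x(1)] cl[OF t y(1)] yc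
    have "c t \<otimes> (\<chi> t y \<ominus> e) \<otimes> \<chi> t x \<oplus> e \<otimes> (c t \<otimes> \<chi> t x) = c t \<otimes> (\<chi> t x \<otimes> \<chi> t y)"
      using * by algebra
    ultimately show "c' t \<otimes> \<chi> t x \<oplus> e \<otimes> (c t \<otimes> \<chi> t x) = c t \<otimes> \<chi> t (x \<otimes> y)"
      by (simp add: c'_def)
  qed (use cl xy in auto)
  finally have A: "A = D \<oplus> e \<otimes> B" by simp
  have sx: "\<chi> s x \<in> carrier R" "\<chi> s (x \<otimes> y) = \<chi> s x \<otimes> e"
    using insert.prems(1,2)[of s] x(1) y(1) by (auto simp: e_def)
  have "b' \<otimes> x \<oplus> D = (b \<otimes> (x \<otimes> y) \<oplus> (c s \<otimes> (\<chi> s x \<otimes> e) \<oplus> (D \<oplus> e \<otimes> B))) \<ominus>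
      e \<otimes> (b \<otimes> x \<oplus> (c s \<otimes> \<chi> s x \<oplus> B))"
    unfolding b'_def using AB(2,3) sx(1) xc yc cs insert.prems(4) by algebra
  also have "\<dots> = f (x \<otimes> y) \<ominus> e \<otimes> f x"
    using f[OF xy] f[OF x(1)] A sx(2) by (simp add: A_def B_def)
  finally have "f (x \<otimes> y) \<ominus> e \<otimes> f x \<notin> I" using x(2) by (simp add: D_def)
  then have "f (x \<otimes> y) \<notin> I \<or> f x \<notin> I"
    using ideal_minus_closed[OF is_ideal] I_l_closed yc by blast
  then show ?case using xy x(1) unfolding f_def by blast
qed

end

section \<open>Inertia groups, coset representatives and the transfer\<close>

context ring_action
begin

definition inertia :: "'a set \<Rightarrow> 'c set" where
  "inertia P = {g \<in> carrier G. \<forall>r\<in>carrier R. \<phi> g r \<ominus> r \<in> P}"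

definition fixed :: "'c set \<Rightarrow> 'a set" where
  "fixed H = {r \<in> carrier R. \<forall>h\<in>H. \<phi> h r = r}"

lemma inertia_subgroup:
  assumes "ideal P R"
  shows "subgroup (inertia P) G"
proof -
  interpret P: ideal P R by fact
  show ?thesis
  proof (rule G.subgroupI)
    show "inertia P \<subseteq> carrier G" by (auto simp: inertia_def)
    have "\<one>\<^bsub>G\<^esub> \<in> inertia P" by (auto simp: inertia_def act_id r_neg minus_eq)
    then show "inertia P \<noteq> {}" by blast
  next
    fix g assume "g \<in> inertia P"
    then have g: "g \<in> carrier G" "\<And>r. r \<in> carrier R \<Longrightarrow> \<phi> g r \<ominus> r \<in> P" by (auto simp: inertia_def)
    have "\<phi> (inv\<^bsub>G\<^esub> g) r \<ominus> r \<in> P" if r: "r \<in> carrier R" for r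
    proof -
      have "\<ominus> (\<phi> g (\<phi> (inv\<^bsub>G\<^esub> g) r) \<ominus> \<phi> (inv\<^bsub>G\<^esub> g) r) \<in> P" using g r by simp
      also have "\<ominus> (\<phi> g (\<phi> (inv\<^bsub>G\<^esub> g) r) \<ominus> \<phi> (inv\<^bsub>G\<^esub> g) r) = \<phi> (inv\<^bsub>G\<^esub> g) r \<ominus> r"
        using g(1) r by (simp add: act_act_inv minus_eq minus_add a_comm)
      finally show ?thesis .
    qed
    then show "inv\<^bsub>G\<^esub> g \<in> inertia P" using g by (simp add: inertia_def)
    fix h assume "h \<in> inertia P"
    then have h: "h \<in> carrier G" "\<And>r. r \<in> carrier R \<Longrightarrow> \<phi> h r \<ominus> r \<in> P" by (auto simp: inertia_def)
    have "\<phi> (g \<otimes>\<^bsub>G\<^esub> h) r \<ominus> r \<in> P" if r: "r \<in> carrier R" for r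
    proof -
      have c: "\<phi> g (\<phi> h r) \<in> carrier R" "\<phi> h r \<in> carrier R" using g(1) h(1) r by simp_all
      have "\<phi> (g \<otimes>\<^bsub>G\<^esub> h) r \<ominus> r = (\<phi> g (\<phi> h r) \<ominus> \<phi> h r) \<oplus> (\<phi> h r \<ominus> r)"
        unfolding act_comp[OF g(1) h(1) r] using c r by algebra
      then show ?thesis using g(2)[OF c(2)] h(2)[OF r] by (simp add: P.a_closed)
    qed
    then show "g \<otimes>\<^bsub>G\<^esub> h \<in> inertia P" using g h by (simp add: inertia_def)
  qed
qed

lemma map_linear_prod:
  assumes "g \<in> carrier G" "set zs \<subseteq> carrier R"
  shows "map (\<phi> g) (linear_prod zs) = linear_prod (map (\<phi> g) zs)"
  using assms(2)
proof (induction zs)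
  case Nil
  then show ?case by (simp add: linear_prod_simps act_one assms(1))
next
  case (Cons z zs)
  have "map (\<phi> g) (mult_linear z c cs) = mult_linear (\<phi> g z) (\<phi> g c) (map (\<phi> g) cs)"
    if "z \<in> carrier R" "c \<in> carrier R" "set cs \<subseteq> carrier R" for c cs
    using that by (induction cs arbitrary: c) (auto simp: act_add act_mult assms(1))
  then show ?case using Cons linear_prod_closed[of zs]
    by (simp add: linear_prod_simps act_zero assms(1))
qed

lemma poly_value_map_congruent:
  assumes P: "ideal P R" and t: "t \<in> carrier G" and a: "a \<in> carrier R"
  shows "\<lbrakk>set cs \<subseteq> carrier R; \<And>c. c \<in> set cs \<Longrightarrow> \<phi> t c \<ominus> c \<in> P\<rbrakk> \<Longrightarrow>
    poly_value (map (\<phi> t) cs) a \<ominus> poly_value cs a \<in> P"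
proof (induction cs)
  case Nil
  then show ?case using ideal_zero_closed[OF P] by (simp add: minus_eq)
next
  case (Cons c cs)
  interpret P: ideal P R by (rule P)
  have c: "c \<in> carrier R" "\<phi> t c \<in> carrier R" "set cs \<subseteq> carrier R" using Cons.prems t by auto
  have v: "poly_value (map (\<phi> t) cs) a \<in> carrier R" "poly_value cs a \<in> carrier R"
    using c(3) t a by (auto intro!: poly_value_closed act_closed)
  have "poly_value (map (\<phi> t) (c # cs)) a \<ominus> poly_value (c # cs) a =
      (\<phi> t c \<ominus> c) \<oplus> a \<otimes> (poly_value (map (\<phi> t) cs) a \<ominus> poly_value cs a)"
    unfolding list.map poly_value.simps using c v a by algebra
  also have "\<dots> \<in> P"
    by (intro P.a_closed P.I_l_closed Cons.IH Cons.prems) (use Cons.prems c a in auto)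
  finally show ?case .
qed

text \<open>Suppose \<open>t\<close> is the identity modulo \<open>P\<close> on the invariants of
  the inertia group \<open>H\<close>. The coefficients of the product of all \<open>X - h r\<close>
  over \<open>H\<close> are such invariants, so applying \<open>t\<close> to them changes nothing
  modulo \<open>P\<close>; the transformed polynomial has the root \<open>t r\<close>. Hence the
  product of all \<open>t r - h r\<close> lies in \<open>P\<close>, and \<open>t r\<close> is
  congruent to some \<open>h r\<close>, thus to \<open>r\<close>. This puts \<open>t\<close> into
  \<open>H\<close>.\<close>

lemma fixed_separates:
  assumes P: "primeideal P R" and t: "t \<in> carrier G" "t \<notin> inertia P"
  shows "\<exists>x\<in>fixed (inertia P). \<phi> t x \<ominus> x \<notin> P"
proof (rule ccontr)
  interpret P: primeideal P R by (rule P)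
  define H where "H = inertia P"
  have H: "subgroup H G" unfolding H_def by (rule inertia_subgroup[OF P.is_ideal])
  interpret H: subgroup H G by (rule H)
  assume "\<not> ?thesis"
  then have congr: "\<And>x. x \<in> fixed H \<Longrightarrow> \<phi> t x \<ominus> x \<in> P" by (auto simp: H_def)
  have "\<phi> t r \<ominus> r \<in> P" if r: "r \<in> carrier R" for r
  proof -
    obtain hs where hs: "set hs = H" "distinct hs"
      using finite_distinct_list[OF finite_subset[OF H.subset fin]] by blast
    define zs where "zs = map (\<lambda>h. \<ominus> \<phi> h r) hs"
    define cs where "cs = linear_prod zs"
    have zs: "set zs \<subseteq> carrier R" using hs(1) H.mem_carrier r by (auto simp: zs_def)
    have cs: "set cs \<subseteq> carrier R" unfolding cs_def by (rule linear_prod_closed[OF zs])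
    have "map (\<phi> h) cs = cs" if h: "h \<in> H" for h
    proof -
      have hc: "h \<in> carrier G" using h by (rule H.mem_carrier)
      have "map (\<phi> h) zs = map (\<lambda>h. \<ominus> \<phi> h r) (map (\<lambda>h'. h \<otimes>\<^bsub>G\<^esub> h') hs)"
        using hs(1) H.mem_carrier hc r by (simp add: zs_def act_uminus act_comp)
      moreover have "mset (map (\<lambda>h'. h \<otimes>\<^bsub>G\<^esub> h') hs) = mset hs"
      proof (rule set_eq_iff_mset_eq_distinct[THEN iffD1])
        show d: "distinct (map (\<lambda>h'. h \<otimes>\<^bsub>G\<^esub> h') hs)"
          using hs H.mem_carrier hc by (auto simp: distinct_map inj_on_def)
        have "set (map (\<lambda>h'. h \<otimes>\<^bsub>G\<^esub> h') hs) \<subseteq> set hs"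
          unfolding hs(1) set_map using H.m_closed[OF h] by blast
        then show "set (map (\<lambda>h'. h \<otimes>\<^bsub>G\<^esub> h') hs) = set hs"
          by (rule card_subset_eq[rotated]) (use d hs(2) distinct_card[OF d] distinct_card[OF hs(2)] in auto)
      qed (rule hs(2))
      ultimately have "mset (map (\<phi> h) zs) = mset zs" unfolding zs_def by (metis mset_map)
      then show ?thesis
        unfolding cs_def map_linear_prod[OF hc zs]
        by (rule linear_prod_mset) (use zs hc in auto)
    qed
    then have "\<phi> h c = c" if "h \<in> H" "c \<in> set cs" for h c
      using that by (metis map_idI map_eq_conv list.map_id id_apply)
    then have "c \<in> fixed H" if "c \<in> set cs" for c using that cs by (auto simp: fixed_def)
    then have "\<phi> t c \<ominus> c \<in> P" if "c \<in> set cs" for c using congr that by blast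
    then have "poly_value (map (\<phi> t) cs) (\<phi> t r) \<ominus> poly_value cs (\<phi> t r) \<in> P"
      using poly_value_map_congruent[OF P.is_ideal t(1) act_closed[OF t(1) r] cs] by blast
    moreover have "poly_value (map (\<phi> t) cs) (\<phi> t r) = \<zero>"
      unfolding cs_def map_linear_prod[OF t(1) zs]
    proof (rule poly_value_linear_prod_root)
      have "\<ominus> \<phi> \<one>\<^bsub>G\<^esub> r \<in> set zs" using hs(1) H.one_closed by (simp add: zs_def)
      then have "\<phi> t (\<ominus> \<phi> \<one>\<^bsub>G\<^esub> r) \<in> set (map (\<phi> t) zs)" by simp
      then show "\<ominus> \<phi> t r \<in> set (map (\<phi> t) zs)" using t(1) r by (simp only: act_id act_uminus)
    qed (use zs t(1) r in auto)
    ultimately have "\<ominus> (\<zero> \<ominus> poly_value cs (\<phi> t r)) \<in> P" by simp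
    then have "poly_value cs (\<phi> t r) \<in> P"
      using poly_value_closed[OF cs act_closed[OF t(1) r]] by (simp add: minus_eq)
    then obtain z where "z \<in> set zs" "\<phi> t r \<oplus> z \<in> P"
      using P.poly_value_linear_prod_mem[OF zs act_closed[OF t(1) r]] unfolding cs_def by blast
    then obtain h where h: "h \<in> H" "\<phi> t r \<ominus> \<phi> h r \<in> P"
      using hs(1) by (auto simp: zs_def minus_eq)
    have c: "\<phi> t r \<in> carrier R" "\<phi> h r \<in> carrier R" using t(1) h(1) r H.mem_carrier by auto
    have "\<phi> t r \<ominus> r = (\<phi> t r \<ominus> \<phi> h r) \<oplus> (\<phi> h r \<ominus> r)" using c r by algebra
    moreover have "\<phi> h r \<ominus> r \<in> P" using h(1) r unfolding H_def inertia_def by blast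
    ultimately show ?thesis using P.a_closed[OF h(2)] by metis
  qed
  then show False using t by (simp add: inertia_def)
qed

text \<open>The choice is made from the coset, so all elements of one left coset receive the same
  representative.\<close>

definition coset_rep :: "'c set \<Rightarrow> 'c \<Rightarrow> 'c" where
  "coset_rep H g = (SOME t. t \<in> g <#\<^bsub>G\<^esub> H)"

definition transversal :: "'c set \<Rightarrow> 'c set" where
  "transversal H = coset_rep H ` carrier G"

lemma coset_rep_mem:
  assumes "subgroup H G" "g \<in> carrier G"
  shows "coset_rep H g \<in> g <#\<^bsub>G\<^esub> H"
proof -
  have "g \<in> g <#\<^bsub>G\<^esub> H" using assms G.lcos_self by blast
  then show ?thesis unfolding coset_rep_def by (rule someI)
qed

lemma coset_rep_eq:
  assumes "subgroup H G" "g \<in> carrier G"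
  obtains h where "h \<in> H" "coset_rep H g = g \<otimes>\<^bsub>G\<^esub> h"
  using coset_rep_mem[OF assms] by (auto simp: l_coset_def)

lemma coset_rep_closed: "\<lbrakk>subgroup H G; g \<in> carrier G\<rbrakk> \<Longrightarrow> coset_rep H g \<in> carrier G"
  by (metis coset_rep_eq G.m_closed subgroup.mem_carrier)

lemma coset_rep_mult:
  assumes "subgroup H G" "g \<in> carrier G" "h \<in> H"
  shows "coset_rep H (g \<otimes>\<^bsub>G\<^esub> h) = coset_rep H g"
proof -
  have "g \<otimes>\<^bsub>G\<^esub> h \<in> g <#\<^bsub>G\<^esub> H" using assms(3) by (auto simp: l_coset_def)
  then have "g <#\<^bsub>G\<^esub> H = (g \<otimes>\<^bsub>G\<^esub> h) <#\<^bsub>G\<^esub> H" by (rule G.l_repr_independence[OF _ assms(2,1)])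
  then show ?thesis by (simp add: coset_rep_def)
qed

lemma coset_rep_coset_rep:
  assumes "subgroup H G" "g \<in> carrier G"
  shows "coset_rep H (coset_rep H g) = coset_rep H g"
  using coset_rep_eq[OF assms] coset_rep_mult[OF assms] by metis

lemma transversal_carrier: "subgroup H G \<Longrightarrow> t \<in> transversal H \<Longrightarrow> t \<in> carrier G"
  using coset_rep_closed by (auto simp: transversal_def)

lemma transversal_finite: "finite (transversal H)"
  using fin by (simp add: transversal_def)

text \<open>Left translation by \<open>g\<close> permutes the left cosets, and \<open>F\<close>
  depends on the coset only.\<close>

lemma finsum_transversal_shift:
  assumes H: "subgroup H G" and g: "g \<in> carrier G"
    and F: "\<And>t. t \<in> carrier G \<Longrightarrow> F t \<in> carrier R"
    and inv: "\<And>t h. t \<in> carrier G \<Longrightarrow> h \<in> H \<Longrightarrow> F (t \<otimes>\<^bsub>G\<^esub> h) = F t"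
  shows "(\<Oplus>t\<in>transversal H. F (g \<otimes>\<^bsub>G\<^esub> t)) = (\<Oplus>t\<in>transversal H. F t)"
proof -
  define \<sigma> where "\<sigma> t = coset_rep H (g \<otimes>\<^bsub>G\<^esub> t)" for t
  have F_rep: "F (coset_rep H t) = F t" if "t \<in> carrier G" for t
    using coset_rep_eq[OF H that] inv[OF that] by metis
  have inj: "inj_on \<sigma> (transversal H)"
  proof (rule inj_onI)
    fix s t assume st: "s \<in> transversal H" "t \<in> transversal H" "\<sigma> s = \<sigma> t"
    have c: "s \<in> carrier G" "t \<in> carrier G" using st transversal_carrier[OF H] by auto
    obtain h where h: "h \<in> H" "\<sigma> s = (g \<otimes>\<^bsub>G\<^esub> s) \<otimes>\<^bsub>G\<^esub> h"
      using coset_rep_eq[OF H, of "g \<otimes>\<^bsub>G\<^esub> s"] g c unfolding \<sigma>_def by blast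
    obtain k where k: "k \<in> H" "\<sigma> t = (g \<otimes>\<^bsub>G\<^esub> t) \<otimes>\<^bsub>G\<^esub> k"
      using coset_rep_eq[OF H, of "g \<otimes>\<^bsub>G\<^esub> t"] g c unfolding \<sigma>_def by blast
    have hk: "h \<in> carrier G" "k \<in> carrier G" using h k subgroup.mem_carrier[OF H] by auto
    have "g \<otimes>\<^bsub>G\<^esub> (s \<otimes>\<^bsub>G\<^esub> h) = g \<otimes>\<^bsub>G\<^esub> (t \<otimes>\<^bsub>G\<^esub> k)"
      using st(3) h(2) k(2) g c hk by (simp add: G.m_assoc)
    then have "s \<otimes>\<^bsub>G\<^esub> h = t \<otimes>\<^bsub>G\<^esub> k" using g c hk by simp
    then have "coset_rep H s = coset_rep H t"
      using coset_rep_mult[OF H c(1) h(1)] coset_rep_mult[OF H c(2) k(1)] by simp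
    then show "s = t" using st(1,2) coset_rep_coset_rep[OF H] by (auto simp: transversal_def)
  qed
  have "\<sigma> ` transversal H \<subseteq> transversal H"
    using g transversal_carrier[OF H] by (auto simp: \<sigma>_def transversal_def)
  then have surj: "\<sigma> ` transversal H = transversal H"
    using inj by (rule endo_inj_surj[OF transversal_finite])
  have "(\<Oplus>t\<in>transversal H. F (g \<otimes>\<^bsub>G\<^esub> t)) = (\<Oplus>t\<in>transversal H. F (\<sigma> t))"
    by (rule finsum_cong') (use g transversal_carrier[OF H] F F_rep coset_rep_closed[OF H] \<sigma>_def in auto)
  also have "\<dots> = (\<Oplus>t\<in>\<sigma> ` transversal H. F t)"
    by (rule finsum_reindex[symmetric]) (use inj surj F transversal_carrier[OF H] in auto)
  finally show ?thesis by (simp add: surj)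
qed

text \<open>The representative \<open>e\<close> of the coset \<open>H\<close> acts as the identity
  on the invariants of \<open>H\<close>; all other representatives lie outside \<open>H\<close> and
  differ from the identity there by \<open>fixed_separates\<close>. So the transfer is a sum of
  characters with coefficients 1 to which \<open>characters_independent\<close> applies.\<close>

lemma transfer_not_mem_prime:
  assumes P: "primeideal P R"
  defines "H \<equiv> inertia P"
  shows "\<exists>x\<in>fixed H. (\<Oplus>t\<in>transversal H. \<phi> t x) \<notin> P"
proof -
  interpret P: primeideal P R by (rule P)
  have H: "subgroup H G" unfolding H_def by (rule inertia_subgroup[OF P.is_ideal])
  interpret H: subgroup H G by (rule H)
  define e where "e = coset_rep H \<one>\<^bsub>G\<^esub>"
  have e: "e \<in> H" using coset_rep_eq[OF H G.one_closed] unfolding e_def by (metis G.l_one H.mem_carrier)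
  have eT: "e \<in> transversal H" by (simp add: e_def transversal_def)
  define T where "T = transversal H - {e}"
  have T: "t \<in> carrier G" "t \<notin> H" if "t \<in> T" for t
  proof -
    show t: "t \<in> carrier G" using that transversal_carrier[OF H] by (auto simp: T_def)
    show "t \<notin> H"
    proof
      assume tH: "t \<in> H"
      have "t = coset_rep H t" using that coset_rep_coset_rep[OF H] by (auto simp: T_def transversal_def)
      also have "\<dots> = e" using coset_rep_mult[OF H G.one_closed tH] t by (simp add: e_def)
      finally show False using that by (simp add: T_def)
    qed
  qed
  have "\<exists>x\<in>fixed H. \<one> \<otimes> x \<oplus> (\<Oplus>t\<in>T. \<one> \<otimes> \<phi> t x) \<notin> P"
  proof (rule P.characters_independent)
    show "finite T" using transversal_finite by (simp add: T_def)
    show "\<one> \<in> fixed H" using H.mem_carrier by (auto simp: fixed_def act_one)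
    show "x \<otimes> y \<in> fixed H" if "x \<in> fixed H" "y \<in> fixed H" for x y
      using that H.mem_carrier by (auto simp: fixed_def act_mult)
    show "\<exists>y\<in>fixed H. \<phi> t y \<ominus> y \<notin> P" if "t \<in> T" for t
      using fixed_separates[OF P] T[OF that] unfolding H_def by blast
    show "\<one> \<notin> P" using P.one_imp_carrier P.I_notcarr by auto
  qed (use T in \<open>auto simp: fixed_def act_mult\<close>)
  then obtain x where x: "x \<in> fixed H" "\<one> \<otimes> x \<oplus> (\<Oplus>t\<in>T. \<one> \<otimes> \<phi> t x) \<notin> P" by blast
  have xc: "x \<in> carrier R" using x(1) by (simp add: fixed_def)
  have "(\<Oplus>t\<in>insert e T. \<phi> t x) = \<phi> e x \<oplus> (\<Oplus>t\<in>T. \<phi> t x)"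
    by (rule finsum_insert) (use transversal_finite T xc e H.mem_carrier in \<open>auto simp: T_def\<close>)
  also have "insert e T = transversal H" using eT by (auto simp: T_def)
  also have "\<phi> e x = x" using x(1) e by (simp add: fixed_def)
  also have "(\<Oplus>t\<in>T. \<phi> t x) = (\<Oplus>t\<in>T. \<one> \<otimes> \<phi> t x)"
    by (rule finsum_cong') (use T xc in auto)
  finally have "(\<Oplus>t\<in>transversal H. \<phi> t x) \<notin> P" using x(2) xc by simp
  then show ?thesis using x(1) by blast
qed

end

section \<open>The simplicial differential and the prism operator\<close>

context abelian_group
begin

text \<open>The alternating sum over deleted entries: first the head is deleted, then the faces that
  keep it follow with opposite sign. Functions take lists of every length, so one operator serves
  all degrees, including the augmentation at the empty list.\<close>

fun bd :: "('c list \<Rightarrow> 'a) \<Rightarrow> 'c list \<Rightarrow> 'a" where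
  "bd f [] = \<zero>"
| "bd f (x # xs) = f xs \<ominus> bd (\<lambda>ys. f (x # ys)) xs"

lemma bd_map: "bd f (map m xs) = bd (\<lambda>ys. f (map m ys)) xs"
  by (induction xs arbitrary: f) auto

lemma bd_cong:
  assumes "xs \<in> lists V" "\<And>ys. ys \<in> lists V \<Longrightarrow> Suc (length ys) = length xs \<Longrightarrow> f ys = f' ys"
  shows "bd f xs = bd f' xs"
  using assms
proof (induction xs arbitrary: f f')
  case (Cons x xs)
  have "bd (\<lambda>ys. f (x # ys)) xs = bd (\<lambda>ys. f' (x # ys)) xs"
    by (rule Cons.IH) (use Cons.hyps Cons.prems in auto)
  moreover have "f xs = f' xs" by (rule Cons.prems) (use Cons.hyps in auto)
  ultimately show ?case by simp
qed simp

lemma bd_closed: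
  "\<lbrakk>xs \<in> lists V; \<And>ys. ys \<in> lists V \<Longrightarrow> f ys \<in> carrier G\<rbrakk> \<Longrightarrow> bd f xs \<in> carrier G"
proof (induction xs arbitrary: f)
  case (Cons x xs)
  have "bd (\<lambda>ys. f (x # ys)) xs \<in> carrier G" by (rule Cons.IH) (use Cons in auto)
  then show ?case using Cons by simp
qed simp

lemma bd_hom:
  assumes h: "\<And>a. a \<in> carrier G \<Longrightarrow> h a \<in> carrier G"
    "\<And>a b. a \<in> carrier G \<Longrightarrow> b \<in> carrier G \<Longrightarrow> h (a \<ominus> b) = h a \<ominus> h b" "h \<zero> = \<zero>"
  shows "\<lbrakk>xs \<in> lists V; \<And>ys. ys \<in> lists V \<Longrightarrow> f ys \<in> carrier G\<rbrakk> \<Longrightarrow> bd (\<lambda>ys. h (f ys)) xs = h (bd f xs)"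
proof (induction xs arbitrary: f)
  case Nil
  then show ?case using h(3) by simp
next
  case (Cons x xs)
  have "bd (\<lambda>ys. f (x # ys)) xs \<in> carrier G" by (rule bd_closed[of _ V]) (use Cons.prems in auto)
  moreover have "bd (\<lambda>ys. h (f (x # ys))) xs = h (bd (\<lambda>ys. f (x # ys)) xs)"
    by (rule Cons.IH) (use Cons.prems in auto)
  ultimately show ?case using h(2) Cons.prems by simp
qed

lemma add_minus_add:
  assumes "a \<in> carrier G" "b \<in> carrier G" "c \<in> carrier G" "d \<in> carrier G"
  shows "(a \<oplus> b) \<ominus> (c \<oplus> d) = (a \<ominus> c) \<oplus> (b \<ominus> d)"
  using assms by (simp add: minus_eq minus_add a_ac)

lemma bd_add:
  "\<lbrakk>xs \<in> lists V; \<And>ys. ys \<in> lists V \<Longrightarrow> f ys \<in> carrier G; \<And>ys. ys \<in> lists V \<Longrightarrow> f' ys \<in> carrier G\<rbrakk> \<Longrightarrow>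
     bd (\<lambda>ys. f ys \<oplus> f' ys) xs = bd f xs \<oplus> bd f' xs"
proof (induction xs arbitrary: f f')
  case (Cons x xs)
  have "bd (\<lambda>ys. f (x # ys)) xs \<in> carrier G" "bd (\<lambda>ys. f' (x # ys)) xs \<in> carrier G"
    by (rule bd_closed[of _ V]; use Cons.prems in auto)+
  moreover have "bd (\<lambda>ys. f (x # ys) \<oplus> f' (x # ys)) xs =
      bd (\<lambda>ys. f (x # ys)) xs \<oplus> bd (\<lambda>ys. f' (x # ys)) xs"
    by (rule Cons.IH) (use Cons.prems in auto)
  ultimately show ?case using Cons.prems add_minus_add by simp
qed simp

lemma bd_uminus:
  assumes "xs \<in> lists V" "\<And>ys. ys \<in> lists V \<Longrightarrow> f ys \<in> carrier G"
  shows "bd (\<lambda>ys. \<ominus> f ys) xs = \<ominus> bd f xs"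
proof (rule bd_hom[of _ xs V f])
  show "\<ominus> (a \<ominus> b) = \<ominus> a \<ominus> \<ominus> b" if "a \<in> carrier G" "b \<in> carrier G" for a b
    using that by (simp add: minus_eq minus_add)
  show "\<ominus> \<zero> = \<zero>" by (rule minus_equality) auto
qed (use assms in auto)

lemma bd_minus:
  assumes "xs \<in> lists V" "\<And>ys. ys \<in> lists V \<Longrightarrow> f ys \<in> carrier G" "\<And>ys. ys \<in> lists V \<Longrightarrow> f' ys \<in> carrier G"
  shows "bd (\<lambda>ys. f ys \<ominus> f' ys) xs = bd f xs \<ominus> bd f' xs"
proof -
  have "bd (\<lambda>ys. f ys \<oplus> \<ominus> f' ys) xs = bd f xs \<oplus> bd (\<lambda>ys. \<ominus> f' ys) xs"
    by (rule bd_add[of _ V]) (use assms in auto)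
  then show ?thesis unfolding minus_eq using bd_uminus[OF assms(1,3)] by simp
qed

lemma bd_zero: "bd (\<lambda>ys. \<zero>) xs = \<zero>"
  by (induction xs) (auto simp: minus_eq r_neg)

lemma minus_minus_cancel:
  assumes "a \<in> carrier G" "b \<in> carrier G"
  shows "a \<ominus> (a \<ominus> b) = b"
proof -
  have "a \<ominus> (a \<ominus> b) = (a \<oplus> \<ominus> a) \<oplus> b" using assms by (simp add: minus_eq minus_add a_assoc)
  then show ?thesis using assms by (simp add: r_neg)
qed

text \<open>For \<open>x # xs\<close>, the faces that keep \<open>x\<close> contribute
  \<open>bd f xs - bd (bd h) xs\<close>, where \<open>h\<close> prefixes \<open>x\<close>. The first
  term cancels the face without \<open>x\<close>, and the second vanishes by induction.\<close>

lemma bd_bd: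
  "\<lbrakk>xs \<in> lists V; \<And>ys. ys \<in> lists V \<Longrightarrow> f ys \<in> carrier G\<rbrakk> \<Longrightarrow> bd (bd f) xs = \<zero>"
proof (induction xs arbitrary: f)
  case (Cons x xs)
  define h where "h = (\<lambda>ys. f (x # ys))"
  have xs: "xs \<in> lists V" and h: "\<And>ys. ys \<in> lists V \<Longrightarrow> h ys \<in> carrier G"
    using Cons.prems by (auto simp: h_def)
  have "bd (\<lambda>ys. bd f (x # ys)) xs = bd f xs \<ominus> bd (bd h) xs"
    unfolding h_def[symmetric]
    by (simp only: flip: bd_minus[OF xs Cons.prems(2) bd_closed[OF _ h]]) (simp add: h_def)
  also have "bd (bd h) xs = \<zero>" by (rule Cons.IH[OF xs h])
  finally have "bd (bd f) (x # xs) = bd f xs \<ominus> (bd f xs \<ominus> \<zero>)" by simp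
  then show ?case using minus_minus_cancel[OF bd_closed[OF xs Cons.prems(2)] zero_closed] by simp
qed simp

lemma bd_finsum:
  assumes "finite T" "xs \<in> lists V" "\<And>t ys. t \<in> T \<Longrightarrow> ys \<in> lists V \<Longrightarrow> f t ys \<in> carrier G"
  shows "bd (\<lambda>ys. \<Oplus>t\<in>T. f t ys) xs = (\<Oplus>t\<in>T. bd (f t) xs)"
  using assms(1,3)
proof (induction T)
  case empty
  then show ?case by (simp add: bd_zero)
next
  case (insert s T)
  have "bd (\<lambda>ys. \<Oplus>t\<in>insert s T. f t ys) xs = bd (\<lambda>ys. f s ys \<oplus> (\<Oplus>t\<in>T. f t ys)) xs"
    by (rule bd_cong[OF assms(2)]) (use insert in \<open>auto intro!: finsum_insert\<close>)
  also have "\<dots> = bd (f s) xs \<oplus> bd (\<lambda>ys. \<Oplus>t\<in>T. f t ys) xs"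
    by (rule bd_add[OF assms(2)]) (use insert.prems in \<open>auto intro!: finsum_closed\<close>)
  also have "bd (\<lambda>ys. \<Oplus>t\<in>T. f t ys) xs = (\<Oplus>t\<in>T. bd (f t) xs)"
    by (rule insert.IH) (use insert.prems in auto)
  also have "bd (f s) xs \<oplus> (\<Oplus>t\<in>T. bd (f t) xs) = (\<Oplus>t\<in>insert s T. bd (f t) xs)"
    by (rule finsum_insert[symmetric])
      (use insert.hyps insert.prems in \<open>auto intro!: bd_closed[OF assms(2)]\<close>)
  finally show ?case .
qed

text \<open>This is the sum of \<open>(-1)^i f [x\<^sub>0, \<dots>, x\<^sub>i, p x\<^sub>i, \<dots>, p x\<^sub>n]\<close>.\<close>

fun prism :: "('c \<Rightarrow> 'c) \<Rightarrow> ('c list \<Rightarrow> 'a) \<Rightarrow> 'c list \<Rightarrow> 'a" where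
  "prism p f [] = \<zero>"
| "prism p f (x # xs) = f (x # p x # map p xs) \<ominus> prism p (\<lambda>ys. f (x # ys)) xs"

lemma prism_closed:
  "\<lbrakk>xs \<in> lists V; \<And>x. x \<in> V \<Longrightarrow> p x \<in> V; \<And>ys. ys \<in> lists V \<Longrightarrow> f ys \<in> carrier G\<rbrakk> \<Longrightarrow>
     prism p f xs \<in> carrier G"
proof (induction xs arbitrary: f)
  case (Cons x xs)
  have "prism p (\<lambda>ys. f (x # ys)) xs \<in> carrier G" by (rule Cons.IH) (use Cons.prems in auto)
  moreover have "f (x # p x # map p xs) \<in> carrier G" by (rule Cons.prems(3)) (use Cons.prems in auto)
  ultimately show ?case by simp
qed simp

lemma prism_minus:
  "\<lbrakk>xs \<in> lists V; \<And>x. x \<in> V \<Longrightarrow> p x \<in> V; \<And>ys. ys \<in> lists V \<Longrightarrow> f ys \<in> carrier G;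
    \<And>ys. ys \<in> lists V \<Longrightarrow> f' ys \<in> carrier G\<rbrakk> \<Longrightarrow>
     prism p (\<lambda>ys. f ys \<ominus> f' ys) xs = prism p f xs \<ominus> prism p f' xs"
proof (induction xs arbitrary: f f')
  case (Cons x xs)
  have "prism p (\<lambda>ys. f (x # ys) \<ominus> f' (x # ys)) xs =
      prism p (\<lambda>ys. f (x # ys)) xs \<ominus> prism p (\<lambda>ys. f' (x # ys)) xs"
    by (rule Cons.IH) (use Cons.prems in auto)
  moreover have "prism p (\<lambda>ys. f (x # ys)) xs \<in> carrier G" "prism p (\<lambda>ys. f' (x # ys)) xs \<in> carrier G"
    by (rule prism_closed[of _ V]; use Cons.prems in auto)+
  moreover have "f (x # p x # map p xs) \<in> carrier G" "f' (x # p x # map p xs) \<in> carrier G"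
    by (rule Cons.prems; use Cons.prems in auto)+
  ultimately show ?case by (simp add: minus_eq minus_add a_ac)
next
  case Nil
  then show ?case by (simp add: minus_eq r_neg)
qed

text \<open>The prism operator is a homotopy between the identity and the pullback along
  \<open>p\<close>. When the first vertex is split off, the terms \<open>u\<close> and
  \<open>v\<close> cancel, and \<open>w + z\<close> is the left side for \<open>h\<close>, to which
  the induction hypothesis applies.\<close>

lemma prism_homotopy:
  "\<lbrakk>xs \<in> lists V; \<And>x. x \<in> V \<Longrightarrow> p x \<in> V; \<And>ys. ys \<in> lists V \<Longrightarrow> f ys \<in> carrier G\<rbrakk> \<Longrightarrow>
     bd (prism p f) xs \<oplus> prism p (bd f) xs = f (map p xs) \<ominus> f xs"
proof (induction xs arbitrary: f)
  case Nil
  then have "f [] \<in> carrier G" by simp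
  then show ?case by (simp add: minus_eq r_neg)
next
  case (Cons x xs)
  define h where "h = (\<lambda>ys. f (x # ys))"
  define q where "q = (\<lambda>ys. h (p x # ys))"
  have xs: "xs \<in> lists V" "map p xs \<in> lists V" and x: "x \<in> V" "p x \<in> V"
    and p: "\<And>x. x \<in> V \<Longrightarrow> p x \<in> V" and f: "\<And>ys. ys \<in> lists V \<Longrightarrow> f ys \<in> carrier G"
    using Cons.prems by auto
  have h: "\<And>ys. ys \<in> lists V \<Longrightarrow> h ys \<in> carrier G" using f x by (simp add: h_def)
  have q: "\<And>ys. ys \<in> lists V \<Longrightarrow> q ys \<in> carrier G" using h x by (simp add: q_def)
  have mp: "map p ys \<in> lists V" if "ys \<in> lists V" for ys using that p by auto
  define u v w z where "u = prism p f xs" and "v = bd q (map p xs)" and "w = bd (prism p h) xs"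
    and "z = prism p (bd h) xs"
  have c: "u \<in> carrier G" "v \<in> carrier G" "w \<in> carrier G" "z \<in> carrier G"
    "h (map p xs) \<in> carrier G" "f (p x # map p xs) \<in> carrier G" "h xs \<in> carrier G"
    unfolding u_def v_def w_def z_def
    using prism_closed[OF xs(1) p f] bd_closed[OF xs(2) q] bd_closed[OF xs(1) prism_closed[OF _ p h]]
      prism_closed[OF xs(1) p bd_closed[OF _ h]] h[OF xs(2)] f xs x h[OF xs(1)] by simp_all
  have "bd (\<lambda>ys. prism p f (x # ys)) xs = bd (\<lambda>ys. q (map p ys)) xs \<ominus> bd (prism p h) xs"
    using bd_minus[where f = "\<lambda>ys. q (map p ys)" and f' = "prism p h", OF xs(1) q[OF mp] prism_closed[OF _ p h]]
    by (simp add: h_def q_def)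
  then have 1: "bd (prism p f) (x # xs) = u \<ominus> (v \<ominus> w)" by (simp add: u_def v_def w_def bd_map)
  have "prism p (\<lambda>ys. bd f (x # ys)) xs = prism p f xs \<ominus> prism p (bd h) xs"
    using prism_minus[where p = p and f' = "bd h", OF xs(1) p f bd_closed[OF _ h]]
    by (simp add: h_def)
  then have 2: "prism p (bd f) (x # xs) = (f (p x # map p xs) \<ominus> (h (map p xs) \<ominus> v)) \<ominus> (u \<ominus> z)"
    by (simp add: u_def z_def h_def q_def v_def)
  have IH: "w \<oplus> z = h (map p xs) \<ominus> h xs"
    unfolding w_def z_def by (rule Cons.IH[OF xs(1) p h])
  have "bd (prism p f) (x # xs) \<oplus> prism p (bd f) (x # xs) =
      (u \<oplus> \<ominus> u) \<oplus> ((v \<oplus> \<ominus> v) \<oplus> (f (p x # map p xs) \<oplus> (\<ominus> h (map p xs) \<oplus> (w \<oplus> z))))"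
    unfolding 1 2 using c by (simp add: minus_eq minus_add a_ac)
  also have "\<dots> = f (p x # map p xs) \<ominus> h xs"
    unfolding IH using c by (simp add: minus_eq r_neg r_neg1)
  finally show ?case by (simp add: h_def)
qed

end

section \<open>Cochains and the transfer\<close>

lemma (in abelian_group) finsum_alternating_eq_bd:
  "\<lbrakk>xs \<in> lists V; \<And>ys. ys \<in> lists V \<Longrightarrow> f ys \<in> carrier G\<rbrakk> \<Longrightarrow>
     (\<Oplus>i\<in>{..<length xs}. if even i then f (take i xs @ drop (Suc i) xs)
       else \<ominus> f (take i xs @ drop (Suc i) xs)) = bd f xs"
proof (induction xs arbitrary: f)
  case (Cons x xs)
  define F where "F f xs i = (if even i then f (take i xs @ drop (Suc i) xs)
    else \<ominus> f (take i xs @ drop (Suc i) xs))" for f :: "'c list \<Rightarrow> 'a" and xs and i :: nat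
  have del: "take i ys @ drop (Suc i) ys \<in> lists V" if "ys \<in> lists V" for i ys
    using that set_take_subset[of i ys] set_drop_subset[of "Suc i" ys] by auto
  have F: "F f ys i \<in> carrier G" if "ys \<in> lists V" "\<And>ys. ys \<in> lists V \<Longrightarrow> f ys \<in> carrier G" for f ys i
    using del[OF that(1)] that(2) by (simp add: F_def)
  define h where "h = (\<lambda>ys. f (x # ys))"
  have xs: "xs \<in> lists V" and h: "\<And>ys. ys \<in> lists V \<Longrightarrow> h ys \<in> carrier G"
    using Cons.prems by (auto simp: h_def)
  have IH: "(\<Oplus>i\<in>{..<length xs}. F h xs i) = bd h xs" unfolding F_def by (rule Cons.IH[OF xs h])
  have F_Suc: "F f (x # xs) (Suc i) = \<ominus> F h xs i" for i
  proof -
    have "h (take i xs @ drop (Suc i) xs) \<in> carrier G" by (rule h[OF del[OF xs]])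
    then show ?thesis by (simp add: F_def h_def minus_minus)
  qed
  have neg: "(\<Oplus>i\<in>A. \<ominus> F h xs i) = \<ominus> (\<Oplus>i\<in>A. F h xs i)" if "finite A" for A
    using that
  proof (induction A)
    case empty
    show ?case by simp (rule minus_equality[symmetric], auto)
  next
    case (insert a A)
    then show ?case using F[OF xs h] by (simp add: Pi_def minus_add finsum_closed)
  qed
  have "(\<Oplus>i\<in>{..<length (x # xs)}. F f (x # xs) i) =
      F f (x # xs) 0 \<oplus> (\<Oplus>i\<in>Suc ` {..<length xs}. F f (x # xs) i)"
    unfolding list.size add_Suc_right add_0_right lessThan_Suc_eq_insert_0
    by (rule finsum_insert) (use F[OF Cons.prems] in auto)
  also have "(\<Oplus>i\<in>Suc ` {..<length xs}. F f (x # xs) i) = (\<Oplus>i\<in>{..<length xs}. F f (x # xs) (Suc i))"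
    by (rule finsum_reindex) (use F[OF Cons.prems] in auto)
  also have "\<dots> = \<ominus> bd h xs" unfolding F_Suc using neg[of "{..<length xs}"] IH by simp
  finally show ?case by (simp add: F_def h_def minus_eq)
qed simp

lemma (in abelian_group) prism_eq_zero:
  "\<lbrakk>xs \<in> lists V; \<And>x. x \<in> V \<Longrightarrow> p x \<in> V; \<And>ys. ys \<in> lists V \<Longrightarrow> f ys = \<zero>\<rbrakk> \<Longrightarrow> prism p f xs = \<zero>"
proof (induction xs arbitrary: f)
  case (Cons x xs)
  have "prism p (\<lambda>ys. f (x # ys)) xs = \<zero>" by (rule Cons.IH) (use Cons.prems in auto)
  moreover have "f (x # p x # map p xs) = \<zero>" by (rule Cons.prems(3)) (use Cons.prems in auto)
  ultimately show ?case by (simp add: minus_eq r_neg)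
qed simp

section \<open>The augmented complex of equivariant functions\<close>

context ring_action
begin

text \<open>All places of the complex lie in one group of functions on all lists, because
  \<open>regular_complex\<close> works inside a single carrier.\<close>

definition chain_group :: "('c list \<Rightarrow> 'a) ring" where
  "chain_group = \<lparr>carrier = {f. \<forall>xs. f xs \<in> carrier R}, monoid.mult = (\<lambda>f g xs. f xs \<otimes> g xs),
     monoid.one = (\<lambda>xs. \<one>), ring.zero = (\<lambda>xs. \<zero>), ring.add = (\<lambda>f g xs. f xs \<oplus> g xs)\<rparr>"

lemma chain_group_simps:
  "f \<in> carrier chain_group \<longleftrightarrow> (\<forall>xs. f xs \<in> carrier R)"
  "\<zero>\<^bsub>chain_group\<^esub> = (\<lambda>xs. \<zero>)" "f \<oplus>\<^bsub>chain_group\<^esub> g = (\<lambda>xs. f xs \<oplus> g xs)"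
  by (simp_all add: chain_group_def)

lemma chain_group_abelian: "abelian_group chain_group"
proof (rule abelian_groupI)
  fix f assume "f \<in> carrier chain_group"
  then show "\<exists>g\<in>carrier chain_group. g \<oplus>\<^bsub>chain_group\<^esub> f = \<zero>\<^bsub>chain_group\<^esub>"
    by (intro bexI[of _ "\<lambda>xs. \<ominus> f xs"]) (auto simp: chain_group_simps l_neg)
qed (auto simp: chain_group_simps a_ac)

text \<open>\<open>C n\<close> consists of the equivariant functions on \<open>n\<close>-tuples, extended by zero to all lists. So
  \<open>C (Suc n)\<close> are the \<open>n\<close>-cochains, and \<open>C 0\<close> is the augmentation term: its elements are given
  by their value at the empty list, an invariant.\<close>

definition C :: "nat \<Rightarrow> ('c list \<Rightarrow> 'a) set" where
  "C n = {f. (\<forall>xs. f xs \<in> carrier R) \<and> (\<forall>xs. xs \<notin> tuples G n \<longrightarrow> f xs = \<zero>) \<and>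
     (\<forall>g\<in>carrier G. \<forall>xs\<in>tuples G n. f (map (\<lambda>x. g \<otimes>\<^bsub>G\<^esub> x) xs) = \<phi> g (f xs))}"

definition D :: "('c list \<Rightarrow> 'a) \<Rightarrow> 'c list \<Rightarrow> 'a" where
  "D f = (\<lambda>xs. if xs \<in> lists (carrier G) then bd f xs else \<zero>)"

lemma C_I:
  assumes "\<And>xs. f xs \<in> carrier R" "\<And>xs. xs \<notin> tuples G n \<Longrightarrow> f xs = \<zero>"
    and "\<And>g xs. \<lbrakk>g \<in> carrier G; xs \<in> tuples G n\<rbrakk> \<Longrightarrow> f (map (\<lambda>x. g \<otimes>\<^bsub>G\<^esub> x) xs) = \<phi> g (f xs)"
  shows "f \<in> C n"
  using assms by (simp add: C_def)

lemma C_D: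
  assumes "f \<in> C n"
  shows "f xs \<in> carrier R" "xs \<notin> tuples G n \<Longrightarrow> f xs = \<zero>"
    "\<lbrakk>g \<in> carrier G; xs \<in> tuples G n\<rbrakk> \<Longrightarrow> f (map (\<lambda>x. g \<otimes>\<^bsub>G\<^esub> x) xs) = \<phi> g (f xs)"
  using assms by (auto simp: C_def)

lemma tuples_map: "\<lbrakk>xs \<in> tuples G n; g \<in> carrier G\<rbrakk> \<Longrightarrow> map (\<lambda>x. g \<otimes>\<^bsub>G\<^esub> x) xs \<in> tuples G n"
  by (auto simp: tuples_def)

lemma mem_tuples_iff: "xs \<in> tuples G n \<longleftrightarrow> xs \<in> lists (carrier G) \<and> length xs = n"
  by (auto simp: tuples_def)

lemma C_subgroup: "additive_subgroup (C n) chain_group"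
proof -
  interpret A: abelian_group chain_group by (rule chain_group_abelian)
  have ainv: "\<ominus>\<^bsub>chain_group\<^esub> f = (\<lambda>xs. \<ominus> f xs)" if "f \<in> C n" for f
    by (rule A.minus_equality) (use C_D(1)[OF that] in \<open>auto simp: chain_group_simps l_neg\<close>)
  have "C n \<subseteq> carrier chain_group" by (auto simp: chain_group_simps C_D)
  moreover have "(\<lambda>xs. \<zero>) \<in> C n" by (rule C_I) (auto simp: act_zero)
  then have "C n \<noteq> {}" by blast
  moreover have "\<ominus>\<^bsub>chain_group\<^esub> f \<in> C n" if "f \<in> C n" for f
    unfolding ainv[OF that] by (rule C_I) (use C_D[OF that] in \<open>auto simp: act_uminus\<close>)
  moreover have "f \<oplus>\<^bsub>chain_group\<^esub> g \<in> C n" if "f \<in> C n" "g \<in> C n" for f g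
    unfolding chain_group_simps
    by (rule C_I) (use C_D[OF that(1)] C_D[OF that(2)] in \<open>auto simp: act_add\<close>)
  ultimately show ?thesis
    by (intro additive_subgroupI A.add.subgroupI) (auto simp: a_inv_def)
qed

lemma D_closed:
  assumes "f \<in> C n"
  shows "D f \<in> C (Suc n)"
proof (rule C_I)
  fix xs
  show "D f xs \<in> carrier R"
    using bd_closed[of xs "carrier G" f] C_D(1)[OF assms] by (simp add: D_def)
  assume xs: "xs \<notin> tuples G (Suc n)"
  have "bd f xs = bd (\<lambda>ys. \<zero>) xs" if "xs \<in> lists (carrier G)"
    using that xs by (intro bd_cong[OF that] C_D(2)[OF assms]) (auto simp: mem_tuples_iff)
  then show "D f xs = \<zero>" by (simp add: D_def bd_zero)
next
  fix g xs assume g: "g \<in> carrier G" and xs: "xs \<in> tuples G (Suc n)"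
  have L: "xs \<in> lists (carrier G)" "length xs = Suc n" using xs by (simp_all add: mem_tuples_iff)
  have "bd f (map (\<lambda>x. g \<otimes>\<^bsub>G\<^esub> x) xs) = bd (\<lambda>ys. \<phi> g (f ys)) xs"
    unfolding bd_map using C_D(3)[OF assms g] L(2)
    by (intro bd_cong[OF L(1)]) (auto simp: mem_tuples_iff)
  also have "\<dots> = \<phi> g (bd f xs)"
    by (rule bd_hom[OF _ _ _ L(1)]) (use g C_D(1)[OF assms] in \<open>auto simp: act_minus act_zero\<close>)
  finally show "D f (map (\<lambda>x. g \<otimes>\<^bsub>G\<^esub> x) xs) = \<phi> g (D f xs)"
    using tuples_map[OF xs g] L(1) by (simp add: D_def mem_tuples_iff)
qed

lemma D_add:
  assumes "f \<in> C n" "g \<in> C n"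
  shows "D (f \<oplus>\<^bsub>chain_group\<^esub> g) = D f \<oplus>\<^bsub>chain_group\<^esub> D g"
proof
  fix xs
  show "D (f \<oplus>\<^bsub>chain_group\<^esub> g) xs = (D f \<oplus>\<^bsub>chain_group\<^esub> D g) xs"
    using bd_add[of xs "carrier G" f g] C_D(1)[OF assms(1)] C_D(1)[OF assms(2)]
    by (simp add: D_def chain_group_simps)
qed

lemma D_D:
  assumes "f \<in> C n"
  shows "D (D f) = \<zero>\<^bsub>chain_group\<^esub>"
proof
  fix xs
  have "bd (D f) xs = bd (bd f) xs" if "xs \<in> lists (carrier G)"
    by (rule bd_cong[OF that]) (simp add: D_def)
  moreover have "bd (bd f) xs = \<zero>" if "xs \<in> lists (carrier G)"
    by (rule bd_bd[OF that C_D(1)[OF assms]])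
  ultimately show "D (D f) xs = \<zero>\<^bsub>chain_group\<^esub> xs" by (simp add: D_def chain_group_simps)
qed

definition scale :: "'a \<Rightarrow> ('c list \<Rightarrow> 'a) \<Rightarrow> 'c list \<Rightarrow> 'a" where
  "scale s f = (\<lambda>xs. s \<otimes> f xs)"

lemma scale_closed: "\<lbrakk>s \<in> Inv; f \<in> C n\<rbrakk> \<Longrightarrow> scale s f \<in> C n"
  by (rule C_I) (auto simp: scale_def C_D act_mult mem_Inv_iff)

lemma scale_D:
  assumes "s \<in> Inv" "f \<in> C n"
  shows "scale s (D f) = D (scale s f)"
proof
  fix xs
  have s: "s \<in> carrier R" by (rule Inv_carrier[OF assms(1)])
  have "bd (\<lambda>ys. s \<otimes> f ys) xs = s \<otimes> bd f xs" if "xs \<in> lists (carrier G)"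
    by (rule bd_hom[OF _ _ _ that]) (use s C_D(1)[OF assms(2)] in \<open>auto simp: minus_eq r_distr r_minus\<close>)
  then show "scale s (D f) xs = D (scale s f) xs" using s by (simp add: scale_def D_def)
qed

lemma scale_add:
  "\<lbrakk>s \<in> Inv; f \<in> C n; g \<in> C n\<rbrakk> \<Longrightarrow> scale s (f \<oplus>\<^bsub>chain_group\<^esub> g) = scale s f \<oplus>\<^bsub>chain_group\<^esub> scale s g"
  by (auto simp: scale_def chain_group_simps r_distr C_D Inv_carrier)

lemma scale_scale: "\<lbrakk>s \<in> Inv; t \<in> Inv; f \<in> C n\<rbrakk> \<Longrightarrow> scale s (scale t f) = scale t (scale s f)"
  by (auto simp: scale_def m_lcomm C_D Inv_carrier)

text \<open>Cochains are \<open>undefined\<close> off their tuples, whereas elements of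
  \<open>C\<close> are zero there; \<open>extend\<close> and \<open>restrict\<close> translate
  between the two.\<close>

definition extend :: "nat \<Rightarrow> ('c list \<Rightarrow> 'a) \<Rightarrow> 'c list \<Rightarrow> 'a" where
  "extend n f = (\<lambda>xs. if xs \<in> tuples G n then f xs else \<zero>)"

lemma extend_mem_C:
  assumes "f \<in> cochains G R \<phi> n"
  shows "extend (Suc n) f \<in> C (Suc n)"
proof (rule C_I)
  have f: "f \<in> tuples G (Suc n) \<rightarrow> carrier R" using assms by (auto simp: cochains_def)
  then show "extend (Suc n) f xs \<in> carrier R" for xs by (auto simp: extend_def)
  show "extend (Suc n) f (map (\<lambda>x. g \<otimes>\<^bsub>G\<^esub> x) xs) = \<phi> g (extend (Suc n) f xs)"
    if "g \<in> carrier G" "xs \<in> tuples G (Suc n)" for g xs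
    using assms that tuples_map[OF that(2,1)] by (simp add: extend_def cochains_def)
qed (simp add: extend_def)

lemma restrict_mem_cochains:
  assumes "f \<in> C (Suc n)"
  shows "restrict f (tuples G (Suc n)) \<in> cochains G R \<phi> n"
  using C_D[OF assms] tuples_map by (auto simp: cochains_def)

lemma extend_restrict:
  assumes "f \<in> C n"
  shows "extend n (restrict f (tuples G n)) = f"
  using C_D(2)[OF assms] by (auto simp: extend_def)

lemma restrict_extend:
  assumes "f \<in> cochains G R \<phi> n"
  shows "restrict (extend (Suc n) f) (tuples G (Suc n)) = f"
  using assms by (auto simp: extend_def cochains_def PiE_def extensional_restrict
      intro!: extensionalityI[of _ "tuples G (Suc n)"])

lemma differential_eq:
  assumes f: "f \<in> tuples G (Suc n) \<rightarrow> carrier R"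
  shows "differential G R n f = restrict (D (extend (Suc n) f)) (tuples G (Suc (Suc n)))"
  unfolding differential_def
proof (rule restrict_ext)
  fix xs assume xs: "xs \<in> tuples G (Suc (Suc n))"
  have L: "xs \<in> lists (carrier G)" "length xs = Suc (Suc n)" using xs by (simp_all add: mem_tuples_iff)
  have e: "extend (Suc n) f ys \<in> carrier R" for ys using f by (auto simp: extend_def)
  have del: "take i xs @ drop (Suc i) xs \<in> tuples G (Suc n)" if "i \<le> Suc n" for i
    using that L set_take_subset[of i xs] set_drop_subset[of "Suc i" xs] by (auto simp: mem_tuples_iff)
  have "(\<Oplus>i\<in>{..Suc n}. if even i then f (take i xs @ drop (Suc i) xs)
      else \<ominus> f (take i xs @ drop (Suc i) xs)) =
    (\<Oplus>i\<in>{..<length xs}. if even i then extend (Suc n) f (take i xs @ drop (Suc i) xs)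
      else \<ominus> extend (Suc n) f (take i xs @ drop (Suc i) xs))"
  proof (rule finsum_cong')
    show "(\<lambda>i. if even i then extend (Suc n) f (take i xs @ drop (Suc i) xs)
      else \<ominus> extend (Suc n) f (take i xs @ drop (Suc i) xs)) \<in> {..<length xs} \<rightarrow> carrier R"
      using e by auto
  qed (use del L(2) in \<open>auto simp: extend_def\<close>)
  also have "\<dots> = bd (extend (Suc n) f) xs" by (rule finsum_alternating_eq_bd[OF L(1) e])
  finally show "(\<Oplus>i\<in>{..Suc n}. if even i then f (take i xs @ drop (Suc i) xs)
      else \<ominus> f (take i xs @ drop (Suc i) xs)) = D (extend (Suc n) f) xs"
    using L(1) by (simp add: D_def)
qed

lemma exact_0:
  assumes "f \<in> C 0" "D f = \<zero>\<^bsub>chain_group\<^esub>"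
  shows "f = \<zero>\<^bsub>chain_group\<^esub>"
proof
  fix xs
  have "D f [\<one>\<^bsub>G\<^esub>] = \<zero>" unfolding assms(2) chain_group_simps ..
  then have "f [] = \<zero>" using C_D(1)[OF assms(1), of "[]"] by (simp add: D_def minus_eq)
  then show "f xs = \<zero>\<^bsub>chain_group\<^esub> xs"
    using C_D(2)[OF assms(1), of xs] by (cases "xs = []") (auto simp: chain_group_simps mem_tuples_iff)
qed

lemma C_0_iff: "f \<in> C 0 \<longleftrightarrow> (\<exists>s\<in>Inv. f = (\<lambda>xs. if xs = [] then s else \<zero>))"
proof
  assume f: "f \<in> C 0"
  have "f [] \<in> Inv"
    using C_D(1)[OF f, of "[]"] C_D(3)[OF f, of _ "[]"] by (auto simp: mem_Inv_iff mem_tuples_iff)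
  moreover have "f = (\<lambda>xs. if xs = [] then f [] else \<zero>)"
    using C_D(2)[OF f] by (auto simp: mem_tuples_iff)
  ultimately show "\<exists>s\<in>Inv. f = (\<lambda>xs. if xs = [] then s else \<zero>)" by blast
next
  assume "\<exists>s\<in>Inv. f = (\<lambda>xs. if xs = [] then s else \<zero>)"
  then show "f \<in> C 0" by (auto simp: C_def mem_tuples_iff mem_Inv_iff split: if_splits)
qed

text \<open>Evaluation at the pairs of the unit and \<open>x\<close> shows that a cocycle in place 1
  is constant, and equivariance makes the constant invariant. So place 1 is exact for every
  action.\<close>

lemma exact_1:
  assumes f: "f \<in> C (Suc 0)" and Df: "D f = \<zero>\<^bsub>chain_group\<^esub>"
  shows "f \<in> D ` C 0"
proof -
  define s where "s = f [\<one>\<^bsub>G\<^esub>]"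
  have sc: "s \<in> carrier R" using C_D(1)[OF f] by (simp add: s_def)
  have fx: "f [x] = s" if x: "x \<in> carrier G" for x
  proof -
    have "D f [\<one>\<^bsub>G\<^esub>, x] = \<zero>" unfolding Df chain_group_simps ..
    then have "f [x] \<ominus> (s \<ominus> \<zero>) = \<zero>" using x by (simp add: D_def s_def)
    moreover have "s \<ominus> \<zero> = s" using sc by (simp add: minus_eq)
    ultimately show ?thesis using C_D(1)[OF f, of "[x]"] sc by (simp only: r_right_minus_eq)
  qed
  have "s \<in> Inv"
    unfolding mem_Inv_iff
  proof (intro conjI ballI sc)
    fix g assume g: "g \<in> carrier G"
    have "f (map (\<lambda>x. g \<otimes>\<^bsub>G\<^esub> x) [\<one>\<^bsub>G\<^esub>]) = \<phi> g s"
      unfolding s_def by (rule C_D(3)[OF f g]) (simp add: mem_tuples_iff)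
    then show "\<phi> g s = s" using fx[of g] g by simp
  qed
  then have e: "(\<lambda>xs. if xs = [] then s else \<zero>) \<in> C 0" using C_0_iff by blast
  have "f = D (\<lambda>xs. if xs = [] then s else \<zero>)"
  proof
    fix xs
    show "f xs = D (\<lambda>xs. if xs = [] then s else \<zero>) xs"
    proof (cases "xs \<in> tuples G (Suc 0)")
      case True
      then obtain x where "xs = [x]" "x \<in> carrier G" by (auto simp: mem_tuples_iff length_Suc_conv)
      then show ?thesis using fx sc by (simp add: D_def minus_eq)
    qed (use C_D(2)[OF f] C_D(2)[OF D_closed[OF e]] in auto)
  qed
  then show ?thesis using e by blast
qed

lemma D_mem_iff_differential:
  assumes f: "f \<in> cochains G R \<phi> (Suc n)"
  shows "f \<in> differential G R n ` cochains G R \<phi> n \<longleftrightarrow> extend (Suc (Suc n)) f \<in> D ` C (Suc n)"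
proof
  assume "f \<in> differential G R n ` cochains G R \<phi> n"
  then obtain b where b: "b \<in> cochains G R \<phi> n" "f = differential G R n b" by blast
  have "f = restrict (D (extend (Suc n) b)) (tuples G (Suc (Suc n)))"
    unfolding b(2) by (rule differential_eq) (use b(1) in \<open>auto simp: cochains_def\<close>)
  then have "extend (Suc (Suc n)) f = D (extend (Suc n) b)"
    using extend_restrict[OF D_closed[OF extend_mem_C[OF b(1)]]] by simp
  then show "extend (Suc (Suc n)) f \<in> D ` C (Suc n)" using extend_mem_C[OF b(1)] by blast
next
  assume "extend (Suc (Suc n)) f \<in> D ` C (Suc n)"
  then obtain b where b: "b \<in> C (Suc n)" "extend (Suc (Suc n)) f = D b" by blast
  let ?b = "restrict b (tuples G (Suc n))"
  have "differential G R n ?b = restrict (D b) (tuples G (Suc (Suc n)))"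
    using differential_eq[of ?b n] extend_restrict[OF b(1)] C_D(1)[OF b(1)] by auto
  then have "f = differential G R n ?b" using restrict_extend[OF f] b(2) by simp
  then show "f \<in> differential G R n ` cochains G R \<phi> n" using restrict_mem_cochains[OF b(1)] by blast
qed

lemma cocycle_iff_D:
  assumes f: "f \<in> cochains G R \<phi> n"
  shows "differential G R n f = zero_cochain G R (Suc n) \<longleftrightarrow> D (extend (Suc n) f) = \<zero>\<^bsub>chain_group\<^esub>"
proof -
  have "differential G R n f = restrict (D (extend (Suc n) f)) (tuples G (Suc (Suc n)))"
    by (rule differential_eq) (use f in \<open>auto simp: cochains_def\<close>)
  moreover have "restrict h (tuples G m) = (\<lambda>xs\<in>tuples G m. \<zero>) \<longleftrightarrow> h = (\<lambda>xs. \<zero>)" if "h \<in> C m" for h m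
  proof
    assume eq: "restrict h (tuples G m) = (\<lambda>xs\<in>tuples G m. \<zero>)"
    show "h = (\<lambda>xs. \<zero>)"
    proof
      fix xs show "h xs = \<zero>" using fun_cong[OF eq, of xs] C_D(2)[OF that, of xs] by (cases "xs \<in> tuples G m") auto
    qed
  qed simp
  ultimately show ?thesis
    using D_closed[OF extend_mem_C[OF f]] by (simp add: zero_cochain_def chain_group_simps)
qed

text \<open>A cocycle that becomes a coboundary on a subgroup \<open>H\<close> is annihilated by the transfer of
  every \<open>H\<close>-invariant: push the primitive \<open>b\<close> forward to \<open>G\<close> along an \<open>H\<close>-equivariant map
  \<open>G \<rightarrow> H\<close>, correct it by the prism homotopy, and sum over the cosets of \<open>H\<close>.\<close>

lemma transfer_annihilates:
  assumes H: "subgroup H G" and x: "x \<in> fixed H"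
    and f: "f \<in> C (Suc n)" "D f = \<zero>\<^bsub>chain_group\<^esub>"
    and b: "\<And>xs. xs \<in> lists H \<Longrightarrow> b xs \<in> carrier R"
      "\<And>h xs. \<lbrakk>h \<in> H; xs \<in> lists H; length xs = n\<rbrakk> \<Longrightarrow> b (map (\<lambda>y. h \<otimes>\<^bsub>G\<^esub> y) xs) = \<phi> h (b xs)"
      "\<And>xs. \<lbrakk>xs \<in> lists H; length xs = Suc n\<rbrakk> \<Longrightarrow> f xs = bd b xs"
  shows "(\<Oplus>t\<in>transversal H. \<phi> t x) \<in> Inv"
    and "scale (\<Oplus>t\<in>transversal H. \<phi> t x) f \<in> D ` C n"
proof -
  interpret H: subgroup H G by (rule H)
  define T where "T = transversal H"
  define s where "s = (\<Oplus>t\<in>T. \<phi> t x)"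
  have xc: "x \<in> carrier R" using x by (simp add: fixed_def)
  have xh: "\<phi> (g \<otimes>\<^bsub>G\<^esub> h) x = \<phi> g x" if "g \<in> carrier G" "h \<in> H" for g h
    using that x H.mem_carrier by (simp add: fixed_def act_comp)
  have T: "t \<in> carrier G" if "t \<in> T" for t using that transversal_carrier[OF H] by (simp add: T_def)
  have finT: "finite T" by (simp add: T_def transversal_finite)
  have sc: "s \<in> carrier R" unfolding s_def using T xc by (auto intro!: finsum_closed)
  have act_sum: "\<phi> g (\<Oplus>t\<in>T. F t) = (\<Oplus>t\<in>T. \<phi> g (F t))"
    if "g \<in> carrier G" "\<And>t. t \<in> T \<Longrightarrow> F t \<in> carrier R" for g F
    using ring_hom_cring.hom_finsum[OF act_ring_hom_cring[OF that(1)], of F T] that(2)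
    by (simp add: o_def Pi_def)
  show "s \<in> Inv"
    unfolding mem_Inv_iff
  proof (intro conjI ballI sc)
    fix g assume g: "g \<in> carrier G"
    have "\<phi> g s = (\<Oplus>t\<in>T. \<phi> (g \<otimes>\<^bsub>G\<^esub> t) x)"
      unfolding s_def using act_sum[OF g, of "\<lambda>t. \<phi> t x"] T xc g
      by (simp add: act_comp cong: finsum_cong)
    also have "\<dots> = s" unfolding s_def T_def
      by (rule finsum_transversal_shift[OF H g]) (use xh xc in auto)
    finally show "\<phi> g s = s" .
  qed
  \<comment> \<open>The representative of the left coset of the inverse of \<open>g\<close> does not
    change when \<open>g\<close> is multiplied by \<open>H\<close> from the left; hence
    \<open>p\<close> is left \<open>H\<close>-equivariant, and its values lie in
    \<open>H\<close>.\<close>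
  define p where "p g = g \<otimes>\<^bsub>G\<^esub> coset_rep H (inv\<^bsub>G\<^esub> g)" for g
  have p: "p g \<in> H" if g: "g \<in> carrier G" for g
  proof -
    obtain h where h: "h \<in> H" "coset_rep H (inv\<^bsub>G\<^esub> g) = inv\<^bsub>G\<^esub> g \<otimes>\<^bsub>G\<^esub> h"
      using coset_rep_eq[OF H G.inv_closed[OF g]] by blast
    then have "p g = h" using g H.mem_carrier by (simp add: p_def flip: G.m_assoc)
    then show ?thesis using h(1) by simp
  qed
  have pc: "p g \<in> carrier G" if "g \<in> carrier G" for g using p[OF that] by (rule H.mem_carrier)
  have p_mult: "p (h \<otimes>\<^bsub>G\<^esub> g) = h \<otimes>\<^bsub>G\<^esub> p g" if h: "h \<in> H" and g: "g \<in> carrier G" for h g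
  proof -
    have hc: "h \<in> carrier G" by (rule H.mem_carrier[OF h])
    have "coset_rep H (inv\<^bsub>G\<^esub> (h \<otimes>\<^bsub>G\<^esub> g)) = coset_rep H (inv\<^bsub>G\<^esub> g)"
      using coset_rep_mult[OF H G.inv_closed[OF g] H.m_inv_closed[OF h]] hc g
      by (simp add: G.inv_mult_group)
    then show ?thesis
      using hc g coset_rep_closed[OF H G.inv_closed[OF g]] by (simp add: p_def G.m_assoc)
  qed
  have mapp: "map p xs \<in> lists H" if "xs \<in> lists (carrier G)" for xs using that p by auto
  have fc: "f xs \<in> carrier R" for xs by (rule C_D(1)[OF f(1)])
  \<comment> \<open>The pullback of \<open>b\<close> along \<open>p\<close> is a primitive of the
    pullback of \<open>f\<close>, and the prism term has boundary the pullback of \<open>f\<close>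
    minus \<open>f\<close>. So \<open>c\<close> is a primitive of \<open>f\<close> on all tuples of
    \<open>G\<close>, but equivariant only under \<open>H\<close>.\<close>
  define c where "c xs = b (map p xs) \<ominus> prism p f xs" for xs
  have prism_c: "prism p f xs \<in> carrier R" if "xs \<in> lists (carrier G)" for xs
    by (rule prism_closed[OF that pc fc])
  have cc: "c xs \<in> carrier R" if "xs \<in> lists (carrier G)" for xs
    unfolding c_def using b(1)[OF mapp[OF that]] prism_c[OF that] by simp
  have bd_f: "bd f xs = \<zero>" if "xs \<in> lists (carrier G)" for xs
    using fun_cong[OF f(2), of xs] that by (simp add: D_def chain_group_simps)
  have bd_c: "bd c xs = f xs" if xs: "xs \<in> tuples G (Suc n)" for xs
  proof -
    have L: "xs \<in> lists (carrier G)" "length xs = Suc n" using xs by (simp_all add: mem_tuples_iff)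
    have "prism p (bd f) xs = \<zero>" by (rule prism_eq_zero[OF L(1) pc bd_f])
    moreover have "bd (prism p f) xs \<oplus> prism p (bd f) xs = f (map p xs) \<ominus> f xs"
      by (rule prism_homotopy[OF L(1) pc fc])
    moreover have "bd (prism p f) xs \<in> carrier R" by (rule bd_closed[OF L(1) prism_c])
    ultimately have K: "bd (prism p f) xs = f (map p xs) \<ominus> f xs" by simp
    have "bd c xs = bd (\<lambda>ys. b (map p ys)) xs \<ominus> bd (prism p f) xs"
      unfolding c_def[abs_def] by (rule bd_minus[OF L(1) b(1)[OF mapp] prism_c])
    also have "bd (\<lambda>ys. b (map p ys)) xs = f (map p xs)"
      using b(3)[OF mapp[OF L(1)]] L(2) by (simp add: bd_map)
    finally show ?thesis unfolding K using minus_minus_cancel[OF fc fc] by simp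
  qed
  have c_act: "c (map (\<lambda>y. h \<otimes>\<^bsub>G\<^esub> y) xs) = \<phi> h (c xs)"
    if h: "h \<in> H" and xs: "xs \<in> tuples G n" for h xs
  proof -
    have hc: "h \<in> carrier G" by (rule H.mem_carrier[OF h])
    have L: "xs \<in> lists (carrier G)" "length xs = n" using xs by (simp_all add: mem_tuples_iff)
    have mm: "map p (map (\<lambda>y. h \<otimes>\<^bsub>G\<^esub> y) ys) = map (\<lambda>y. h \<otimes>\<^bsub>G\<^esub> y) (map p ys)"
      if "ys \<in> lists (carrier G)" for ys
      using that p_mult[OF h] by (induction ys) auto
    \<comment> \<open>Two functions are needed for the induction, since the recursion of
      \<open>prism\<close> prefixes \<open>h x\<close> on the left and \<open>x\<close> on the
      right.\<close>
    have "prism p g (map (\<lambda>y. h \<otimes>\<^bsub>G\<^esub> y) xs) = \<phi> h (prism p g' xs)"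
      if "xs \<in> lists (carrier G)"
        "\<And>ys. ys \<in> lists (carrier G) \<Longrightarrow> length ys = Suc (length xs) \<Longrightarrow> g (map (\<lambda>y. h \<otimes>\<^bsub>G\<^esub> y) ys) = \<phi> h (g' ys)"
        "\<And>ys. ys \<in> lists (carrier G) \<Longrightarrow> g' ys \<in> carrier R" for g g' :: "'c list \<Rightarrow> 'a" and xs
      using that
    proof (induction xs arbitrary: g g')
      case Nil
      then show ?case by (simp add: act_zero hc)
    next
      case (Cons x xs)
      have x: "x \<in> carrier G" "xs \<in> lists (carrier G)" using Cons.hyps Cons.prems by auto
      have 1: "prism p (\<lambda>ys. g ((h \<otimes>\<^bsub>G\<^esub> x) # ys)) (map (\<lambda>y. h \<otimes>\<^bsub>G\<^esub> y) xs) =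
          \<phi> h (prism p (\<lambda>ys. g' (x # ys)) xs)"
      proof (rule Cons.IH)
        fix ys assume ys: "ys \<in> lists (carrier G)"
        show "g' (x # ys) \<in> carrier R" using Cons.prems(2)[of "x # ys"] x ys by simp
        assume "length ys = Suc (length xs)"
        then show "g ((h \<otimes>\<^bsub>G\<^esub> x) # map (\<lambda>y. h \<otimes>\<^bsub>G\<^esub> y) ys) = \<phi> h (g' (x # ys))"
          using Cons.prems(1)[of "x # ys"] x ys by simp
      qed
      have z: "x # p x # map p xs \<in> lists (carrier G)" using x pc by auto
      have 2: "g (map (\<lambda>y. h \<otimes>\<^bsub>G\<^esub> y) (x # p x # map p xs)) = \<phi> h (g' (x # p x # map p xs))"
        by (rule Cons.prems(1)[OF z]) simp
      have 3: "prism p (\<lambda>ys. g' (x # ys)) xs \<in> carrier R"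
        by (rule prism_closed[OF x(2) pc]) (use Cons.prems(2) x in auto)
      show ?case
        using 2 unfolding list.map prism.simps act_minus[OF hc Cons.prems(2)[OF z] 3]
          mm[OF x(2), unfolded list.map] p_mult[OF h x(1)] 1 by (simp only:)
    qed
    from this[OF L(1), of f f] have "prism p f (map (\<lambda>y. h \<otimes>\<^bsub>G\<^esub> y) xs) = \<phi> h (prism p f xs)"
      using C_D(3)[OF f(1) hc] L(2) fc by (simp add: mem_tuples_iff)
    moreover have "b (map p (map (\<lambda>y. h \<otimes>\<^bsub>G\<^esub> y) xs)) = \<phi> h (b (map p xs))"
      unfolding mm[OF L(1)] by (rule b(2)[OF h mapp[OF L(1)]]) (simp add: L(2))
    ultimately show ?thesis
      unfolding c_def using act_minus[OF hc b(1)[OF mapp[OF L(1)]] prism_c[OF L(1)]] by simp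
  qed
  \<comment> \<open>\<open>F t\<close> is the conjugate by \<open>t\<close> of the
    \<open>H\<close>-equivariant cochain \<open>x c\<close>, and depends only on the coset of
    \<open>t\<close>. The sum \<open>e\<close> is the corestriction of \<open>x c\<close>, and
    \<open>D e = s f\<close> is the projection formula.\<close>
  define F where "F t xs = \<phi> t (x \<otimes> c (map (\<lambda>y. inv\<^bsub>G\<^esub> t \<otimes>\<^bsub>G\<^esub> y) xs))" for t xs
  define e where "e xs = (if xs \<in> tuples G n then (\<Oplus>t\<in>T. F t xs) else \<zero>)" for xs
  have shift: "map (\<lambda>y. g \<otimes>\<^bsub>G\<^esub> y) xs \<in> lists (carrier G)" if "xs \<in> lists (carrier G)" "g \<in> carrier G" for xs g
    using that by auto
  have Fc: "F t xs \<in> carrier R" if "t \<in> carrier G" "xs \<in> lists (carrier G)" for t xs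
    unfolding F_def using that xc cc[OF shift[OF that(2) G.inv_closed[OF that(1)]]] by simp
  have e: "e \<in> C n"
  proof (rule C_I)
    show "e xs \<in> carrier R" for xs
      unfolding e_def using Fc T by (auto simp: mem_tuples_iff intro!: finsum_closed)
    fix g xs assume g: "g \<in> carrier G" and xs: "xs \<in> tuples G n"
    have L: "xs \<in> lists (carrier G)" "length xs = n" using xs by (simp_all add: mem_tuples_iff)
    define gxs where "gxs = map (\<lambda>y. g \<otimes>\<^bsub>G\<^esub> y) xs"
    have gxs: "gxs \<in> tuples G n" unfolding gxs_def by (rule tuples_map[OF xs g])
    have gL: "gxs \<in> lists (carrier G)" using gxs by (simp add: mem_tuples_iff)
    have "F (t \<otimes>\<^bsub>G\<^esub> h) gxs = F t gxs" if t: "t \<in> carrier G" and h: "h \<in> H" for t h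
    proof -
      have hc: "h \<in> carrier G" by (rule H.mem_carrier[OF h])
      define ys where "ys = map (\<lambda>y. inv\<^bsub>G\<^esub> t \<otimes>\<^bsub>G\<^esub> y) gxs"
      have ys: "ys \<in> tuples G n" unfolding ys_def by (rule tuples_map[OF gxs G.inv_closed[OF t]])
      have yL: "ys \<in> lists (carrier G)" using ys by (simp add: mem_tuples_iff)
      have "map (\<lambda>y. inv\<^bsub>G\<^esub> (t \<otimes>\<^bsub>G\<^esub> h) \<otimes>\<^bsub>G\<^esub> y) gxs = map (\<lambda>y. inv\<^bsub>G\<^esub> h \<otimes>\<^bsub>G\<^esub> y) ys"
        unfolding ys_def map_map o_def
        by (rule map_cong) (use t hc gL in \<open>auto simp: G.inv_mult_group G.m_assoc\<close>)
      then have "F (t \<otimes>\<^bsub>G\<^esub> h) gxs = \<phi> (t \<otimes>\<^bsub>G\<^esub> h) (x \<otimes> \<phi> (inv\<^bsub>G\<^esub> h) (c ys))"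
        unfolding F_def using c_act[OF H.m_inv_closed[OF h] ys] by simp
      also have "\<dots> = \<phi> t (\<phi> h (x \<otimes> \<phi> (inv\<^bsub>G\<^esub> h) (c ys)))"
        by (rule act_comp[OF t hc]) (use xc cc[OF yL] hc in simp)
      also have "\<phi> h (x \<otimes> \<phi> (inv\<^bsub>G\<^esub> h) (c ys)) = \<phi> h x \<otimes> c ys"
        using act_mult[OF hc xc, of "\<phi> (inv\<^bsub>G\<^esub> h) (c ys)"] act_act_inv[OF hc cc[OF yL]] hc cc[OF yL] by simp
      also have "\<phi> h x = x" using x h by (simp add: fixed_def)
      finally show ?thesis by (simp add: F_def ys_def)
    qed
    then have "e gxs = (\<Oplus>t\<in>T. F (g \<otimes>\<^bsub>G\<^esub> t) gxs)"
      unfolding e_def T_def using finsum_transversal_shift[OF H g, of "\<lambda>t. F t gxs"] Fc[OF _ gL] gxs by simp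
    also have "\<dots> = (\<Oplus>t\<in>T. \<phi> g (F t xs))"
    proof (rule finsum_cong')
      fix t assume "t \<in> T"
      then have t: "t \<in> carrier G" by (rule T)
      have "map (\<lambda>y. inv\<^bsub>G\<^esub> (g \<otimes>\<^bsub>G\<^esub> t) \<otimes>\<^bsub>G\<^esub> y) gxs = map (\<lambda>y. inv\<^bsub>G\<^esub> t \<otimes>\<^bsub>G\<^esub> y) xs"
        unfolding gxs_def map_map o_def
      proof (rule map_cong)
        fix y assume "y \<in> set xs"
        then have y: "y \<in> carrier G" using L(1) by auto
        have "inv\<^bsub>G\<^esub> g \<otimes>\<^bsub>G\<^esub> (g \<otimes>\<^bsub>G\<^esub> y) = y" using g y by (simp flip: G.m_assoc)
        then show "inv\<^bsub>G\<^esub> (g \<otimes>\<^bsub>G\<^esub> t) \<otimes>\<^bsub>G\<^esub> (g \<otimes>\<^bsub>G\<^esub> y) = inv\<^bsub>G\<^esub> t \<otimes>\<^bsub>G\<^esub> y"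
          using g t y by (simp add: G.inv_mult_group G.m_assoc)
      qed simp
      then show "F (g \<otimes>\<^bsub>G\<^esub> t) gxs = \<phi> g (F t xs)"
        unfolding F_def using act_comp[OF g t] xc cc[OF shift[OF L(1) G.inv_closed[OF t]]] by simp
    qed (use Fc[OF T L(1)] g in auto)
    also have "\<dots> = \<phi> g (e xs)" unfolding e_def using act_sum[OF g Fc[OF T L(1)]] xs by simp
    finally show "e (map (\<lambda>y. g \<otimes>\<^bsub>G\<^esub> y) xs) = \<phi> g (e xs)" by (simp add: gxs_def)
  qed (simp add: e_def)
  have "D e xs = scale s f xs" for xs
  proof (cases "xs \<in> tuples G (Suc n)")
    case True
    then have L: "xs \<in> lists (carrier G)" "length xs = Suc n" by (simp_all add: mem_tuples_iff)
    have "bd e xs = bd (\<lambda>ys. \<Oplus>t\<in>T. F t ys) xs"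
      by (rule bd_cong[OF L(1)]) (use L(2) in \<open>simp add: e_def mem_tuples_iff\<close>)
    also have "\<dots> = (\<Oplus>t\<in>T. bd (F t) xs)" by (rule bd_finsum[OF finT L(1)]) (rule Fc[OF T])
    also have "\<dots> = (\<Oplus>t\<in>T. \<phi> t x \<otimes> f xs)"
    proof (rule finsum_cong')
      fix t assume "t \<in> T"
      then have t: "t \<in> carrier G" by (rule T)
      define m where "m = map (\<lambda>y. inv\<^bsub>G\<^esub> t \<otimes>\<^bsub>G\<^esub> y)"
      have m: "m ys \<in> lists (carrier G)" if "ys \<in> lists (carrier G)" for ys
        unfolding m_def by (rule shift[OF that G.inv_closed[OF t]])
      have "bd (F t) xs = \<phi> t (x \<otimes> bd (\<lambda>ys. c (m ys)) xs)"
        unfolding F_def[abs_def] m_def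
        by (rule bd_hom[OF _ _ _ L(1)])
          (use t xc cc[OF m] in \<open>auto simp: m_def act_mult act_minus act_zero minus_eq r_distr r_minus act_add act_uminus\<close>)
      also have "bd (\<lambda>ys. c (m ys)) xs = bd c (m xs)" unfolding m_def by (rule bd_map[symmetric])
      also have "\<dots> = f (m xs)" by (rule bd_c) (use m[OF L(1)] L(2) in \<open>simp add: mem_tuples_iff m_def\<close>)
      also have "\<dots> = \<phi> (inv\<^bsub>G\<^esub> t) (f xs)" unfolding m_def by (rule C_D(3)[OF f(1) G.inv_closed[OF t] True])
      finally show "bd (F t) xs = \<phi> t x \<otimes> f xs" using t xc fc by (simp add: act_mult act_act_inv)
    qed (use T xc fc in auto)
    also have "\<dots> = s \<otimes> f xs" unfolding s_def using finT T xc fc by (subst finsum_ldistr) auto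
    finally show ?thesis using L(1) by (simp add: D_def scale_def)
  next
    case False
    then show ?thesis using C_D(2)[OF D_closed[OF e] False] C_D(2)[OF f(1) False] sc by (simp add: scale_def)
  qed
  then show "scale s f \<in> D ` C n" using e by (intro image_eqI[of _ _ e]) auto
qed

end

section \<open>Injectivity of the restriction\<close>

primrec adjoin_seq :: "('a, 'b) ring_scheme \<Rightarrow> (nat \<Rightarrow> 'a) \<Rightarrow> nat \<Rightarrow> 'a set" where
  "adjoin_seq R z 0 = {\<zero>\<^bsub>R\<^esub>}"
| "adjoin_seq R z (Suc j) = ideal_adjoin R (adjoin_seq R z j) (z j)"

context cring
begin

lemma adjoin_seq_ideal: "(\<And>i. z i \<in> carrier R) \<Longrightarrow> ideal (adjoin_seq R z j) R"
  by (induction j) (simp_all add: zeroideal ideal_adjoin_ideal)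

lemma adjoin_seq_nth:
  "\<lbrakk>j \<le> length xs; \<And>i. i < length xs \<Longrightarrow> z i = xs ! i\<rbrakk> \<Longrightarrow>
     adjoin_seq R z j = ideal_adjoin_list {\<zero>} (take j xs)"
  by (induction j) (simp_all add: take_Suc_conv_app_nth)

lemma regular_seq_mod_nth:
  assumes "regular_seq_mod K xs" "i < length xs"
  shows "regular_mod R (ideal_adjoin_list K (take i xs)) (xs ! i)"
proof -
  have "regular_seq_mod K (take i xs @ xs ! i # drop (Suc i) xs)"
    using assms id_take_nth_drop by metis
  then show ?thesis by (simp add: regular_seq_mod_append)
qed

end

context ring_action
begin

primrec filtration :: "(nat \<Rightarrow> 'a) \<Rightarrow> nat \<Rightarrow> nat \<Rightarrow> ('c list \<Rightarrow> 'a) set" where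
  "filtration z 0 n = {\<zero>\<^bsub>chain_group\<^esub>}"
| "filtration z (Suc j) n =
     {f \<oplus>\<^bsub>chain_group\<^esub> scale (z j) g | f g. f \<in> filtration z j n \<and> g \<in> C n}"

lemma filtration_values:
  "\<lbrakk>f \<in> filtration z j n\<rbrakk> \<Longrightarrow> f xs \<in> adjoin_seq R z j"
proof (induction j arbitrary: f)
  case (Suc j)
  then obtain a b where ab: "f = a \<oplus>\<^bsub>chain_group\<^esub> scale (z j) b" "a \<in> filtration z j n" "b \<in> C n"
    by auto
  have "f xs = a xs \<oplus> z j \<otimes> b xs" by (simp add: ab(1) chain_group_simps scale_def)
  then show ?case using ideal_adjoinI[OF _ Suc.IH[OF ab(2)] C_D(1)[OF ab(3)]] by simp
qed (simp add: chain_group_simps)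

lemma act_adjoin_seq:
  assumes "g \<in> carrier G" "\<And>i. z i \<in> Inv"
  shows "r \<in> adjoin_seq R z j \<Longrightarrow> \<phi> g r \<in> adjoin_seq R z j"
proof (induction j arbitrary: r)
  case 0
  then show ?case using assms(1) by (simp add: act_zero)
next
  case (Suc j)
  then obtain a b where ab: "r = a \<oplus> z j \<otimes> b" "a \<in> adjoin_seq R z j" "b \<in> carrier R"
    using ideal_adjoinE[of r] by (metis adjoin_seq.simps(2))
  have zc: "z i \<in> carrier R" for i using assms(2) Inv_carrier by blast
  have "a \<in> carrier R" using ideal.Icarr[OF adjoin_seq_ideal ab(2)] zc by blast
  moreover have "\<phi> g (z j) = z j" using assms by (simp add: mem_Inv_iff)
  ultimately have "\<phi> g r = \<phi> g a \<oplus> z j \<otimes> \<phi> g b"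
    using assms(1) ab(3) zc by (simp add: ab(1) act_add act_mult)
  then show ?case using ideal_adjoinI[OF _ Suc.IH[OF ab(2)]] assms(1) ab(3) by simp
qed

text \<open>Rebuilds an equivariant function from its values \<open>u ys\<close> at the tuples
  starting with the unit. These values can be prescribed freely, which identifies
  \<open>C (Suc m)\<close> with a power of \<open>R\<close>.\<close>

definition induced :: "nat \<Rightarrow> ('c list \<Rightarrow> 'a) \<Rightarrow> 'c list \<Rightarrow> 'a" where
  "induced m u xs = (if xs \<in> tuples G (Suc m)
     then \<phi> (hd xs) (u (map (\<lambda>y. inv\<^bsub>G\<^esub> (hd xs) \<otimes>\<^bsub>G\<^esub> y) (tl xs))) else \<zero>)"

lemma tuples_SucE:
  assumes "xs \<in> tuples G (Suc m)"
  obtains g ys where "xs = g # ys" "g \<in> carrier G" "ys \<in> tuples G m"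
  using assms by (cases xs) (auto simp: tuples_def)

lemma induced_C:
  assumes u: "\<And>ys. ys \<in> tuples G m \<Longrightarrow> u ys \<in> carrier R"
  shows "induced m u \<in> C (Suc m)"
proof (rule C_I)
  show "induced m u xs \<in> carrier R" for xs
  proof (cases "xs \<in> tuples G (Suc m)")
    case True
    then show ?thesis
      by (rule tuples_SucE) (use True u tuples_map in \<open>auto simp: induced_def\<close>)
  qed (simp add: induced_def)
  fix h xs assume h: "h \<in> carrier G" and xs: "xs \<in> tuples G (Suc m)"
  obtain g ys where g: "xs = g # ys" "g \<in> carrier G" "ys \<in> tuples G m" using xs by (rule tuples_SucE)
  have "map (\<lambda>y. inv\<^bsub>G\<^esub> (h \<otimes>\<^bsub>G\<^esub> g) \<otimes>\<^bsub>G\<^esub> y) (map (\<lambda>y. h \<otimes>\<^bsub>G\<^esub> y) ys) = map (\<lambda>y. inv\<^bsub>G\<^esub> g \<otimes>\<^bsub>G\<^esub> y) ys"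
    unfolding map_map o_def
  proof (rule map_cong)
    fix y assume "y \<in> set ys"
    then have y: "y \<in> carrier G" using g(3) by (auto simp: tuples_def)
    have "inv\<^bsub>G\<^esub> h \<otimes>\<^bsub>G\<^esub> (h \<otimes>\<^bsub>G\<^esub> y) = y" using h y by (simp flip: G.m_assoc)
    then show "inv\<^bsub>G\<^esub> (h \<otimes>\<^bsub>G\<^esub> g) \<otimes>\<^bsub>G\<^esub> (h \<otimes>\<^bsub>G\<^esub> y) = inv\<^bsub>G\<^esub> g \<otimes>\<^bsub>G\<^esub> y"
      using h g y by (simp add: G.inv_mult_group G.m_assoc)
  qed simp
  then show "induced m u (map (\<lambda>x. h \<otimes>\<^bsub>G\<^esub> x) xs) = \<phi> h (induced m u xs)"
    using tuples_map[OF xs h] xs act_comp[OF h g(2) u[OF tuples_map[OF g(3) G.inv_closed[OF g(2)]]]]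
    by (simp add: induced_def g(1) del: map_map)
qed (simp add: induced_def)

lemma C_eq_induced:
  assumes f: "f \<in> C (Suc m)"
  shows "f = induced m (\<lambda>ys. f (\<one>\<^bsub>G\<^esub> # ys))"
proof
  fix xs
  show "f xs = induced m (\<lambda>ys. f (\<one>\<^bsub>G\<^esub> # ys)) xs"
  proof (cases "xs \<in> tuples G (Suc m)")
    case True
    then obtain g ys where g: "xs = g # ys" "g \<in> carrier G" "ys \<in> tuples G m" by (rule tuples_SucE)
    define zs where "zs = \<one>\<^bsub>G\<^esub> # map (\<lambda>y. inv\<^bsub>G\<^esub> g \<otimes>\<^bsub>G\<^esub> y) ys"
    have zs: "zs \<in> tuples G (Suc m)" using g by (auto simp: zs_def tuples_def)
    have "map (\<lambda>y. g \<otimes>\<^bsub>G\<^esub> y) (map (\<lambda>y. inv\<^bsub>G\<^esub> g \<otimes>\<^bsub>G\<^esub> y) ys) = ys"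
      unfolding map_map o_def
    proof (rule map_idI)
      fix y assume "y \<in> set ys"
      then have "y \<in> carrier G" using g(3) by (auto simp: tuples_def)
      then show "g \<otimes>\<^bsub>G\<^esub> (inv\<^bsub>G\<^esub> g \<otimes>\<^bsub>G\<^esub> y) = y" using g(2) by (simp flip: G.m_assoc)
    qed
    then have "map (\<lambda>y. g \<otimes>\<^bsub>G\<^esub> y) zs = xs" using g(2) by (simp add: zs_def g(1))
    then have "f xs = \<phi> g (f zs)" using C_D(3)[OF f g(2) zs] by simp
    then show ?thesis using True by (simp add: induced_def g(1) zs_def)
  qed (use C_D(2)[OF f] in \<open>simp add: induced_def\<close>)
qed

text \<open>The values at tuples starting with the unit are decomposed separately, and the parts are
  spread out by \<open>induced\<close>. The ideal is generated by invariants, hence stable under the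
  group, so the spread values stay in it.\<close>

lemma filtration_of_values:
  assumes z: "\<And>i. z i \<in> Inv"
  shows "f \<in> C (Suc m) \<Longrightarrow> (\<And>xs. f xs \<in> adjoin_seq R z j) \<Longrightarrow> f \<in> filtration z j (Suc m)"
proof (induction j arbitrary: f)
  case 0
  then show ?case by (auto simp: chain_group_simps)
next
  case (Suc j)
  have zc: "z i \<in> carrier R" for i using z Inv_carrier by blast
  note I = adjoin_seq_ideal[of z, OF zc]
  have "\<exists>a b. f (\<one>\<^bsub>G\<^esub> # ys) = a \<oplus> z j \<otimes> b \<and> a \<in> adjoin_seq R z j \<and> b \<in> carrier R" for ys
  proof -
    have "f (\<one>\<^bsub>G\<^esub> # ys) \<in> ideal_adjoin R (adjoin_seq R z j) (z j)" using Suc.prems(2) by simp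
    then show ?thesis by (rule ideal_adjoinE) blast
  qed
  then obtain \<kappa> \<rho> where f1: "\<And>ys. f (\<one>\<^bsub>G\<^esub> # ys) = \<kappa> ys \<oplus> z j \<otimes> \<rho> ys"
    and \<kappa>: "\<And>ys. \<kappa> ys \<in> adjoin_seq R z j" and \<rho>: "\<And>ys. \<rho> ys \<in> carrier R" by metis
  have \<kappa>c: "\<kappa> ys \<in> carrier R" for ys using ideal.Icarr[OF I \<kappa>] .
  have "induced m \<kappa> xs \<in> adjoin_seq R z j" for xs
  proof (cases "xs \<in> tuples G (Suc m)")
    case True
    then show ?thesis
      by (rule tuples_SucE) (use True act_adjoin_seq[OF _ z \<kappa>] in \<open>auto simp: induced_def\<close>)
  qed (use ideal_zero_closed[OF I] in \<open>simp add: induced_def\<close>)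
  then have 1: "induced m \<kappa> \<in> filtration z j (Suc m)" by (intro Suc.IH induced_C \<kappa>c)
  have "f = induced m \<kappa> \<oplus>\<^bsub>chain_group\<^esub> scale (z j) (induced m \<rho>)"
  proof
    fix xs
    have "f xs = induced m (\<lambda>ys. f (\<one>\<^bsub>G\<^esub> # ys)) xs" by (rule fun_cong[OF C_eq_induced[OF Suc.prems(1)]])
    also have "\<dots> = induced m \<kappa> xs \<oplus> z j \<otimes> induced m \<rho> xs"
    proof (cases "xs \<in> tuples G (Suc m)")
      case True
      then obtain g ys where g: "xs = g # ys" "g \<in> carrier G" "ys \<in> tuples G m" by (rule tuples_SucE)
      show ?thesis using True g(2) \<kappa>c \<rho> zc z[of j]
        by (simp add: induced_def g(1) f1 act_add act_mult mem_Inv_iff)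
    qed (use zc in \<open>simp add: induced_def\<close>)
    finally show "f xs = (induced m \<kappa> \<oplus>\<^bsub>chain_group\<^esub> scale (z j) (induced m \<rho>)) xs"
      by (simp add: chain_group_simps scale_def)
  qed
  then show ?case using 1 induced_C[of m \<rho>] \<rho> by auto
qed

text \<open>In place 0 the coefficients must be invariant as well. The relevant ideal is therefore
  the one generated in \<open>inv_ring\<close>, which may be smaller than the invariant part of the
  ideal generated in \<open>R\<close>.\<close>

lemma filtration_0_iff:
  assumes S: "cring inv_ring" and z: "\<And>i. z i \<in> Inv"
  shows "f \<in> filtration z j 0 \<longleftrightarrow> f \<in> C 0 \<and> f [] \<in> adjoin_seq inv_ring z j"
proof (induction j arbitrary: f)
  case 0
  have "f = (\<lambda>xs. \<zero>) \<longleftrightarrow> f \<in> C 0 \<and> f [] = \<zero>"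
  proof
    assume "f = (\<lambda>xs. \<zero>)"
    then have "\<exists>s\<in>Inv. f = (\<lambda>xs. if xs = [] then s else \<zero>)"
      using Inv_closed(1) by (intro bexI[of _ \<zero>]) auto
    then show "f \<in> C 0 \<and> f [] = \<zero>" using C_0_iff \<open>f = (\<lambda>xs. \<zero>)\<close> by simp
  next
    assume f: "f \<in> C 0 \<and> f [] = \<zero>"
    then show "f = (\<lambda>xs. \<zero>)" using C_0_iff[of f] by auto
  qed
  then show ?case by (simp add: chain_group_simps)
next
  case (Suc j)
  interpret S: cring inv_ring by (rule S)
  note I = S.adjoin_seq_ideal[of z, OF z]
  show ?case
  proof
    assume "f \<in> filtration z (Suc j) 0"
    then obtain a b where ab: "f = a \<oplus>\<^bsub>chain_group\<^esub> scale (z j) b" "a \<in> filtration z j 0" "b \<in> C 0"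
      by auto
    have a: "a \<in> C 0" "a [] \<in> adjoin_seq inv_ring z j" using Suc.IH ab(2) by auto
    have "f \<in> C 0"
      unfolding ab(1) by (rule additive_subgroup.a_closed[OF C_subgroup a(1) scale_closed[OF z ab(3)]])
    moreover have "b [] \<in> Inv" using ab(3) C_0_iff by auto
    moreover have "f [] = a [] \<oplus> z j \<otimes> b []" by (simp add: ab(1) chain_group_simps scale_def)
    ultimately show "f \<in> C 0 \<and> f [] \<in> adjoin_seq inv_ring z (Suc j)"
      using S.ideal_adjoinI[of "f []" "a []" "z j" "b []"] a(2) by simp
  next
    assume f: "f \<in> C 0 \<and> f [] \<in> adjoin_seq inv_ring z (Suc j)"
    then obtain k r where kr: "f [] = k \<oplus> z j \<otimes> r" "k \<in> adjoin_seq inv_ring z j" "r \<in> Inv"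
      using S.ideal_adjoinE[of "f []"] by (metis adjoin_seq.simps(2) inv_ring_simps(1,2))
    have k: "k \<in> Inv" by (rule ideal.Icarr[OF I kr(2)])
    define a where "a = (\<lambda>xs :: 'c list. if xs = [] then k else \<zero>)"
    define b where "b = (\<lambda>xs :: 'c list. if xs = [] then r else \<zero>)"
    have ab: "a \<in> C 0" "b \<in> C 0" using C_0_iff k kr(3) by (auto simp: a_def b_def)
    have "a \<in> filtration z j 0" using Suc.IH ab(1) kr(2) by (simp add: a_def)
    moreover have "f = a \<oplus>\<^bsub>chain_group\<^esub> scale (z j) b"
    proof
      fix xs
      have "f xs = \<zero>" if "xs \<noteq> []" using C_D(2)[of f 0 xs] f that by (simp add: mem_tuples_iff)
      then show "f xs = (a \<oplus>\<^bsub>chain_group\<^esub> scale (z j) b) xs"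
        using kr(1) Inv_carrier[OF z] by (simp add: chain_group_simps scale_def a_def b_def)
    qed
    ultimately show "f \<in> filtration z (Suc j) 0" using ab(2) by auto
  qed
qed

text \<open>Place 0 is governed by regularity on \<open>inv_ring\<close>, all other places by
  regularity on \<open>R\<close>; this is why one sequence must be regular on both rings.\<close>

lemma filtration_regular:
  assumes S: "cring inv_ring" and z: "\<And>i. z i \<in> Inv"
    and reg: "regular_mod R (adjoin_seq R z j) (z j)" "regular_mod inv_ring (adjoin_seq inv_ring z j) (z j)"
    and f: "f \<in> C n" "scale (z j) f \<in> filtration z j n"
  shows "f \<in> filtration z j n"
proof (cases n)
  case 0
  have "f [] \<in> Inv" using f(1) C_0_iff 0 by auto
  moreover have "z j \<otimes> f [] \<in> adjoin_seq inv_ring z j"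
    using filtration_0_iff[OF S z] f(2) 0 by (simp add: scale_def)
  ultimately have "f [] \<in> adjoin_seq inv_ring z j" using regular_modD[OF reg(2)] by simp
  then show ?thesis using filtration_0_iff[OF S z] f(1) 0 by simp
next
  case (Suc m)
  have "f xs \<in> adjoin_seq R z j" for xs
    using regular_modD[OF reg(1) C_D(1)[OF f(1)]] filtration_values[OF f(2), of xs] by (simp add: scale_def)
  then show ?thesis unfolding Suc by (rule filtration_of_values[OF z f(1)[unfolded Suc]])
qed

text \<open>The next entry has to avoid the associated primes of the first \<open>m\<close> entries
  in both rings, by prime avoidance inside \<open>inv_ring\<close>. Unmixedness bounds their heights
  by \<open>m\<close>, hence by \<open>N\<close>. Primes of \<open>R\<close> are contracted; a prime
  of \<open>inv_ring\<close> is lifted by \<open>lying_over\<close> to a prime of \<open>R\<close>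
  of no larger height, so that \<open>ht\<close> excludes it too.\<close>

lemma exists_common_regular_seq:
  assumes CM: "cohen_macaulay R" "cohen_macaulay inv_ring"
    and a: "ideal a inv_ring"
    and ht: "\<And>P. primeideal P R \<Longrightarrow> prime_height R P \<le> enat N \<Longrightarrow> \<not> a \<subseteq> P"
  shows "m \<le> Suc N \<Longrightarrow> \<exists>xs. length xs = m \<and> set xs \<subseteq> a \<and> regular_seq_mod {\<zero>} xs \<and>
    cring.regular_seq_mod inv_ring {\<zero>} xs"
proof (induction m)
  case 0
  interpret S: cring inv_ring using CM(2) by (simp add: cohen_macaulay_def)
  show ?case by (rule exI[of _ "[]"]) simp
next
  case (Suc m)
  interpret R: noetherian_cring R using CM(1) by (simp add: noetherian_cring_def cohen_macaulay_def)
  interpret S: noetherian_cring inv_ring using CM(2) by (simp add: noetherian_cring_def cohen_macaulay_def)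
  have aI: "a \<subseteq> Inv" using ideal.Icarr[OF a] by blast
  obtain xs where xs: "length xs = m" "set xs \<subseteq> a" "regular_seq_mod {\<zero>} xs" "S.regular_seq_mod {\<zero>} xs"
    using Suc by auto
  define K where "K = ideal_adjoin_list {\<zero>} xs"
  define L where "L = S.ideal_adjoin_list {\<zero>} xs"
  have K: "ideal K R" unfolding K_def
    by (rule ideal_adjoin_list_ideal[OF zeroideal regular_seq_mod_carrier[OF xs(3)]])
  have L: "ideal L inv_ring" unfolding L_def
    using S.ideal_adjoin_list_ideal[OF S.zeroideal S.regular_seq_mod_carrier[OF xs(4)]] by simp
  have "\<exists>x\<in>a. \<forall>p\<in>(\<lambda>P. P \<inter> Inv) ` assoc_primes R K \<union> assoc_primes inv_ring L. x \<notin> p"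
  proof (rule S.prime_avoidance[OF _ a])
    show "finite ((\<lambda>P. P \<inter> Inv) ` assoc_primes R K \<union> assoc_primes inv_ring L)"
      using R.assoc_primes_finite[OF K] S.assoc_primes_finite[OF L] by simp
    fix p assume "p \<in> (\<lambda>P. P \<inter> Inv) ` assoc_primes R K \<union> assoc_primes inv_ring L"
    then consider P where "P \<in> assoc_primes R K" "p = P \<inter> Inv" | "p \<in> assoc_primes inv_ring L" by blast
    then show "primeideal p inv_ring \<and> \<not> a \<subseteq> p"
    proof cases
      case 1
      have P: "primeideal P R" using 1(1) by (simp add: assoc_primes_def)
      have "prime_height R P \<le> enat m"
        using assoc_prime_height_le[OF CM(1) xs(3)] 1(1) xs(1) by (simp add: K_def)
      also have "\<dots> \<le> enat N" using Suc.prems by simp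
      finally show ?thesis using ht[OF P] contract_prime[OF S.is_cring P] 1(2) by blast
    next
      case 2
      have p: "primeideal p inv_ring" using 2 by (simp add: assoc_primes_def)
      obtain P where P: "primeideal P R" "P \<inter> Inv = p"
        using lying_over[OF R.noetherian_ring_axioms S.is_cring p] by blast
      have "prime_height R P \<le> prime_height inv_ring p"
        using prime_height_le_contract[OF S.is_cring P(1)] P(2) by simp
      also have "\<dots> \<le> enat m"
        using assoc_prime_height_le[OF CM(2), of xs p] xs(1,4) 2 by (simp add: L_def)
      also have "\<dots> \<le> enat N" using Suc.prems by simp
      finally show ?thesis using ht[OF P(1)] p P(2) by blast
    qed
  qed
  then obtain x where x': "x \<in> a"
    "\<forall>p\<in>(\<lambda>P. P \<inter> Inv) ` assoc_primes R K \<union> assoc_primes inv_ring L. x \<notin> p" by (rule bexE)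
  have xI: "x \<in> Inv" using x'(1) aI by blast
  have x: "x \<in> a" "\<And>P. P \<in> assoc_primes R K \<Longrightarrow> x \<notin> P"
    "\<And>p. p \<in> assoc_primes inv_ring L \<Longrightarrow> x \<notin> p" using x' xI by auto
  have "regular_mod R K x" by (rule R.regular_modI[OF K Inv_carrier[OF xI] x(2)])
  moreover have "regular_mod inv_ring L x" by (rule S.regular_modI[OF L xI x(3)])
  ultimately show ?case using xs x(1) xI Inv_carrier[OF xI]
    by (intro exI[of _ "xs @ [x]"])
      (simp add: regular_seq_mod_append S.regular_seq_mod_append K_def L_def)
qed

lemma annihilator_ideal:
  assumes S: "cring inv_ring" and f: "f \<in> C (Suc k)" "D f = \<zero>\<^bsub>chain_group\<^esub>"
  shows "ideal {s \<in> Inv. scale s f \<in> D ` C k} inv_ring"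
proof -
  interpret S: cring inv_ring by (rule S)
  show ?thesis
  proof (rule S.idealI_cring)
    have "scale \<zero> f = D (scale \<zero> (\<lambda>xs. \<zero>))"
      using C_D(1)[OF f(1)] by (auto simp: scale_def D_def bd_zero)
    moreover have "scale \<zero> (\<lambda>xs. \<zero>) \<in> C k"
      by (rule scale_closed[OF Inv_closed(1)]) (auto intro!: C_I simp: act_zero)
    ultimately show "{s \<in> Inv. scale s f \<in> D ` C k} \<noteq> {}" using Inv_closed(1) by blast
    fix s assume s: "s \<in> {s \<in> Inv. scale s f \<in> D ` C k}"
    then obtain b where b: "b \<in> C k" "scale s f = D b" by blast
    show "s \<oplus>\<^bsub>inv_ring\<^esub> t \<in> {s \<in> Inv. scale s f \<in> D ` C k}"
      if t: "t \<in> {s \<in> Inv. scale s f \<in> D ` C k}" for t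
    proof -
      obtain c where c: "c \<in> C k" "scale t f = D c" using t by blast
      have "scale (s \<oplus> t) f = scale s f \<oplus>\<^bsub>chain_group\<^esub> scale t f"
        using s t C_D(1)[OF f(1)] Inv_carrier by (auto simp: scale_def chain_group_simps l_distr)
      also have "\<dots> = D (b \<oplus>\<^bsub>chain_group\<^esub> c)" unfolding b(2) c(2) by (rule D_add[OF b(1) c(1), symmetric])
      finally show ?thesis
        using s t Inv_closed(3) additive_subgroup.a_closed[OF C_subgroup b(1) c(1)] by auto
    qed
    show "t \<otimes>\<^bsub>inv_ring\<^esub> s \<in> {s \<in> Inv. scale s f \<in> D ` C k}" if t: "t \<in> Inv" for t
    proof -
      have "scale (t \<otimes> s) f = scale t (scale s f)"
        using s t C_D(1)[OF f(1)] Inv_carrier by (auto simp: scale_def m_assoc)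
      also have "\<dots> = D (scale t b)" unfolding b(2) by (rule scale_D[OF t b(1)])
      finally show ?thesis using s t Inv_closed(4) scale_closed[OF t b(1)] by auto
    qed
  qed auto
qed

section \<open>Cosets of cocycles and restriction to subgroups\<close>

lemma coboundaries_Suc:
  "coboundaries G R \<phi> (Suc n) = {restrict (D b) (tuples G (Suc (Suc n))) | b. b \<in> C (Suc n)}"
proof
  show "coboundaries G R \<phi> (Suc n) \<subseteq> {restrict (D b) (tuples G (Suc (Suc n))) | b. b \<in> C (Suc n)}"
  proof
    fix c assume "c \<in> coboundaries G R \<phi> (Suc n)"
    then obtain b where b: "b \<in> cochains G R \<phi> n" "c = differential G R n b" by auto
    have "c = restrict (D (extend (Suc n) b)) (tuples G (Suc (Suc n)))"
      unfolding b(2) by (rule differential_eq) (use b(1) in \<open>auto simp: cochains_def\<close>)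
    then show "c \<in> {restrict (D b) (tuples G (Suc (Suc n))) | b. b \<in> C (Suc n)}"
      using extend_mem_C[OF b(1)] by blast
  qed
  show "{restrict (D b) (tuples G (Suc (Suc n))) | b. b \<in> C (Suc n)} \<subseteq> coboundaries G R \<phi> (Suc n)"
  proof clarify
    fix b assume b: "b \<in> C (Suc n)"
    have "restrict (D b) (tuples G (Suc (Suc n))) =
        differential G R n (restrict b (tuples G (Suc n)))"
      using differential_eq[of "restrict b (tuples G (Suc n))" n] C_D(1)[OF b] extend_restrict[OF b] by auto
    then show "restrict (D b) (tuples G (Suc (Suc n))) \<in> coboundaries G R \<phi> (Suc n)"
      using restrict_mem_cochains[OF b] by auto
  qed
qed

lemma zero_mem_C: "(\<lambda>xs. \<zero>) \<in> C n"
  using additive_subgroup.zero_closed[OF C_subgroup] by (simp add: chain_group_simps)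

lemma D_zero: "D (\<lambda>xs. \<zero>) = (\<lambda>xs. \<zero>)"
  by (auto simp: D_def bd_zero)

lemma zero_cochain_mem_coboundaries: "zero_cochain G R n \<in> coboundaries G R \<phi> n"
proof (cases n)
  case (Suc m)
  show ?thesis
    unfolding Suc coboundaries_Suc zero_cochain_def
    using zero_mem_C[of "Suc m"] D_zero by (auto intro!: exI[of _ "\<lambda>xs. \<zero>"])
qed simp

lemma cochains_values:
  assumes "c \<in> cochains G R \<phi> n"
  shows "xs \<in> tuples G (Suc n) \<Longrightarrow> c xs \<in> carrier R" "restrict c (tuples G (Suc n)) = c"
  using assms by (auto simp: cochains_def)

lemma mem_coset_iff:
  "c' \<in> B #>\<^bsub>cocycle_group G R \<phi> n\<^esub> c \<longleftrightarrow> (\<exists>\<beta>\<in>B. c' = (\<lambda>xs\<in>tuples G (Suc n). \<beta> xs \<oplus> c xs))"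
  by (auto simp: r_coset_def cocycle_group_def)

lemma mem_coset_self:
  assumes c: "c \<in> cochains G R \<phi> n"
  shows "c \<in> coboundaries G R \<phi> n #>\<^bsub>cocycle_group G R \<phi> n\<^esub> c"
proof -
  have "c = restrict c (tuples G (Suc n))" using cochains_values(2)[OF c] by simp
  also have "\<dots> = (\<lambda>xs\<in>tuples G (Suc n). zero_cochain G R n xs \<oplus> c xs)"
    using cochains_values(1)[OF c] by (intro restrict_ext) (simp add: zero_cochain_def)
  finally show ?thesis unfolding mem_coset_iff using zero_cochain_mem_coboundaries by blast
qed

lemma exact_of_trivial_cohomology:
  assumes triv: "trivial_group (cohomology G R \<phi> (Suc n))"
    and f: "f \<in> C (Suc (Suc n))" "D f = \<zero>\<^bsub>chain_group\<^esub>"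
  shows "f \<in> D ` C (Suc n)"
proof -
  define c where "c = restrict f (tuples G (Suc (Suc n)))"
  define B where "B = coboundaries G R \<phi> (Suc n)"
  have c: "c \<in> cochains G R \<phi> (Suc n)" unfolding c_def by (rule restrict_mem_cochains[OF f(1)])
  have ext: "extend (Suc (Suc n)) c = f" unfolding c_def by (rule extend_restrict[OF f(1)])
  have "c \<in> carrier (cocycle_group G R \<phi> (Suc n))"
    using c cocycle_iff_D[OF c] f(2) by (simp add: cocycle_group_def ext)
  then have "B #>\<^bsub>cocycle_group G R \<phi> (Suc n)\<^esub> c \<in> carrier (cohomology G R \<phi> (Suc n))"
    by (auto simp: cohomology_def FactGroup_def RCOSETS_def B_def)
  also have "\<dots> = {B}" using triv by (simp add: trivial_group_def cohomology_def FactGroup_def B_def)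
  finally have coset: "B #>\<^bsub>cocycle_group G R \<phi> (Suc n)\<^esub> c = B" by simp
  have "c \<in> B" using mem_coset_self[OF c] coset by (simp add: B_def)
  then show ?thesis using D_mem_iff_differential[OF c] by (simp add: B_def ext)
qed

text \<open>This isolates the commutative algebra: subgroups and transfers enter only through the
  elements \<open>s\<close> that \<open>ann\<close> provides.\<close>

lemma coboundary_of_annihilated_at_small_primes:
  assumes CM: "cohen_macaulay R" "cohen_macaulay inv_ring"
    and triv: "\<And>i. 0 < i \<Longrightarrow> i < k \<Longrightarrow> trivial_group (cohomology G R \<phi> i)"
    and f: "f \<in> C (Suc k)" "D f = \<zero>\<^bsub>chain_group\<^esub>"
    and ann: "\<And>P. primeideal P R \<Longrightarrow> prime_height R P \<le> enat (Suc k) \<Longrightarrow>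
      \<exists>s\<in>Inv. s \<notin> P \<and> scale s f \<in> D ` C k"
  shows "f \<in> D ` C k"
proof -
  have S: "cring inv_ring" using CM(2) by (simp add: cohen_macaulay_def)
  interpret S: cring inv_ring by (rule S)
  define a where "a = {s \<in> Inv. scale s f \<in> D ` C k}"
  have a: "ideal a inv_ring" unfolding a_def by (rule annihilator_ideal[OF S f])
  have "\<exists>xs. length xs = Suc (Suc k) \<and> set xs \<subseteq> a \<and> regular_seq_mod {\<zero>} xs \<and> S.regular_seq_mod {\<zero>} xs"
  proof (rule exists_common_regular_seq[OF CM a])
    show "\<not> a \<subseteq> P" if "primeideal P R" "prime_height R P \<le> enat (Suc k)" for P
      using ann[OF that] by (auto simp: a_def)
  qed simp
  then obtain xs where xs: "length xs = Suc (Suc k)" "set xs \<subseteq> a" "regular_seq_mod {\<zero>} xs"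
    "S.regular_seq_mod {\<zero>} xs" by blast
  \<comment> \<open>Zero beyond the end keeps every \<open>z i\<close> invariant, as
    \<open>regular_complex\<close> has operators for all indices.\<close>
  define z where "z i = (if i < length xs then xs ! i else \<zero>)" for i
  have za: "z i \<in> a" if "i \<le> Suc k" for i using that xs(1,2) by (auto simp: z_def)
  have zI: "z i \<in> Inv" for i
    using xs(2) ideal.Icarr[OF a, of "xs ! i"] Inv_closed(1) subsetD[OF xs(2) nth_mem[of i xs]]
    by (simp add: z_def)
  have reg: "regular_mod R (adjoin_seq R z j) (z j)" "regular_mod inv_ring (adjoin_seq inv_ring z j) (z j)"
    if j: "j \<le> Suc k" for j
    using regular_seq_mod_nth[OF xs(3), of j] S.regular_seq_mod_nth[OF xs(4), of j]
      adjoin_seq_nth[of j xs z] S.adjoin_seq_nth[of j xs z] j xs(1) by (simp_all add: z_def)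
  interpret A: regular_complex chain_group C D "\<lambda>i. scale (z i)" "filtration z" k
  proof (intro regular_complex.intro regular_complex_axioms.intro chain_group_abelian)
    show "additive_subgroup (C n) chain_group" for n by (rule C_subgroup)
    \<comment> \<open>Place \<open>n + 1\<close> carries the \<open>n\<close>-cochains. Place 1 is
      exact in any case; place \<open>m + 2\<close> needs vanishing cohomology in degree
      \<open>m + 1\<close>, which is below \<open>k\<close> because
      \<open>m + 2 \<le> k\<close>.\<close>
    show "f \<in> D ` C n" if "Suc n \<le> k" "f \<in> C (Suc n)" "D f = \<zero>\<^bsub>chain_group\<^esub>" for n f
    proof (cases n)
      case 0
      then show ?thesis using exact_1 that by simp
    next
      case (Suc m)
      then show ?thesis using exact_of_trivial_cohomology[OF triv] that by simp
    qed
    show "f \<in> filtration z j n" if "j \<le> Suc k" "f \<in> C n" "scale (z j) f \<in> filtration z j n" for j n f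
      by (rule filtration_regular[OF S zI reg[OF that(1)] that(2,3)])
  qed (use zI D_closed D_add D_D scale_closed scale_add scale_D scale_scale exact_0 in auto)
  show ?thesis by (rule A.torsion_free[OF f(1)]) (use za in \<open>auto simp: a_def\<close>)
qed

lemma restricted_action:
  assumes "subgroup H G"
  shows "ring_action R (G\<lparr>carrier := H\<rparr>) \<phi>"
proof -
  interpret H: subgroup H G by (rule assms)
  show ?thesis
    by (intro ring_action.intro ring_action_axioms.intro is_cring G.subgroup_imp_group[OF assms])
      (use finite_subset[OF H.subset fin] act_hom act_comp act_id H.mem_carrier in simp_all)
qed

lemma mem_cohomology_res_iff:
  "r \<in> cohomology_res G R \<phi> n H (coboundaries G R \<phi> n #>\<^bsub>cocycle_group G R \<phi> n\<^esub> c) \<longleftrightarrow>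
     (\<exists>\<beta>\<in>coboundaries G R \<phi> n. \<exists>\<gamma>\<in>coboundaries (G\<lparr>carrier := H\<rparr>) R \<phi> n.
        r = (\<lambda>xs\<in>tuples (G\<lparr>carrier := H\<rparr>) (Suc n).
          \<gamma> xs \<oplus> restrict (\<lambda>xs\<in>tuples G (Suc n). \<beta> xs \<oplus> c xs) (tuples (G\<lparr>carrier := H\<rparr>) (Suc n)) xs))"
  by (auto simp: cohomology_res_def Let_def r_coset_def cocycle_group_def
      simp del: restrict_apply restrict_restrict)

text \<open>The restriction of \<open>c\<close> itself, with both coboundaries zero, belongs to the
  union on the left. Membership in the union on the right then supplies \<open>\<beta>\<close> and
  \<open>\<gamma>\<close>.\<close>

lemma cohomology_res_eqD:
  assumes H: "subgroup H G" and c: "c \<in> cochains G R \<phi> n"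
    and eq: "cohomology_res G R \<phi> n H (coboundaries G R \<phi> n #>\<^bsub>cocycle_group G R \<phi> n\<^esub> c) =
      cohomology_res G R \<phi> n H (coboundaries G R \<phi> n #>\<^bsub>cocycle_group G R \<phi> n\<^esub> c')"
  obtains \<beta> \<gamma> where "\<beta> \<in> coboundaries G R \<phi> n" "\<gamma> \<in> coboundaries (G\<lparr>carrier := H\<rparr>) R \<phi> n"
    "\<And>xs. xs \<in> tuples (G\<lparr>carrier := H\<rparr>) (Suc n) \<Longrightarrow> c xs = \<gamma> xs \<oplus> (\<beta> xs \<oplus> c' xs)"
proof -
  interpret H: subgroup H G by (rule H)
  let ?K = "G\<lparr>carrier := H\<rparr>"
  interpret K: ring_action R ?K \<phi> by (rule restricted_action[OF H])
  have sub: "xs \<in> tuples G (Suc n)" if "xs \<in> tuples ?K (Suc n)" for xs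
    using that H.subset by (auto simp: tuples_def)
  have "restrict c (tuples ?K (Suc n)) \<in>
    cohomology_res G R \<phi> n H (coboundaries G R \<phi> n #>\<^bsub>cocycle_group G R \<phi> n\<^esub> c)"
    unfolding mem_cohomology_res_iff
  proof (intro bexI)
    show "restrict c (tuples ?K (Suc n)) = (\<lambda>xs\<in>tuples ?K (Suc n). zero_cochain ?K R n xs \<oplus>
        restrict (\<lambda>xs\<in>tuples G (Suc n). zero_cochain G R n xs \<oplus> c xs) (tuples ?K (Suc n)) xs)"
      using cochains_values(1)[OF c] sub by (intro restrict_ext) (simp add: zero_cochain_def)
  qed (rule zero_cochain_mem_coboundaries K.zero_cochain_mem_coboundaries)+
  then obtain \<beta> \<gamma> where bg: "\<beta> \<in> coboundaries G R \<phi> n" "\<gamma> \<in> coboundaries ?K R \<phi> n"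
    and r: "restrict c (tuples ?K (Suc n)) = (\<lambda>xs\<in>tuples ?K (Suc n). \<gamma> xs \<oplus>
        restrict (\<lambda>xs\<in>tuples G (Suc n). \<beta> xs \<oplus> c' xs) (tuples ?K (Suc n)) xs)"
    unfolding eq mem_cohomology_res_iff by blast
  have "c xs = \<gamma> xs \<oplus> (\<beta> xs \<oplus> c' xs)" if "xs \<in> tuples ?K (Suc n)" for xs
    using fun_cong[OF r, of xs] sub[OF that] that by simp
  then show thesis using that bg by blast
qed

text \<open>With \<open>s\<close> equal to 1 or -1 this covers sums and differences.\<close>

lemma coboundary_add:
  assumes "\<beta> \<in> coboundaries G R \<phi> (Suc n)" "\<gamma> \<in> coboundaries G R \<phi> (Suc n)" "s \<in> Inv"
  shows "(\<lambda>xs\<in>tuples G (Suc (Suc n)). \<beta> xs \<oplus> s \<otimes> \<gamma> xs) \<in> coboundaries G R \<phi> (Suc n)"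
proof -
  obtain b where b: "b \<in> C (Suc n)" "\<beta> = restrict (D b) (tuples G (Suc (Suc n)))"
    using assms(1) unfolding coboundaries_Suc by blast
  obtain c where c: "c \<in> C (Suc n)" "\<gamma> = restrict (D c) (tuples G (Suc (Suc n)))"
    using assms(2) unfolding coboundaries_Suc by blast
  have sc: "scale s c \<in> C (Suc n)" by (rule scale_closed[OF assms(3) c(1)])
  have "D (b \<oplus>\<^bsub>chain_group\<^esub> scale s c) = D b \<oplus>\<^bsub>chain_group\<^esub> scale s (D c)"
    using D_add[OF b(1) sc] scale_D[OF assms(3) c(1)] by simp
  then have "(\<lambda>xs\<in>tuples G (Suc (Suc n)). \<beta> xs \<oplus> s \<otimes> \<gamma> xs) =
      restrict (D (b \<oplus>\<^bsub>chain_group\<^esub> scale s c)) (tuples G (Suc (Suc n)))"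
    unfolding b(2) c(2) by (intro restrict_ext) (simp add: chain_group_simps scale_def)
  then show ?thesis
    unfolding coboundaries_Suc using additive_subgroup.a_closed[OF C_subgroup b(1) sc] by blast
qed

lemma coset_eqI:
  assumes c: "c \<in> cochains G R \<phi> (Suc n)" "c' \<in> cochains G R \<phi> (Suc n)"
    and d: "\<delta> \<in> coboundaries G R \<phi> (Suc n)"
      "\<And>xs. xs \<in> tuples G (Suc (Suc n)) \<Longrightarrow> c xs = \<delta> xs \<oplus> c' xs"
  shows "coboundaries G R \<phi> (Suc n) #>\<^bsub>cocycle_group G R \<phi> (Suc n)\<^esub> c =
    coboundaries G R \<phi> (Suc n) #>\<^bsub>cocycle_group G R \<phi> (Suc n)\<^esub> c'"
proof -
  have val: "\<beta> xs \<in> carrier R" if "\<beta> \<in> coboundaries G R \<phi> (Suc n)" "xs \<in> tuples G (Suc (Suc n))" for \<beta> xs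
    using that C_D(1)[OF D_closed] unfolding coboundaries_Suc by auto
  note cv = cochains_values(1)[OF c(1)] cochains_values(1)[OF c(2)]
  define m where "m = \<zero> \<ominus> \<one>"
  have m: "m \<in> Inv" unfolding m_def by (rule Inv_closed(5)[OF Inv_closed(1,2)])
  have m_mult: "m \<otimes> a = \<ominus> a" if "a \<in> carrier R" for a
    using that by (simp add: m_def minus_eq l_minus)
  show ?thesis
  proof (rule subset_antisym; rule subsetI)
    fix e assume "e \<in> coboundaries G R \<phi> (Suc n) #>\<^bsub>cocycle_group G R \<phi> (Suc n)\<^esub> c"
    then obtain \<beta> where b: "\<beta> \<in> coboundaries G R \<phi> (Suc n)"
      "e = (\<lambda>xs\<in>tuples G (Suc (Suc n)). \<beta> xs \<oplus> c xs)" unfolding mem_coset_iff by blast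
    have "e = (\<lambda>xs\<in>tuples G (Suc (Suc n)).
        (\<lambda>xs\<in>tuples G (Suc (Suc n)). \<beta> xs \<oplus> \<one> \<otimes> \<delta> xs) xs \<oplus> c' xs)"
      unfolding b(2) by (intro restrict_ext) (simp add: d(2) val[OF b(1)] val[OF d(1)] cv a_assoc)
    then show "e \<in> coboundaries G R \<phi> (Suc n) #>\<^bsub>cocycle_group G R \<phi> (Suc n)\<^esub> c'"
      unfolding mem_coset_iff using coboundary_add[OF b(1) d(1) Inv_closed(2)] by blast
  next
    fix e assume "e \<in> coboundaries G R \<phi> (Suc n) #>\<^bsub>cocycle_group G R \<phi> (Suc n)\<^esub> c'"
    then obtain \<beta> where b: "\<beta> \<in> coboundaries G R \<phi> (Suc n)"
      "e = (\<lambda>xs\<in>tuples G (Suc (Suc n)). \<beta> xs \<oplus> c' xs)" unfolding mem_coset_iff by blast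
    have "e = (\<lambda>xs\<in>tuples G (Suc (Suc n)).
        (\<lambda>xs\<in>tuples G (Suc (Suc n)). \<beta> xs \<oplus> m \<otimes> \<delta> xs) xs \<oplus> c xs)"
      unfolding b(2)
      by (intro restrict_ext) (simp add: d(2) val[OF b(1)] val[OF d(1)] cv a_assoc m_mult r_neg2 r_neg1)
    then show "e \<in> coboundaries G R \<phi> (Suc n) #>\<^bsub>cocycle_group G R \<phi> (Suc n)\<^esub> c"
      unfolding mem_coset_iff using coboundary_add[OF b(1) d(1) m] by blast
  qed
qed

text \<open>\<open>P\<close> contains the displacement ideal of its inertia group, so it takes part
  in the infimum that defines the height of that ideal.\<close>

lemma inertia_mem_height_subgroups:
  assumes P: "primeideal P R" and ht: "prime_height R P \<le> enat j"
  shows "inertia P \<in> height_subgroups G R \<phi> j"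
proof -
  interpret P: primeideal P R by (rule P)
  have "displacement_ideal R \<phi> g \<subseteq> P" if "g \<in> inertia P" for g
    unfolding displacement_ideal_def
    by (rule genideal_minimal[OF P.is_ideal]) (use that in \<open>auto simp: inertia_def\<close>)
  then have "displacement_ideal_of R \<phi> (inertia P) \<subseteq> P"
    unfolding displacement_ideal_of_def by (intro genideal_minimal[OF P.is_ideal]) blast
  then have "ideal_height R (displacement_ideal_of R \<phi> (inertia P)) \<le> prime_height R P"
    unfolding ideal_height_def using P by (intro INF_lower) simp
  then show ?thesis
    unfolding height_subgroups_def using ht inertia_subgroup[OF P.is_ideal] by auto
qed

text \<open>In a nonzero ring the zero ideal has an associated prime, and unmixedness for the empty
  sequence gives it height 0. Restriction to the trivial subgroup is what detects classes of degree
  0.\<close>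

lemma trivial_mem_height_subgroups:
  assumes CM: "cohen_macaulay R" and ne: "\<one> \<noteq> \<zero>"
  shows "{\<one>\<^bsub>G\<^esub>} \<in> height_subgroups G R \<phi> j"
proof -
  interpret noetherian_cring R using CM by (simp add: noetherian_cring_def cohen_macaulay_def)
  have "{\<zero>} \<noteq> carrier R" using ne one_closed by blast
  then obtain P where P: "P \<in> assoc_primes R {\<zero>}" using assoc_primes_nonempty[OF zeroideal] by blast
  then have prime: "primeideal P R" by (simp add: assoc_primes_def)
  interpret P: primeideal P R by (rule prime)
  have "prime_height R P \<le> enat 0" using assoc_prime_height_le[OF CM, of "[]"] P by simp
  also have "\<dots> \<le> enat j" by simp
  finally have ht: "prime_height R P \<le> enat j" .
  have "displacement_ideal R \<phi> \<one>\<^bsub>G\<^esub> \<subseteq> P"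
    unfolding displacement_ideal_def
    by (rule genideal_minimal[OF P.is_ideal]) (auto simp: act_id minus_eq r_neg)
  then have "displacement_ideal_of R \<phi> {\<one>\<^bsub>G\<^esub>} \<subseteq> P"
    unfolding displacement_ideal_of_def by (intro genideal_minimal[OF P.is_ideal]) simp
  then have "ideal_height R (displacement_ideal_of R \<phi> {\<one>\<^bsub>G\<^esub>}) \<le> prime_height R P"
    unfolding ideal_height_def using prime by (intro INF_lower) simp
  then show ?thesis unfolding height_subgroups_def using ht G.triv_subgroup by auto
qed

lemma restriction_injective:
  assumes CM: "cohen_macaulay R" "cohen_macaulay inv_ring"
    and triv: "\<And>i. 0 < i \<Longrightarrow> i < k \<Longrightarrow> trivial_group (cohomology G R \<phi> i)"
  shows "inj_on (cohomology_res_family G R \<phi> k (height_subgroups G R \<phi> (k + 1)))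
    (carrier (cohomology G R \<phi> k))"
proof (rule inj_onI)
  fix \<xi> \<xi>' assume xi: "\<xi> \<in> carrier (cohomology G R \<phi> k)" "\<xi>' \<in> carrier (cohomology G R \<phi> k)"
    and fam: "cohomology_res_family G R \<phi> k (height_subgroups G R \<phi> (k + 1)) \<xi> =
      cohomology_res_family G R \<phi> k (height_subgroups G R \<phi> (k + 1)) \<xi>'"
  let ?coset = "\<lambda>c. coboundaries G R \<phi> k #>\<^bsub>cocycle_group G R \<phi> k\<^esub> c"
  obtain c where c: "\<xi> = ?coset c" "c \<in> cochains G R \<phi> k" "differential G R k c = zero_cochain G R (Suc k)"
    using xi(1) by (auto simp: cohomology_def carrier_FactGroup cocycle_group_def)
  obtain c' where c': "\<xi>' = ?coset c'" "c' \<in> cochains G R \<phi> k" "differential G R k c' = zero_cochain G R (Suc k)"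
    using xi(2) by (auto simp: cohomology_def carrier_FactGroup cocycle_group_def)
  have res: "cohomology_res G R \<phi> k H (?coset c) = cohomology_res G R \<phi> k H (?coset c')"
    if "H \<in> height_subgroups G R \<phi> (Suc k)" for H
    using fun_cong[OF fam, of H] that by (simp add: cohomology_res_family_def c(1) c'(1))
  note cv = cochains_values(1)[OF c(2)] cochains_values(1)[OF c'(2)]
  show "\<xi> = \<xi>'"
  proof (cases k)
    case 0
    \<comment> \<open>In place 1 the augmented complex divides by the invariants and would lose
      everything. Instead, a 0-cochain is determined by its value at the unit, which the trivial
      subgroup sees.\<close>
    have "c xs = c' xs" if xs: "xs \<in> tuples G (Suc 0)" for xs
    proof (cases "\<one> = \<zero>")
      \<comment> \<open>The zero ring has no primes, so every displacement ideal has infinite height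
        and the family is empty; but then all values coincide.\<close>
      case True
      have "a = \<zero>" if "a \<in> carrier R" for a
        using that True l_one[OF that] l_null[OF that] by simp
      then show ?thesis using cv xs 0 by metis
    next
      case False
      have H: "{\<one>\<^bsub>G\<^esub>} \<in> height_subgroups G R \<phi> (Suc k)" by (rule trivial_mem_height_subgroups[OF CM(1) False])
      then have "subgroup {\<one>\<^bsub>G\<^esub>} G" by (simp add: height_subgroups_def)
      from this c(2) res[OF H] obtain \<beta> \<gamma> where "\<beta> \<in> coboundaries G R \<phi> k"
        "\<gamma> \<in> coboundaries (G\<lparr>carrier := {\<one>\<^bsub>G\<^esub>}\<rparr>) R \<phi> k"
        "\<And>xs. xs \<in> tuples (G\<lparr>carrier := {\<one>\<^bsub>G\<^esub>}\<rparr>) (Suc k) \<Longrightarrow> c xs = \<gamma> xs \<oplus> (\<beta> xs \<oplus> c' xs)"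
        by (rule cohomology_res_eqD) blast
      moreover have one: "[\<one>\<^bsub>G\<^esub>] \<in> tuples (G\<lparr>carrier := {\<one>\<^bsub>G\<^esub>}\<rparr>) (Suc k)" "[\<one>\<^bsub>G\<^esub>] \<in> tuples G (Suc k)"
        by (simp_all add: tuples_def 0)
      ultimately have c1: "c [\<one>\<^bsub>G\<^esub>] = c' [\<one>\<^bsub>G\<^esub>]"
        using cv(2)[OF one(2)] 0 by (simp add: zero_cochain_def)
      obtain g where g: "xs = [g]" "g \<in> carrier G" using xs by (auto simp: tuples_def length_Suc_conv)
      have "e [g] = \<phi> g (e [\<one>\<^bsub>G\<^esub>])" if "e \<in> cochains G R \<phi> k" for e
      proof -
        have "e (map (\<lambda>x. g \<otimes>\<^bsub>G\<^esub> x) [\<one>\<^bsub>G\<^esub>]) = \<phi> g (e [\<one>\<^bsub>G\<^esub>])"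
          using that g(2) one(2) unfolding cochains_def by blast
        then show ?thesis using g(2) by simp
      qed
      then show ?thesis using c1 c(2) c'(2) g(1) by metis
    qed
    then have "restrict c (tuples G (Suc 0)) = restrict c' (tuples G (Suc 0))" by (intro restrict_ext)
    then have "c = c'" using cochains_values(2)[OF c(2)] cochains_values(2)[OF c'(2)] 0 by simp
    then show ?thesis by (simp add: c(1) c'(1))
  next
    case (Suc n)
    \<comment> \<open>The invariant scalar -1, by which the difference \<open>f\<close> of the two
      cocycles is formed with \<open>scale\<close>; injectivity on classes becomes a statement about
      \<open>f\<close> alone.\<close>
    define m where "m = \<zero> \<ominus> \<one>"
    have m: "m \<in> Inv" unfolding m_def by (rule Inv_closed(5)[OF Inv_closed(1,2)])
    have m_mult: "m \<otimes> a = \<ominus> a" if "a \<in> carrier R" for a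
      using that by (simp add: m_def minus_eq l_minus)
    define E where "E = extend (Suc k) c"
    define E' where "E' = extend (Suc k) c'"
    have E: "E \<in> C (Suc k)" "E' \<in> C (Suc k)" unfolding E_def E'_def by (intro extend_mem_C c(2) c'(2))+
    have DE: "D E = \<zero>\<^bsub>chain_group\<^esub>" "D E' = \<zero>\<^bsub>chain_group\<^esub>"
      unfolding E_def E'_def using cocycle_iff_D[OF c(2)] cocycle_iff_D[OF c'(2)] c(3) c'(3) by simp_all
    define f where "f = E \<oplus>\<^bsub>chain_group\<^esub> scale m E'"
    have mE': "scale m E' \<in> C (Suc k)" by (rule scale_closed[OF m E(2)])
    have f: "f \<in> C (Suc k)" unfolding f_def by (rule additive_subgroup.a_closed[OF C_subgroup E(1) mE'])
    have "D f = D E \<oplus>\<^bsub>chain_group\<^esub> scale m (D E')"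
      unfolding f_def D_add[OF E(1) mE'] scale_D[OF m E(2)] ..
    then have Df: "D f = \<zero>\<^bsub>chain_group\<^esub>"
      using Inv_carrier[OF m] by (simp add: DE chain_group_simps scale_def)
    have f_val: "f xs = c xs \<ominus> c' xs" if "xs \<in> tuples G (Suc k)" for xs
      using that cv(2)[OF that] m_mult by (simp add: f_def chain_group_simps scale_def E_def E'_def extend_def minus_eq)
    have "f \<in> D ` C k"
    proof (rule coboundary_of_annihilated_at_small_primes[OF CM triv f Df])
      fix P assume P: "primeideal P R" "prime_height R P \<le> enat (Suc k)"
      interpret P: primeideal P R by (rule P(1))
      define H where "H = inertia P"
      have H: "subgroup H G" unfolding H_def by (rule inertia_subgroup[OF P.is_ideal])
      interpret H: subgroup H G by (rule H)
      let ?K = "G\<lparr>carrier := H\<rparr>"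
      interpret K: ring_action R ?K \<phi> by (rule restricted_action[OF H])
      have "H \<in> height_subgroups G R \<phi> (Suc k)" unfolding H_def by (rule inertia_mem_height_subgroups[OF P])
      from H c(2) res[OF this] obtain \<beta> \<gamma> where bg: "\<beta> \<in> coboundaries G R \<phi> k" "\<gamma> \<in> coboundaries ?K R \<phi> k"
        "\<And>xs. xs \<in> tuples ?K (Suc k) \<Longrightarrow> c xs = \<gamma> xs \<oplus> (\<beta> xs \<oplus> c' xs)"
        by (rule cohomology_res_eqD) blast
      obtain b where b: "b \<in> C k" "\<beta> = restrict (D b) (tuples G (Suc k))"
        using bg(1) unfolding Suc coboundaries_Suc by blast
      obtain b' where b': "b' \<in> K.C k" "\<gamma> = restrict (K.D b') (tuples ?K (Suc k))"
        using bg(2) unfolding Suc K.coboundaries_Suc by blast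
      have sub: "xs \<in> tuples G j" if "xs \<in> tuples ?K j" for xs j
        using that H.subset by (auto simp: tuples_def)
      obtain x where x: "x \<in> fixed H" "(\<Oplus>t\<in>transversal H. \<phi> t x) \<notin> P"
        using transfer_not_mem_prime[OF P(1)] unfolding H_def by blast
      \<comment> \<open>On tuples of \<open>H\<close> the difference \<open>f\<close> has the
        primitive \<open>b' + b\<close>, one summand from each of the two coboundaries. It is
        equivariant under \<open>H\<close>, as \<open>transfer_annihilates\<close> asks.\<close>
      have bc: "b' xs \<oplus> b xs \<in> carrier R" for xs using C_D(1)[OF b(1)] K.C_D(1)[OF b'(1)] by simp
      have equiv: "b' (map (\<lambda>y. h \<otimes>\<^bsub>G\<^esub> y) xs) \<oplus> b (map (\<lambda>y. h \<otimes>\<^bsub>G\<^esub> y) xs) = \<phi> h (b' xs \<oplus> b xs)"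
        if h: "h \<in> H" and xs: "xs \<in> lists H" "length xs = k" for h xs
      proof -
        have t: "xs \<in> tuples ?K k" using xs by (auto simp: tuples_def)
        have hc: "h \<in> carrier G" by (rule H.mem_carrier[OF h])
        show ?thesis
          using C_D(3)[OF b(1) hc sub[OF t]] K.C_D(3)[OF b'(1) _ t, of h] h
            act_add[OF hc K.C_D(1)[OF b'(1)] C_D(1)[OF b(1)]] by simp
      qed
      have prim: "f xs = bd (\<lambda>xs. b' xs \<oplus> b xs) xs" if xs: "xs \<in> lists H" "length xs = Suc k" for xs
      proof -
        have t: "xs \<in> tuples ?K (Suc k)" using xs by (auto simp: tuples_def)
        have "xs \<in> lists (carrier G)" using xs(1) H.subset by auto
        then have "\<gamma> xs = bd b' xs" "\<beta> xs = bd b xs"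
          using t sub[OF t] xs(1) by (simp_all add: b(2) b'(2) D_def K.D_def)
        moreover have v: "bd b' xs \<in> carrier R" "bd b xs \<in> carrier R"
          by (rule bd_closed[OF xs(1)]; use C_D(1)[OF b(1)] K.C_D(1)[OF b'(1)] in simp)+
        ultimately have "f xs = (bd b' xs \<oplus> (bd b xs \<oplus> c' xs)) \<ominus> c' xs"
          using f_val[OF sub[OF t]] bg(3)[OF t] by simp
        also have "\<dots> = bd b' xs \<oplus> bd b xs" using v cv(2)[OF sub[OF t]] by algebra
        also have "\<dots> = bd (\<lambda>xs. b' xs \<oplus> b xs) xs"
          by (rule bd_add[OF xs(1), symmetric]) (use C_D(1)[OF b(1)] K.C_D(1)[OF b'(1)] in simp_all)
        finally show ?thesis .
      qed
      note tr = transfer_annihilates[OF H x(1) f Df, of "\<lambda>xs. b' xs \<oplus> b xs", OF bc equiv prim]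
      show "\<exists>s\<in>Inv. s \<notin> P \<and> scale s f \<in> D ` C k" using tr x(2) by blast
    qed
    then obtain b where b: "b \<in> C (Suc n)" "f = D b" using Suc by blast
    define \<delta> where "\<delta> = restrict (D b) (tuples G (Suc (Suc n)))"
    have d: "\<delta> \<in> coboundaries G R \<phi> (Suc n)" unfolding coboundaries_Suc \<delta>_def using b(1) by blast
    have "c xs = \<delta> xs \<oplus> c' xs" if "xs \<in> tuples G (Suc (Suc n))" for xs
    proof -
      have "\<delta> xs = c xs \<ominus> c' xs" using f_val[of xs] that Suc by (simp add: \<delta>_def flip: b(2))
      then show ?thesis using cv[of xs] that Suc by (simp add: minus_eq a_assoc l_neg)
    qed
    then show ?thesis
      using coset_eqI[OF _ _ d] c(1,2) c'(1,2) Suc by simp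
  qed
qed

end

theorem proposition1p4:
  fixes G :: "('g, 'm) monoid_scheme"
    and R :: "('r, 'n) ring_scheme"
    and \<phi> :: "'g \<Rightarrow> 'r \<Rightarrow> 'r"
    and k :: nat
  assumes "group G" and "finite (carrier G)"
    and "cring R"
    and "group_action G (carrier R) \<phi>"
    and "\<And>g. g \<in> carrier G \<Longrightarrow> \<phi> g \<in> ring_iso R R"
    and "noetherian_module (invariant_ring G R \<phi>) (mult_module R)"
    and "cohen_macaulay R"
    and "cohen_macaulay (invariant_ring G R \<phi>)"
    and "\<And>i. 0 < i \<Longrightarrow> i < k \<Longrightarrow> trivial_group (cohomology G R \<phi> i)"
  shows "inj_on (cohomology_res_family G R \<phi> k (height_subgroups G R \<phi> (k + 1)))
           (carrier (cohomology G R \<phi> k))"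
proof -
  interpret group_action G "carrier R" \<phi> by (rule assms(4))
  interpret ring_action R G \<phi>
  proof (intro ring_action.intro ring_action_axioms.intro assms(1-3))
    show "\<phi> g \<in> ring_hom R R" if "g \<in> carrier G" for g
      using assms(5)[OF that] by (simp add: ring_iso_def)
    show "\<phi> (g \<otimes>\<^bsub>G\<^esub> h) r = \<phi> g (\<phi> h r)" if "g \<in> carrier G" "h \<in> carrier G" "r \<in> carrier R" for g h r
      using composition_rule that by simp
    show "\<phi> \<one>\<^bsub>G\<^esub> r = r" if "r \<in> carrier R" for r
      using id_eq_one that by (metis restrict_apply')
  qed
  show ?thesis by (rule restriction_injective[OF assms(7-9)])
qed

end
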